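(* Let $R$ be a (commutative) Cohen-Macaulay complete local ring with coefficient field $k$. Then the canonical module $\omega_R$ of $R$ admits a compatible right $D_{R|k}$-module structure.
   Context: For a commutative $k$-algebra $R$, identify $f\in R$ with the operator $g\mapsto fg$ on $R$, so that $R\subseteq \operatorname{End}_k(R)$. Define inductively $D^0_{R|k}=R$ and $D^n_{R|k}=\{\xi\in\operatorname{End}_k(R): [\xi,f]\in D^{n-1}_{R|k}\text{ for all } f\in R\}$. The ring of $k$-linear differential operators on $R$ is $D_{R|k}=\bigcup_{n\ge 0}D^n_{R|k}\subseteq\operatorname{End}_k(R)$. A (right or left) $D_{R|k}$-module structure on an $R$-module $M$ is compatible if it extends the already-existing $R$-module structure on $M$. A coefficient field of a local ring $(R,\mathfrak m)$ is a subfield $k\subseteq R$ mapping isomorphically onto $R/\mathfrak m$. *)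

theory Defs
  imports "HOL-Algebra.Ring_Divisibility" "HOL-Algebra.Ideal_Product" "HOL-Algebra.Subrings"
    "HOL-Algebra.Module" "HOL-Library.Extended_Nat"
begin

section \<open>Complete local rings, Cohen-Macaulay rings, coefficient fields\<close>

text \<open>As usual in commutative algebra, local rings are Noetherian.\<close>

locale noetherian_local_ring = cring R + noetherian_ring R
  for R :: "('a, 'r) ring_scheme" (structure) and \<mm> :: "'a set" +
  assumes maximal: "maximalideal \<mm> R"
    and unique_maximal: "maximalideal J R \<Longrightarrow> J = \<mm>"

text \<open>Completeness says that the canonical map from \<open>R\<close> to the inverse limit of the rings
  \<open>R/\<mm>\<^sup>n\<close> is injective and surjective. An element of that limit is given by a sequence
  \<open>r\<close> with \<open>r (n + 1) \<equiv> r n\<close> modulo \<open>\<mm>\<^sup>n\<close>. Powers of ideals are taken in the library's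
  monoid of ideals.\<close>

locale complete_local_ring = noetherian_local_ring +
  assumes separated: "(\<Inter>n::nat. \<mm> [^]\<^bsub>ideals_set R\<^esub> n) = {\<zero>}"
    and limits: "\<lbrakk> \<And>n::nat. r n \<in> carrier R;
        \<And>n. r (Suc n) \<ominus> r n \<in> \<mm> [^]\<^bsub>ideals_set R\<^esub> n \<rbrakk>
      \<Longrightarrow> \<exists>x\<in>carrier R. \<forall>n. x \<ominus> r n \<in> \<mm> [^]\<^bsub>ideals_set R\<^esub> n"

definition krull_dim :: "('a, 'r) ring_scheme \<Rightarrow> enat" where
  "krull_dim R = Sup {enat n | n. \<exists>P. (\<forall>i\<le>n. primeideal (P i) R) \<and> (\<forall>i<n. P i \<subset> P (Suc i))}"

text \<open>The second condition says that \<open>xs ! i\<close> is a nonzerodivisor modulo the preceding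
  elements.\<close>

definition regular_sequence :: "('a, 'r) ring_scheme \<Rightarrow> 'a list \<Rightarrow> bool" where
  "regular_sequence R xs \<longleftrightarrow> set xs \<subseteq> carrier R \<and>
     (\<forall>i<length xs. \<forall>r\<in>carrier R. xs ! i \<otimes>\<^bsub>R\<^esub> r \<in> Idl\<^bsub>R\<^esub> set (take i xs)
        \<longrightarrow> r \<in> Idl\<^bsub>R\<^esub> set (take i xs)) \<and>
     Idl\<^bsub>R\<^esub> set xs \<noteq> carrier R"

definition depth :: "('a, 'r) ring_scheme \<Rightarrow> 'a set \<Rightarrow> enat" where
  "depth R \<mm> = Sup {enat (length xs) | xs. regular_sequence R xs \<and> set xs \<subseteq> \<mm>}"

definition cohen_macaulay :: "('a, 'r) ring_scheme \<Rightarrow> 'a set \<Rightarrow> bool" where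
  "cohen_macaulay R \<mm> \<longleftrightarrow> noetherian_local_ring R \<mm> \<and> depth R \<mm> = krull_dim R"

definition coefficient_field :: "('a, 'r) ring_scheme \<Rightarrow> 'a set \<Rightarrow> 'a set \<Rightarrow> bool" where
  "coefficient_field R \<mm> K \<longleftrightarrow>
     subfield K R \<and> (\<lambda>x. \<mm> +>\<^bsub>R\<^esub> x) \<in> ring_iso (R\<lparr>carrier := K\<rparr>) (R Quot \<mm>)"


section \<open>Modules\<close>

text \<open>The \<open>mult\<close> and \<open>one\<close> fields of a \<open>module\<close> record play no role in the notion of a module;
  below they are \<open>undefined\<close> where there is no natural choice.\<close>

definition mod_hom ::
  "('a, 'r) ring_scheme \<Rightarrow> ('a, 'b, 's) module_scheme \<Rightarrow> ('a, 'c, 't) module_scheme \<Rightarrow> ('b \<Rightarrow> 'c) set"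
where
  "mod_hom R M N = {f \<in> carrier M \<rightarrow> carrier N.
     (\<forall>x\<in>carrier M. \<forall>y\<in>carrier M. f (x \<oplus>\<^bsub>M\<^esub> y) = f x \<oplus>\<^bsub>N\<^esub> f y) \<and>
     (\<forall>a\<in>carrier R. \<forall>x\<in>carrier M. f (a \<odot>\<^bsub>M\<^esub> x) = a \<odot>\<^bsub>N\<^esub> f x)}"

definition mod_isomorphic ::
  "('a, 'r) ring_scheme \<Rightarrow> ('a, 'b, 's) module_scheme \<Rightarrow> ('a, 'c, 't) module_scheme \<Rightarrow> bool"
where
  "mod_isomorphic R M N \<longleftrightarrow> (\<exists>f\<in>mod_hom R M N. bij_betw f (carrier M) (carrier N))"

definition Hom_module ::
  "('a, 'r) ring_scheme \<Rightarrow> ('a, 'b, 's) module_scheme \<Rightarrow> ('a, 'c, 't) module_scheme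
    \<Rightarrow> ('a, 'b \<Rightarrow> 'c) module"
where
  "Hom_module R M N =
     \<lparr>carrier = mod_hom R M N \<inter> extensional (carrier M),
      monoid.mult = undefined, one = undefined,
      ring.zero = (\<lambda>x\<in>carrier M. \<zero>\<^bsub>N\<^esub>),
      add = (\<lambda>f g. \<lambda>x\<in>carrier M. f x \<oplus>\<^bsub>N\<^esub> g x),
      smult = (\<lambda>a f. \<lambda>x\<in>carrier M. a \<odot>\<^bsub>N\<^esub> f x)\<rparr>"

definition quotient_module :: "('a, 'b, 's) module_scheme \<Rightarrow> 'b set \<Rightarrow> ('a, 'b set) module" where
  "quotient_module M N =
     \<lparr>carrier = a_rcosets\<^bsub>M\<^esub> N,
      monoid.mult = undefined, one = undefined,
      ring.zero = N,
      add = set_add M,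
      smult = (\<lambda>a X. \<Union>x\<in>X. N +>\<^bsub>M\<^esub> (a \<odot>\<^bsub>M\<^esub> x))\<rparr>"

definition product_module ::
  "'i set \<Rightarrow> ('i \<Rightarrow> ('a, 'b, 's) module_scheme) \<Rightarrow> ('a, 'i \<Rightarrow> 'b) module"
where
  "product_module A M =
     \<lparr>carrier = (\<Pi>\<^sub>E i\<in>A. carrier (M i)),
      monoid.mult = undefined, one = undefined,
      ring.zero = (\<lambda>i\<in>A. \<zero>\<^bsub>M i\<^esub>),
      add = (\<lambda>f g. \<lambda>i\<in>A. f i \<oplus>\<^bsub>M i\<^esub> g i),
      smult = (\<lambda>a f. \<lambda>i\<in>A. a \<odot>\<^bsub>M i\<^esub> f i)\<rparr>"

definition regular_module :: "('a, 'r) ring_scheme \<Rightarrow> ('a, 'a) module" where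
  "regular_module R =
     \<lparr>carrier = carrier R, monoid.mult = monoid.mult R, one = one R,
      ring.zero = ring.zero R, add = add R, smult = monoid.mult R\<rparr>"

definition finitely_generated :: "('a, 'r) ring_scheme \<Rightarrow> ('a, 'b, 's) module_scheme \<Rightarrow> bool" where
  "finitely_generated R M \<longleftrightarrow>
     (\<exists>S. finite S \<and> S \<subseteq> carrier M \<and> (\<forall>N. submodule N R M \<and> S \<subseteq> N \<longrightarrow> N = carrier M))"

text \<open>Homomorphisms into \<open>E\<close> extend from submodules. A HOL definition cannot quantify over modules
  on all types; \<open>B\<close> ranges over the modules whose elements lie in the type of the elements of
  \<open>R\<close>. Nothing is lost: the inclusions of ideals into \<open>R\<close> are among the cases considered, and by
  Baer's criterion these already imply the extension property for all modules.\<close>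

definition injective_module :: "('a, 'r) ring_scheme \<Rightarrow> ('a, 'e, 's) module_scheme \<Rightarrow> bool" where
  "injective_module R E \<longleftrightarrow> module R E \<and>
     (\<forall>(B :: ('a, 'a) module) A f.
        module R B \<and> submodule A R B \<and> f \<in> mod_hom R (B\<lparr>carrier := A\<rparr>) E
        \<longrightarrow> (\<exists>g\<in>mod_hom R B E. \<forall>x\<in>A. g x = f x))"

definition injective_hull ::
  "('a, 'r) ring_scheme \<Rightarrow> ('a, 'b, 's) module_scheme \<Rightarrow> ('a, 'e, 't) module_scheme \<Rightarrow> bool"
where
  "injective_hull R N E \<longleftrightarrow> injective_module R E \<and>
     (\<exists>\<iota>\<in>mod_hom R N E. inj_on \<iota> (carrier N) \<and>
        (\<forall>A. submodule A R E \<and> A \<noteq> {\<zero>\<^bsub>E\<^esub>} \<longrightarrow> A \<inter> \<iota> ` carrier N \<noteq> {\<zero>\<^bsub>E\<^esub>}))"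


section \<open>Localization\<close>

text \<open>Here \<open>S\<close> is a multiplicative set; the pair \<open>(r, s)\<close> stands for the fraction \<open>r/s\<close>.\<close>

definition loc_rel :: "('a, 'r) ring_scheme \<Rightarrow> 'a set \<Rightarrow> (('a \<times> 'a) \<times> ('a \<times> 'a)) set" where
  "loc_rel R S = {((r, s), (r', s')). r \<in> carrier R \<and> s \<in> S \<and> r' \<in> carrier R \<and> s' \<in> S \<and>
     (\<exists>u\<in>S. u \<otimes>\<^bsub>R\<^esub> (s' \<otimes>\<^bsub>R\<^esub> r \<ominus>\<^bsub>R\<^esub> s \<otimes>\<^bsub>R\<^esub> r') = \<zero>\<^bsub>R\<^esub>)}"

definition loc_frac :: "('a, 'r) ring_scheme \<Rightarrow> 'a set \<Rightarrow> 'a \<Rightarrow> 'a \<Rightarrow> ('a \<times> 'a) set" where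
  "loc_frac R S r s = loc_rel R S `` {(r, s)}"

definition localization ::
  "('a, 'r) ring_scheme \<Rightarrow> 'a set \<Rightarrow> ('a, ('a \<times> 'a) set) module"
where
  "localization R S =
     \<lparr>carrier = (carrier R \<times> S) // loc_rel R S,
      monoid.mult = (\<lambda>X Y. \<Union>(r, s)\<in>X. \<Union>(r', s')\<in>Y. loc_frac R S (r \<otimes>\<^bsub>R\<^esub> r') (s \<otimes>\<^bsub>R\<^esub> s')),
      one = loc_frac R S \<one>\<^bsub>R\<^esub> \<one>\<^bsub>R\<^esub>,
      ring.zero = loc_frac R S \<zero>\<^bsub>R\<^esub> \<one>\<^bsub>R\<^esub>,
      add = (\<lambda>X Y. \<Union>(r, s)\<in>X. \<Union>(r', s')\<in>Y.
               loc_frac R S (s' \<otimes>\<^bsub>R\<^esub> r \<oplus>\<^bsub>R\<^esub> s \<otimes>\<^bsub>R\<^esub> r') (s \<otimes>\<^bsub>R\<^esub> s')),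
      smult = (\<lambda>a X. \<Union>(r, s)\<in>X. loc_frac R S (a \<otimes>\<^bsub>R\<^esub> r) s)\<rparr>"

text \<open>The canonical map between the localizations at multiplicative sets \<open>S \<subseteq> T\<close>, sending the
  class of \<open>(r, s)\<close> for \<open>S\<close> to the class of \<open>(r, s)\<close> for \<open>T\<close>.
\<close>

definition loc_map :: "('a, 'r) ring_scheme \<Rightarrow> 'a set \<Rightarrow> ('a \<times> 'a) set \<Rightarrow> ('a \<times> 'a) set" where
  "loc_map R T X = (\<Union>(r, s)\<in>X. loc_frac R T r s)"


section \<open>Local cohomology via the Cech complex\<close>

text \<open>The set of monomials in the \<open>xs ! i\<close>, \<open>i \<in> I\<close>. Localizing at it is the same as inverting the
  single element \<open>\<Prod>i\<in>I. xs ! i\<close>.\<close>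

definition monomials :: "('a, 'r) ring_scheme \<Rightarrow> 'a list \<Rightarrow> nat set \<Rightarrow> 'a set" where
  "monomials R xs I = {(\<Otimes>\<^bsub>R\<^esub>i\<in>I. (xs ! i) [^]\<^bsub>R\<^esub> e i) | e :: nat \<Rightarrow> nat. True}"

definition cech_indices :: "'a list \<Rightarrow> nat \<Rightarrow> nat set set" where
  "cech_indices xs p = {I. I \<subseteq> {..<length xs} \<and> card I = p}"

definition cech_module ::
  "('a, 'r) ring_scheme \<Rightarrow> 'a list \<Rightarrow> nat \<Rightarrow> ('a, nat set \<Rightarrow> ('a \<times> 'a) set) module"
where
  "cech_module R xs p =
     product_module (cech_indices xs p) (\<lambda>I. localization R (monomials R xs I))"

definition cech_diff ::
  "('a, 'r) ring_scheme \<Rightarrow> 'a list \<Rightarrow> nat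
    \<Rightarrow> (nat set \<Rightarrow> ('a \<times> 'a) set) \<Rightarrow> (nat set \<Rightarrow> ('a \<times> 'a) set)"
where
  "cech_diff R xs p c = (\<lambda>J\<in>cech_indices xs (Suc p).
     \<Oplus>\<^bsub>localization R (monomials R xs J)\<^esub>j\<in>J.
       (let y = loc_map R (monomials R xs J) (c (J - {j}))
        in if even (card {i \<in> J. i < j}) then y else \<ominus>\<^bsub>localization R (monomials R xs J)\<^esub> y))"

definition cech_cocycles ::
  "('a, 'r) ring_scheme \<Rightarrow> 'a list \<Rightarrow> nat \<Rightarrow> (nat set \<Rightarrow> ('a \<times> 'a) set) set"
where
  "cech_cocycles R xs p =
     {c \<in> carrier (cech_module R xs p). cech_diff R xs p c = \<zero>\<^bsub>cech_module R xs (Suc p)\<^esub>}"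

definition cech_boundaries ::
  "('a, 'r) ring_scheme \<Rightarrow> 'a list \<Rightarrow> nat \<Rightarrow> (nat set \<Rightarrow> ('a \<times> 'a) set) set"
where
  "cech_boundaries R xs p = (case p of
      0 \<Rightarrow> {\<zero>\<^bsub>cech_module R xs 0\<^esub>}
    | Suc q \<Rightarrow> cech_diff R xs q ` carrier (cech_module R xs q))"

definition cech_cohomology ::
  "('a, 'r) ring_scheme \<Rightarrow> 'a list \<Rightarrow> nat \<Rightarrow> ('a, (nat set \<Rightarrow> ('a \<times> 'a) set) set) module"
where
  "cech_cohomology R xs p =
     quotient_module ((cech_module R xs p)\<lparr>carrier := cech_cocycles R xs p\<rparr>)
       (cech_boundaries R xs p)"

text \<open>The local cohomology of \<open>R\<close> with support in a finitely generated ideal \<open>I\<close>: Cech cohomology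
  for a finite sequence of generators of \<open>I\<close>. Up to isomorphism the result does not depend on
  the chosen generators.\<close>

definition local_cohomology ::
  "('a, 'r) ring_scheme \<Rightarrow> 'a set \<Rightarrow> nat \<Rightarrow> ('a, (nat set \<Rightarrow> ('a \<times> 'a) set) set) module"
where
  "local_cohomology R I p =
     cech_cohomology R (SOME xs. set xs \<subseteq> carrier R \<and> Idl\<^bsub>R\<^esub> set xs = I) p"


section \<open>Canonical modules\<close>

text \<open>\<open>E\<close> is meant to be an injective hull of the residue field \<open>R/\<mm>\<close>. A canonical module is a
  finitely generated module whose Matlis dual is the top local cohomology module of \<open>R\<close>
  (Brodmann and Sharp, Local Cohomology, Chapter 12).\<close>

definition residue_module :: "('a, 'r) ring_scheme \<Rightarrow> 'a set \<Rightarrow> ('a, 'a set) module" where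
  "residue_module R \<mm> = quotient_module (regular_module R) \<mm>"

definition canonical_module ::
  "('a, 'r) ring_scheme \<Rightarrow> 'a set \<Rightarrow> ('a, 'e, 's) module_scheme \<Rightarrow> ('a, 'w, 't) module_scheme \<Rightarrow> bool"
where
  "canonical_module R \<mm> E W \<longleftrightarrow> module R W \<and> finitely_generated R W \<and>
     mod_isomorphic R (Hom_module R W E) (local_cohomology R \<mm> (the_enat (krull_dim R)))"


section \<open>Differential operators\<close>

text \<open>Operators on \<open>R\<close> are functions that are \<open>undefined\<close> outside \<open>carrier R\<close>, so that equality of
  operators is equality of functions. Multiplication is composition.\<close>

definition End_ring :: "('a, 'r) ring_scheme \<Rightarrow> 'a set \<Rightarrow> ('a \<Rightarrow> 'a) ring" where
  "End_ring R K =
     \<lparr>carrier = {\<xi> \<in> carrier R \<rightarrow>\<^sub>E carrier R.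
        (\<forall>x\<in>carrier R. \<forall>y\<in>carrier R. \<xi> (x \<oplus>\<^bsub>R\<^esub> y) = \<xi> x \<oplus>\<^bsub>R\<^esub> \<xi> y) \<and>
        (\<forall>c\<in>K. \<forall>x\<in>carrier R. \<xi> (c \<otimes>\<^bsub>R\<^esub> x) = c \<otimes>\<^bsub>R\<^esub> \<xi> x)},
      monoid.mult = compose (carrier R),
      one = (\<lambda>x\<in>carrier R. x),
      ring.zero = (\<lambda>x\<in>carrier R. \<zero>\<^bsub>R\<^esub>),
      add = (\<lambda>\<xi> \<eta>. \<lambda>x\<in>carrier R. \<xi> x \<oplus>\<^bsub>R\<^esub> \<eta> x)\<rparr>"

definition mult_op :: "('a, 'r) ring_scheme \<Rightarrow> 'a \<Rightarrow> 'a \<Rightarrow> 'a" where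
  "mult_op R f = (\<lambda>g\<in>carrier R. f \<otimes>\<^bsub>R\<^esub> g)"

definition commutator :: "('b, 's) ring_scheme \<Rightarrow> 'b \<Rightarrow> 'b \<Rightarrow> 'b" where
  "commutator A \<xi> \<eta> = \<xi> \<otimes>\<^bsub>A\<^esub> \<eta> \<ominus>\<^bsub>A\<^esub> \<eta> \<otimes>\<^bsub>A\<^esub> \<xi>"

primrec diff_ops_order :: "('a, 'r) ring_scheme \<Rightarrow> 'a set \<Rightarrow> nat \<Rightarrow> ('a \<Rightarrow> 'a) set" where
  "diff_ops_order R K 0 = mult_op R ` carrier R"
| "diff_ops_order R K (Suc n) = {\<xi> \<in> carrier (End_ring R K).
     \<forall>f\<in>carrier R. commutator (End_ring R K) \<xi> (mult_op R f) \<in> diff_ops_order R K n}"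

definition diff_ops :: "('a, 'r) ring_scheme \<Rightarrow> 'a set \<Rightarrow> ('a \<Rightarrow> 'a) ring" where
  "diff_ops R K = (End_ring R K)\<lparr>carrier := (\<Union>n. diff_ops_order R K n)\<rparr>"

text \<open>The library only has modules over commutative rings.\<close>

locale right_module = D?: ring D + M?: abelian_group M
  for D :: "('d, 's) ring_scheme" and M :: "('b, 't) ring_scheme"
    and act :: "'b \<Rightarrow> 'd \<Rightarrow> 'b" +
  assumes act_closed: "\<lbrakk> x \<in> carrier M; \<xi> \<in> carrier D \<rbrakk> \<Longrightarrow> act x \<xi> \<in> carrier M"
    and act_add_left: "\<lbrakk> x \<in> carrier M; y \<in> carrier M; \<xi> \<in> carrier D \<rbrakk>
      \<Longrightarrow> act (x \<oplus>\<^bsub>M\<^esub> y) \<xi> = act x \<xi> \<oplus>\<^bsub>M\<^esub> act y \<xi>"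
    and act_add_right: "\<lbrakk> x \<in> carrier M; \<xi> \<in> carrier D; \<eta> \<in> carrier D \<rbrakk>
      \<Longrightarrow> act x (\<xi> \<oplus>\<^bsub>D\<^esub> \<eta>) = act x \<xi> \<oplus>\<^bsub>M\<^esub> act x \<eta>"
    and act_mult: "\<lbrakk> x \<in> carrier M; \<xi> \<in> carrier D; \<eta> \<in> carrier D \<rbrakk>
      \<Longrightarrow> act x (\<xi> \<otimes>\<^bsub>D\<^esub> \<eta>) = act (act x \<xi>) \<eta>"
    and act_one: "x \<in> carrier M \<Longrightarrow> act x \<one>\<^bsub>D\<^esub> = x"

definition compatible_right_D_module ::
  "('a, 'r) ring_scheme \<Rightarrow> 'a set \<Rightarrow> ('a, 'b, 's) module_scheme \<Rightarrow> ('b \<Rightarrow> ('a \<Rightarrow> 'a) \<Rightarrow> 'b) \<Rightarrow> bool"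
where
  "compatible_right_D_module R K M act \<longleftrightarrow> right_module (diff_ops R K) M act \<and>
     (\<forall>f\<in>carrier R. \<forall>x\<in>carrier M. act x (mult_op R f) = f \<odot>\<^bsub>M\<^esub> x)"

end

theory Submission
  imports Defs
begin

text \<open>A differential operator on \<open>R\<close> extends uniquely to every localization of \<open>R\<close>, so the Cech complex
  and its cohomology are left \<open>D\<close>-modules; thus \<open>D\<close> acts from the left on
  \<open>H = Hom(\<omega>, E)\<close>, which is isomorphic to the top local cohomology module of \<open>R\<close>. Let \<open>\<tau>\<close> be a \<open>k\<close>-linear functional on
  \<open>E\<close> that does not vanish on the socle. The pairing \<open>\<langle>w, \<phi>\<rangle> = \<tau> (\<phi> w)\<close> identifies \<open>\<omega>\<close> with the space
  of all \<open>k\<close>-linear functionals on \<open>H\<close>: it is nondegenerate on the left because \<open>E\<close> is injective, and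
  every functional is represented because \<open>H\<close> is \<open>\<mm>\<close>-torsion and \<open>R\<close> is complete. Differential
  operators are \<open>k\<close>-linear, so the adjoint of the left action on \<open>H\<close> is a right action on \<open>\<omega>\<close>.\<close>


section \<open>Differential operators between modules\<close>

text \<open>A differential operator is not R-linear, so it can neither be localized nor be
  transposed along Hom(_, E) by functoriality. On the Cech side, functoriality is replaced by
  rigidity: a map of finite order from a localization to a module on which the denominators are
  invertible is determined by its values on the image of R, and every identity between extended
  operators is checked there. On the dual side, the action on H is still K-linear, so it can be
  transposed on functionals, and transposition reverses products. A functional on H is represented
  on the annihilator of \<mm>^n in H, one n at a time. Each stage meets finitely many conditions,
  because \<mm>^n and \<omega> are finitely generated, and the next stage changes the coefficients
  with respect to fixed generators of \<omega> only by elements of \<mm>^n. The limit is taken among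
  these coefficients in R, so no statement about the topology of \<omega> is involved.\<close>

definition additive_map :: "('b, 's) ring_scheme \<Rightarrow> ('c, 't) ring_scheme \<Rightarrow> ('b \<Rightarrow> 'c) \<Rightarrow> bool" where
  "additive_map M N \<phi> \<longleftrightarrow> \<phi> \<in> carrier M \<rightarrow> carrier N \<and>
     (\<forall>x\<in>carrier M. \<forall>y\<in>carrier M. \<phi> (x \<oplus>\<^bsub>M\<^esub> y) = \<phi> x \<oplus>\<^bsub>N\<^esub> \<phi> y)"

lemma additive_mapD:
  assumes "additive_map M N \<phi>"
  shows additive_map_closed: "x \<in> carrier M \<Longrightarrow> \<phi> x \<in> carrier N"
    and additive_map_add: "\<lbrakk>x \<in> carrier M; y \<in> carrier M\<rbrakk> \<Longrightarrow> \<phi> (x \<oplus>\<^bsub>M\<^esub> y) = \<phi> x \<oplus>\<^bsub>N\<^esub> \<phi> y"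
  using assms by (auto simp: additive_map_def)

lemma additive_mapI:
  assumes "\<And>x. x \<in> carrier M \<Longrightarrow> \<phi> x \<in> carrier N"
    and "\<And>x y. \<lbrakk>x \<in> carrier M; y \<in> carrier M\<rbrakk> \<Longrightarrow> \<phi> (x \<oplus>\<^bsub>M\<^esub> y) = \<phi> x \<oplus>\<^bsub>N\<^esub> \<phi> y"
  shows "additive_map M N \<phi>"
  using assms by (auto simp: additive_map_def)

lemma additive_map_zero:
  assumes "abelian_group M" "abelian_group N" "additive_map M N \<phi>"
  shows "\<phi> \<zero>\<^bsub>M\<^esub> = \<zero>\<^bsub>N\<^esub>"
proof -
  interpret M: abelian_group M by fact
  interpret N: abelian_group N by fact
  have "\<phi> \<zero>\<^bsub>M\<^esub> \<oplus>\<^bsub>N\<^esub> \<phi> \<zero>\<^bsub>M\<^esub> = \<phi> \<zero>\<^bsub>M\<^esub>"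
    using additive_map_add[OF assms(3), of "\<zero>\<^bsub>M\<^esub>" "\<zero>\<^bsub>M\<^esub>"] by simp
  then show ?thesis
    using additive_map_closed[OF assms(3), of "\<zero>\<^bsub>M\<^esub>"] by (metis M.zero_closed N.add.l_cancel_one)
qed

lemma additive_map_minus:
  assumes "abelian_group M" "abelian_group N" "additive_map M N \<phi>" "x \<in> carrier M"
  shows "\<phi> (\<ominus>\<^bsub>M\<^esub> x) = \<ominus>\<^bsub>N\<^esub> \<phi> x"
proof -
  interpret M: abelian_group M by fact
  interpret N: abelian_group N by fact
  have "\<phi> (\<ominus>\<^bsub>M\<^esub> x) \<oplus>\<^bsub>N\<^esub> \<phi> x = \<zero>\<^bsub>N\<^esub>"
    using assms additive_map_add[OF assms(3), of "\<ominus>\<^bsub>M\<^esub> x" x]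
    by (simp add: M.l_neg additive_map_zero)
  then show ?thesis
    using assms by (simp add: N.minus_equality additive_map_closed)
qed

lemma additive_map_finsum:
  assumes "abelian_group M" "abelian_group N" "additive_map M N \<phi>"
    and "finite A" "g \<in> A \<rightarrow> carrier M"
  shows "\<phi> (\<Oplus>\<^bsub>M\<^esub>i\<in>A. g i) = (\<Oplus>\<^bsub>N\<^esub>i\<in>A. \<phi> (g i))"
proof -
  interpret M: abelian_group M by fact
  interpret N: abelian_group N by fact
  show ?thesis using assms(4,5)
  proof (induction A rule: finite_induct)
    case empty
    then show ?case using additive_map_zero[OF assms(1-3)] by simp
  next
    case (insert a A)
    then have g: "g a \<in> carrier M" "g \<in> A \<rightarrow> carrier M" by auto
    have "(\<lambda>i. \<phi> (g i)) \<in> A \<rightarrow> carrier N" "\<phi> (g a) \<in> carrier N"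
      using g additive_map_closed[OF assms(3)] by auto
    with insert g show ?case
      by (simp add: additive_map_add[OF assms(3)] M.finsum_closed)
  qed
qed

lemma mod_hom_iff:
  "f \<in> mod_hom R M N \<longleftrightarrow> additive_map M N f \<and>
     (\<forall>a\<in>carrier R. \<forall>x\<in>carrier M. f (a \<odot>\<^bsub>M\<^esub> x) = a \<odot>\<^bsub>N\<^esub> f x)"
  by (auto simp: mod_hom_def additive_map_def)

lemma mod_homD:
  assumes "f \<in> mod_hom R M N"
  shows mod_hom_additive: "additive_map M N f"
    and mod_hom_closed: "x \<in> carrier M \<Longrightarrow> f x \<in> carrier N"
    and mod_hom_add: "\<lbrakk>x \<in> carrier M; y \<in> carrier M\<rbrakk> \<Longrightarrow> f (x \<oplus>\<^bsub>M\<^esub> y) = f x \<oplus>\<^bsub>N\<^esub> f y"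
    and mod_hom_smult: "\<lbrakk>a \<in> carrier R; x \<in> carrier M\<rbrakk> \<Longrightarrow> f (a \<odot>\<^bsub>M\<^esub> x) = a \<odot>\<^bsub>N\<^esub> f x"
  using assms by (auto simp: mod_hom_iff additive_map_def)

lemma mod_homI:
  assumes "\<And>x. x \<in> carrier M \<Longrightarrow> f x \<in> carrier N"
    and "\<And>x y. \<lbrakk>x \<in> carrier M; y \<in> carrier M\<rbrakk> \<Longrightarrow> f (x \<oplus>\<^bsub>M\<^esub> y) = f x \<oplus>\<^bsub>N\<^esub> f y"
    and "\<And>a x. \<lbrakk>a \<in> carrier R; x \<in> carrier M\<rbrakk> \<Longrightarrow> f (a \<odot>\<^bsub>M\<^esub> x) = a \<odot>\<^bsub>N\<^esub> f x"
  shows "f \<in> mod_hom R M N"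
  using assms by (auto simp: mod_hom_iff additive_map_def)

text \<open>\<open>dop R M N n\<close> describes the operators of order strictly less than \<open>n\<close>, so that the
  induction starts with the zero operator. The commutator with \<open>f\<close> is the map \<open>\<psi>\<close> below.\<close>

primrec dop ::
  "('a, 'r) ring_scheme \<Rightarrow> ('a, 'b, 's) module_scheme \<Rightarrow> ('a, 'c, 't) module_scheme
    \<Rightarrow> nat \<Rightarrow> ('b \<Rightarrow> 'c) \<Rightarrow> bool"
where
  "dop R M N 0 \<phi> \<longleftrightarrow> (\<forall>x\<in>carrier M. \<phi> x = \<zero>\<^bsub>N\<^esub>)"
| "dop R M N (Suc n) \<phi> \<longleftrightarrow> additive_map M N \<phi> \<and>
     (\<forall>f\<in>carrier R. \<exists>\<psi>. dop R M N n \<psi> \<and>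
        (\<forall>x\<in>carrier M. \<phi> (f \<odot>\<^bsub>M\<^esub> x) = \<psi> x \<oplus>\<^bsub>N\<^esub> f \<odot>\<^bsub>N\<^esub> \<phi> x))"

lemma dop_SucE:
  assumes "dop R M N (Suc n) \<phi>" "f \<in> carrier R"
  obtains \<psi> where "dop R M N n \<psi>"
    "\<And>x. x \<in> carrier M \<Longrightarrow> \<phi> (f \<odot>\<^bsub>M\<^esub> x) = \<psi> x \<oplus>\<^bsub>N\<^esub> f \<odot>\<^bsub>N\<^esub> \<phi> x"
  using assms by auto

locale module_pair = M: module R M + N: module R N for R (structure) and M and N
begin

lemma dop_additive: "dop R M N n \<phi> \<Longrightarrow> additive_map M N \<phi>"
  by (cases n) (auto intro: additive_mapI)

lemma dop_zero: "dop R M N n (\<lambda>_. \<zero>\<^bsub>N\<^esub>)"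
proof (induction n)
  case (Suc n)
  then show ?case by (auto intro!: additive_mapI exI[of _ "\<lambda>_. \<zero>\<^bsub>N\<^esub>"])
qed simp

lemma dop_cong:
  assumes "dop R M N n \<phi>" "\<And>x. x \<in> carrier M \<Longrightarrow> \<phi> x = \<phi>' x"
  shows "dop R M N n \<phi>'"
  using assms by (cases n) (auto simp: additive_map_def Pi_iff)

lemma dop_Suc: "dop R M N n \<phi> \<Longrightarrow> dop R M N (Suc n) \<phi>"
proof (induction n arbitrary: \<phi>)
  case 0
  then have "dop R M N 1 \<phi>"
    using dop_cong[OF dop_zero[of 1], of \<phi>] by simp
  then show ?case by simp
next
  case (Suc n)
  have "\<exists>\<psi>. dop R M N (Suc n) \<psi> \<and>
      (\<forall>x\<in>carrier M. \<phi> (f \<odot>\<^bsub>M\<^esub> x) = \<psi> x \<oplus>\<^bsub>N\<^esub> f \<odot>\<^bsub>N\<^esub> \<phi> x)" if "f \<in> carrier R" for f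
    using dop_SucE[OF Suc.prems that] Suc.IH by metis
  then show ?case
    using dop_additive[OF Suc.prems] unfolding dop.simps(2)[of R M N "Suc n"] by blast
qed

lemma dop_mono: "\<lbrakk>n \<le> m; dop R M N n \<phi>\<rbrakk> \<Longrightarrow> dop R M N m \<phi>"
  by (induction m rule: dec_induct) (auto intro: dop_Suc simp del: dop.simps)

lemma dop_add:
  "\<lbrakk>dop R M N n \<phi>; dop R M N n \<phi>'\<rbrakk> \<Longrightarrow> dop R M N n (\<lambda>x. \<phi> x \<oplus>\<^bsub>N\<^esub> \<phi>' x)"
proof (induction n arbitrary: \<phi> \<phi>')
  case (Suc n)
  note a = dop_additive[OF Suc.prems(1)] dop_additive[OF Suc.prems(2)]
  note c = a[THEN additive_map_closed]
  have "additive_map M N (\<lambda>x. \<phi> x \<oplus>\<^bsub>N\<^esub> \<phi>' x)"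
    by (rule additive_mapI) (simp_all add: c additive_map_add[OF a(1)] additive_map_add[OF a(2)] N.a_ac)
  moreover have "\<exists>\<psi>. dop R M N n \<psi> \<and> (\<forall>x\<in>carrier M. \<phi> (f \<odot>\<^bsub>M\<^esub> x) \<oplus>\<^bsub>N\<^esub> \<phi>' (f \<odot>\<^bsub>M\<^esub> x)
      = \<psi> x \<oplus>\<^bsub>N\<^esub> f \<odot>\<^bsub>N\<^esub> (\<phi> x \<oplus>\<^bsub>N\<^esub> \<phi>' x))" if f: "f \<in> carrier R" for f
  proof -
    obtain \<psi> where \<psi>: "dop R M N n \<psi>"
      "\<And>x. x \<in> carrier M \<Longrightarrow> \<phi> (f \<odot>\<^bsub>M\<^esub> x) = \<psi> x \<oplus>\<^bsub>N\<^esub> f \<odot>\<^bsub>N\<^esub> \<phi> x"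
      using dop_SucE[OF Suc.prems(1) f] by blast
    obtain \<psi>' where \<psi>': "dop R M N n \<psi>'"
      "\<And>x. x \<in> carrier M \<Longrightarrow> \<phi>' (f \<odot>\<^bsub>M\<^esub> x) = \<psi>' x \<oplus>\<^bsub>N\<^esub> f \<odot>\<^bsub>N\<^esub> \<phi>' x"
      using dop_SucE[OF Suc.prems(2) f] by blast
    note d = \<psi>(1)[THEN dop_additive, THEN additive_map_closed] \<psi>'(1)[THEN dop_additive, THEN additive_map_closed]
    show ?thesis
      using f by (intro exI[of _ "\<lambda>x. \<psi> x \<oplus>\<^bsub>N\<^esub> \<psi>' x"] conjI Suc.IH \<psi>(1) \<psi>'(1))
        (simp add: \<psi>(2) \<psi>'(2) c d N.smult_r_distr N.a_ac)
  qed
  ultimately show ?case by simp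
qed simp

text \<open>All commutators of an R-linear map vanish, so its order is 0 and its strict bound is 1.
  In this way the canonical maps enter compositions of operators.\<close>

lemma mod_hom_dop:
  assumes "g \<in> mod_hom R M N"
  shows "dop R M N (Suc 0) g"
  using assms by (auto simp: mod_hom_iff additive_map_closed intro!: exI[of _ "\<lambda>_. \<zero>\<^bsub>N\<^esub>"])

end

text \<open>The commutator of a composite obeys the Leibniz rule [\<psi>\<phi>, f] =
  \<psi>[\<phi>, f] + [\<psi>, f]\<phi>, and both summands have a smaller sum of bounds. For
  positive strict bounds the value a + b exceeds the sharp one by one; in this form the induction on
  a + b involves no subtraction, and a zero bound simply makes the composite zero.\<close>

lemma dop_comp:
  fixes R (structure)
  assumes M: "module R M" and N: "module R N" and P: "module R P"
  shows "\<lbrakk>dop R M N a \<phi>; dop R N P b \<psi>\<rbrakk> \<Longrightarrow> dop R M P (a + b) (\<lambda>x. \<psi> (\<phi> x))"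
proof (induction "a + b" arbitrary: a b \<phi> \<psi>)
  case 0
  then show ?case by simp (metis M N additive_map_closed module_pair.dop_additive module_pair.intro dop.simps(1))
next
  case (Suc n)
  interpret MN: module_pair R M N by (intro module_pair.intro M N)
  interpret NP: module_pair R N P by (intro module_pair.intro N P)
  interpret MP: module_pair R M P by (intro module_pair.intro M P)
  note a\<phi> = MN.dop_additive[OF Suc.prems(1)] and a\<psi> = NP.dop_additive[OF Suc.prems(2)]
  note c\<phi> = a\<phi>[THEN additive_map_closed] and c\<psi> = a\<psi>[THEN additive_map_closed]
  consider "a = 0" | "b = 0" | a' b' where "a = Suc a'" "b = Suc b'"
    by (cases a; cases b) auto
  then show ?case
  proof cases
    case 1
    then have "\<psi> (\<phi> x) = \<zero>\<^bsub>P\<^esub>" if "x \<in> carrier M" for x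
      using Suc.prems(1) that additive_map_zero[OF module.axioms(2)[OF N] module.axioms(2)[OF P] a\<psi>] by simp
    then show ?thesis using MP.dop_cong[OF MP.dop_zero] by simp
  next
    case 2
    then have "\<psi> (\<phi> x) = \<zero>\<^bsub>P\<^esub>" if "x \<in> carrier M" for x
      using Suc.prems(2) that c\<phi> by simp
    then show ?thesis using MP.dop_cong[OF MP.dop_zero] by simp
  next
    case 3
    have "additive_map M P (\<lambda>x. \<psi> (\<phi> x))"
      by (rule additive_mapI) (simp_all add: c\<phi> c\<psi> additive_map_add[OF a\<phi>] additive_map_add[OF a\<psi>])
    moreover have "\<exists>\<chi>. dop R M P (a' + b) \<chi> \<and>
        (\<forall>x\<in>carrier M. \<psi> (\<phi> (f \<odot>\<^bsub>M\<^esub> x)) = \<chi> x \<oplus>\<^bsub>P\<^esub> f \<odot>\<^bsub>P\<^esub> \<psi> (\<phi> x))" if f: "f \<in> carrier R" for f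
    proof -
      obtain \<alpha> where \<alpha>: "dop R M N a' \<alpha>"
        "\<And>x. x \<in> carrier M \<Longrightarrow> \<phi> (f \<odot>\<^bsub>M\<^esub> x) = \<alpha> x \<oplus>\<^bsub>N\<^esub> f \<odot>\<^bsub>N\<^esub> \<phi> x"
        using dop_SucE[of R M N a' \<phi> f] Suc.prems 3 f by blast
      obtain \<beta> where \<beta>: "dop R N P b' \<beta>"
        "\<And>x. x \<in> carrier N \<Longrightarrow> \<psi> (f \<odot>\<^bsub>N\<^esub> x) = \<beta> x \<oplus>\<^bsub>P\<^esub> f \<odot>\<^bsub>P\<^esub> \<psi> x"
        using dop_SucE[of R N P b' \<psi> f] Suc.prems 3 f by blast
      note d = \<alpha>(1)[THEN MN.dop_additive, THEN additive_map_closed]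
        \<beta>(1)[THEN NP.dop_additive, THEN additive_map_closed]
      have "dop R M P (a' + b) (\<lambda>x. \<psi> (\<alpha> x))" "dop R M P (a + b') (\<lambda>x. \<beta> (\<phi> x))"
        using Suc.hyps(1)[OF _ \<alpha>(1) Suc.prems(2)] Suc.hyps(1)[OF _ Suc.prems(1) \<beta>(1)] Suc.hyps(2) 3
        by (simp_all del: dop.simps)
      then have "dop R M P (a' + b) (\<lambda>x. \<psi> (\<alpha> x) \<oplus>\<^bsub>P\<^esub> \<beta> (\<phi> x))"
        using MP.dop_add 3 by (simp del: dop.simps)
      then show ?thesis
        using f by (intro exI[of _ "\<lambda>x. \<psi> (\<alpha> x) \<oplus>\<^bsub>P\<^esub> \<beta> (\<phi> x)"] conjI)
          (simp_all add: \<alpha>(2) \<beta>(2) c\<phi> c\<psi> d additive_map_add[OF a\<psi>] NP.N.a_assoc)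
    qed
    ultimately show ?thesis using 3 by simp
  qed
qed

section \<open>Extension of differential operators to modules of fractions\<close>

locale fraction_module = L: module R L
  for R :: "('a, 'r) ring_scheme" (structure) and S
    and L :: "('a, 'b, 's) module_scheme" and l :: "'a \<Rightarrow> 'b" +
  assumes S_carrier: "S \<subseteq> carrier R"
    and S_one: "\<one> \<in> S"
    and S_mult: "\<lbrakk>s \<in> S; t \<in> S\<rbrakk> \<Longrightarrow> s \<otimes> t \<in> S"
    and l_hom: "l \<in> mod_hom R (regular_module R) L"
    and denominator: "y \<in> carrier L \<Longrightarrow> \<exists>s\<in>S. \<exists>r\<in>carrier R. s \<odot>\<^bsub>L\<^esub> y = l r"
    and l_kernel: "\<lbrakk>r \<in> carrier R; l r = \<zero>\<^bsub>L\<^esub>\<rbrakk> \<Longrightarrow> \<exists>u\<in>S. u \<otimes> r = \<zero>"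

definition invertible_on :: "'a set \<Rightarrow> ('a, 'b, 's) module_scheme \<Rightarrow> bool" where
  "invertible_on S N \<longleftrightarrow> (\<forall>s\<in>S. bij_betw (\<lambda>y. s \<odot>\<^bsub>N\<^esub> y) (carrier N) (carrier N))"

lemma (in cring) regular_module: "module R (regular_module R)"
proof (rule moduleI)
  show "cring R" by (rule is_cring)
  show "abelian_group (regular_module R)"
    by (rule abelian_groupI) (auto simp: regular_module_def a_ac intro!: bexI[of _ "\<ominus> x" for x] l_neg)
qed (auto simp: regular_module_def m_assoc l_distr r_distr)

lemma regular_module_simps [simp]:
  "carrier (regular_module R) = carrier R" "\<zero>\<^bsub>regular_module R\<^esub> = \<zero>\<^bsub>R\<^esub>"
  "x \<oplus>\<^bsub>regular_module R\<^esub> y = x \<oplus>\<^bsub>R\<^esub> y" "x \<odot>\<^bsub>regular_module R\<^esub> y = x \<otimes>\<^bsub>R\<^esub> y"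
  by (simp_all add: regular_module_def)

text \<open>Denominators are cancelled in the target. Therefore S is required to act bijectively on
  N, and N may be a localization at a larger set; this covers the action on a single localization as
  well as the comparison of two.\<close>

locale fraction_extension = fraction_module R S L l + N: module R N
  for R :: "('a, 'r) ring_scheme" (structure) and S
    and L :: "('a, 'b, 's) module_scheme" and l :: "'a \<Rightarrow> 'b"
    and N :: "('a, 'c, 't) module_scheme" +
  assumes invertible: "invertible_on S N"
begin

sublocale RN: module_pair R "regular_module R" N
  by (intro module_pair.intro L.regular_module N.module_axioms)

sublocale LN: module_pair R L N
  by (intro module_pair.intro L.module_axioms N.module_axioms)

lemma in_R: "s \<in> S \<Longrightarrow> s \<in> carrier R"
  using S_carrier by auto

lemma l_simps:
  "r \<in> carrier R \<Longrightarrow> l r \<in> carrier L"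
  "\<lbrakk>r \<in> carrier R; r' \<in> carrier R\<rbrakk> \<Longrightarrow> l (r \<oplus> r') = l r \<oplus>\<^bsub>L\<^esub> l r'"
  "\<lbrakk>a \<in> carrier R; r \<in> carrier R\<rbrakk> \<Longrightarrow> l (a \<otimes> r) = a \<odot>\<^bsub>L\<^esub> l r"
  using mod_homD[OF l_hom] by auto

lemma smult_cancel:
  "\<lbrakk>s \<in> S; x \<in> carrier N; y \<in> carrier N; s \<odot>\<^bsub>N\<^esub> x = s \<odot>\<^bsub>N\<^esub> y\<rbrakk> \<Longrightarrow> x = y"
  using invertible by (auto simp: invertible_on_def bij_betw_def dest: inj_onD)

text \<open>Write s y = l r. Then P (s y) = [P, s] y + s P y, where the left side depends only on
  values on the image of R, and [P, s] is covered by the induction hypothesis. Hence s P y = s P' y,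
  and s cancels in N.\<close>

lemma dop_eqI:
  "\<lbrakk>dop R L N n P; dop R L N n P'; \<And>r. r \<in> carrier R \<Longrightarrow> P (l r) = P' (l r); y \<in> carrier L\<rbrakk>
    \<Longrightarrow> P y = P' y"
proof (induction n arbitrary: P P' y)
  case 0
  then show ?case by simp
next
  case (Suc n)
  obtain s r where s: "s \<in> S" and r: "r \<in> carrier R" and sy: "s \<odot>\<^bsub>L\<^esub> y = l r"
    using denominator[OF Suc.prems(4)] by blast
  note c = LN.dop_additive[OF Suc.prems(1), THEN additive_map_closed]
    LN.dop_additive[OF Suc.prems(2), THEN additive_map_closed]
  obtain A where A: "dop R L N n A"
    "\<And>x. x \<in> carrier L \<Longrightarrow> P (s \<odot>\<^bsub>L\<^esub> x) = A x \<oplus>\<^bsub>N\<^esub> s \<odot>\<^bsub>N\<^esub> P x"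
    using dop_SucE[OF Suc.prems(1) in_R[OF s]] by blast
  obtain A' where A': "dop R L N n A'"
    "\<And>x. x \<in> carrier L \<Longrightarrow> P' (s \<odot>\<^bsub>L\<^esub> x) = A' x \<oplus>\<^bsub>N\<^esub> s \<odot>\<^bsub>N\<^esub> P' x"
    using dop_SucE[OF Suc.prems(2) in_R[OF s]] by blast
  note d = LN.dop_additive[OF A(1), THEN additive_map_closed]
    LN.dop_additive[OF A'(1), THEN additive_map_closed]
  have "A (l x) = A' (l x)" if x: "x \<in> carrier R" for x
  proof -
    have "P (l (s \<otimes> x)) = P' (l (s \<otimes> x))" using Suc.prems(3) x s in_R by simp
    then show ?thesis
      using x s in_R c d A(2)[of "l x"] A'(2)[of "l x"] Suc.prems(3)[OF x] by (simp add: l_simps)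
  qed
  from Suc.IH[OF A(1) A'(1) this Suc.prems(4)] have "A y = A' y" by blast
  moreover have "P (s \<odot>\<^bsub>L\<^esub> y) = P' (s \<odot>\<^bsub>L\<^esub> y)" using sy Suc.prems(3)[OF r] by simp
  ultimately have "s \<odot>\<^bsub>N\<^esub> P y = s \<odot>\<^bsub>N\<^esub> P' y"
    using A(2) A'(2) Suc.prems(4) c d in_R[OF s] by simp
  then show ?case using smult_cancel[OF s] c Suc.prems(4) by blast
qed

text \<open>If \<open>\<psi>\<^sub>s = [\<eta>, s]\<close> has the extension \<open>Q s\<close>, then the extension \<open>P\<close> of \<open>\<eta>\<close> at \<open>y = r/s\<close> has to satisfy
  \<open>\<eta> r = P (s y) = Q s y + s P y\<close>, which defines \<open>P y\<close>. Uniqueness in lower order gives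
  \<open>[Q s, t] = [Q t, s]\<close> and with it independence of the representation \<open>r/s\<close>.\<close>

lemma dop_extend:
  "dop R (regular_module R) N n \<eta> \<Longrightarrow>
    \<exists>P. dop R L N n P \<and> (\<forall>r\<in>carrier R. P (l r) = \<eta> r)"
proof (induction n arbitrary: \<eta>)
  case 0
  then show ?case by (intro exI[of _ "\<lambda>_. \<zero>\<^bsub>N\<^esub>"]) auto
next
  case (Suc n)
  have c: "\<eta> r \<in> carrier N" if "r \<in> carrier R" for r
    using RN.dop_additive[OF Suc.prems, THEN additive_map_closed] that by simp
  have add: "\<eta> (r \<oplus> r') = \<eta> r \<oplus>\<^bsub>N\<^esub> \<eta> r'" if "r \<in> carrier R" "r' \<in> carrier R" for r r'
    using RN.dop_additive[OF Suc.prems, THEN additive_map_add] that by simp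
  have "\<exists>P. dop R L N n P \<and>
      (\<forall>x\<in>carrier R. \<eta> (f \<otimes> x) = P (l x) \<oplus>\<^bsub>N\<^esub> f \<odot>\<^bsub>N\<^esub> \<eta> x)" if f: "f \<in> carrier R" for f
  proof -
    obtain \<psi> where "dop R (regular_module R) N n \<psi>"
      "\<And>x. x \<in> carrier R \<Longrightarrow> \<eta> (f \<otimes> x) = \<psi> x \<oplus>\<^bsub>N\<^esub> f \<odot>\<^bsub>N\<^esub> \<eta> x"
      using dop_SucE[OF Suc.prems f] by (metis regular_module_simps(1,4))
    then show ?thesis using Suc.IH[of \<psi>] by auto
  qed
  \<comment> \<open>One extension \<open>Q f\<close> of [\<eta>, f] is chosen for every f; the
    choices for different f are related only through the symmetry of their commutators.\<close>
  then obtain Q where Q: "\<And>f. f \<in> carrier R \<Longrightarrow> dop R L N n (Q f)"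
    and Q_comm: "\<And>f x. \<lbrakk>f \<in> carrier R; x \<in> carrier R\<rbrakk>
        \<Longrightarrow> \<eta> (f \<otimes> x) = Q f (l x) \<oplus>\<^bsub>N\<^esub> f \<odot>\<^bsub>N\<^esub> \<eta> x"
    by metis
  have Qc: "Q f y \<in> carrier N" if "f \<in> carrier R" "y \<in> carrier L" for f y
    using LN.dop_additive[OF Q[OF that(1)], THEN additive_map_closed] that by blast
  have Qadd: "Q f (y \<oplus>\<^bsub>L\<^esub> y') = Q f y \<oplus>\<^bsub>N\<^esub> Q f y'"
    if "f \<in> carrier R" "y \<in> carrier L" "y' \<in> carrier L" for f y y'
    using LN.dop_additive[OF Q[OF that(1)], THEN additive_map_add] that by blast
  \<comment> \<open>The commutator [Q f, g] will be called \<open>C f g\<close>. The bound of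
    \<open>Q f\<close> is first raised to \<open>Suc n\<close>, so that the commutator is available
    also for n = 0; the weaker bound n is enough to apply \<open>dop_eqI\<close>.\<close>
  have "\<exists>C. dop R L N n C \<and> (\<forall>y\<in>carrier L. Q f (g \<odot>\<^bsub>L\<^esub> y) = C y \<oplus>\<^bsub>N\<^esub> g \<odot>\<^bsub>N\<^esub> Q f y)"
    if "f \<in> carrier R" "g \<in> carrier R" for f g
    using dop_SucE[OF LN.dop_Suc[OF Q[OF that(1)]] that(2)] by metis
  then obtain C where C: "\<And>f g. \<lbrakk>f \<in> carrier R; g \<in> carrier R\<rbrakk> \<Longrightarrow> dop R L N n (C f g)"
    and C_comm: "\<And>f g y. \<lbrakk>f \<in> carrier R; g \<in> carrier R; y \<in> carrier L\<rbrakk>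
        \<Longrightarrow> Q f (g \<odot>\<^bsub>L\<^esub> y) = C f g y \<oplus>\<^bsub>N\<^esub> g \<odot>\<^bsub>N\<^esub> Q f y"
    by metis
  have Cc: "C f g y \<in> carrier N" if "f \<in> carrier R" "g \<in> carrier R" "y \<in> carrier L" for f g y
    using LN.dop_additive[OF C[OF that(1,2)], THEN additive_map_closed] that by blast
  have C_sym: "C f g y = C g f y" if fg: "f \<in> carrier R" "g \<in> carrier R" and y: "y \<in> carrier L" for f g y
  proof (rule dop_eqI[OF C C _ y])
    fix x assume x: "x \<in> carrier R"
    have e: "\<eta> (f \<otimes> (g \<otimes> x)) = (C f g (l x) \<oplus>\<^bsub>N\<^esub> g \<odot>\<^bsub>N\<^esub> Q f (l x)) \<oplus>\<^bsub>N\<^esub>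
        f \<odot>\<^bsub>N\<^esub> (Q g (l x) \<oplus>\<^bsub>N\<^esub> g \<odot>\<^bsub>N\<^esub> \<eta> x)"
      if "f \<in> carrier R" "g \<in> carrier R" for f g
      using that x Q_comm C_comm by (simp add: l_simps)
    have "f \<otimes> (g \<otimes> x) = g \<otimes> (f \<otimes> x)" "f \<odot>\<^bsub>N\<^esub> (g \<odot>\<^bsub>N\<^esub> \<eta> x) = g \<odot>\<^bsub>N\<^esub> (f \<odot>\<^bsub>N\<^esub> \<eta> x)"
      using fg x c by (simp_all add: L.m_lcomm flip: N.smult_assoc1) (simp add: L.m_comm)
    with e[OF fg] e[OF fg(2,1)]
    have "C f g (l x) \<oplus>\<^bsub>N\<^esub> (g \<odot>\<^bsub>N\<^esub> Q f (l x) \<oplus>\<^bsub>N\<^esub> (f \<odot>\<^bsub>N\<^esub> Q g (l x) \<oplus>\<^bsub>N\<^esub> f \<odot>\<^bsub>N\<^esub> (g \<odot>\<^bsub>N\<^esub> \<eta> x)))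
        = C g f (l x) \<oplus>\<^bsub>N\<^esub> (g \<odot>\<^bsub>N\<^esub> Q f (l x) \<oplus>\<^bsub>N\<^esub> (f \<odot>\<^bsub>N\<^esub> Q g (l x) \<oplus>\<^bsub>N\<^esub> f \<odot>\<^bsub>N\<^esub> (g \<odot>\<^bsub>N\<^esub> \<eta> x)))"
      using fg x c Qc Cc by (simp add: l_simps N.smult_r_distr N.a_ac)
    then show "C f g (l x) = C g f (l x)"
      using fg x c Qc Cc by (simp add: l_simps)
  qed (use fg in auto)
  \<comment> \<open>The numerator r in s y = l r is determined only modulo the kernel of l. An
    element q of the kernel satisfies u q = 0 for some u in S; since \<open>Q u\<close> vanishes at
    l q = 0, expanding \<eta> (u q) leaves u \<eta> q = 0.\<close>
  have \<eta>_ker: "\<eta> q = \<zero>\<^bsub>N\<^esub>" if q: "q \<in> carrier R" "l q = \<zero>\<^bsub>L\<^esub>" for q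
  proof -
    obtain u where u: "u \<in> S" "u \<otimes> q = \<zero>" using l_kernel[OF q] by blast
    have "\<eta> \<zero> = \<zero>\<^bsub>N\<^esub>"
      using add[of \<zero> \<zero>] c[of \<zero>] by simp
    moreover have "Q u \<zero>\<^bsub>L\<^esub> = \<zero>\<^bsub>N\<^esub>"
      using Qadd[of u "\<zero>\<^bsub>L\<^esub>" "\<zero>\<^bsub>L\<^esub>"] Qc[of u "\<zero>\<^bsub>L\<^esub>"] u in_R by simp
    ultimately have "\<zero>\<^bsub>N\<^esub> = \<zero>\<^bsub>N\<^esub> \<oplus>\<^bsub>N\<^esub> u \<odot>\<^bsub>N\<^esub> \<eta> q"
      using Q_comm[of u q] u q in_R by (metis (full_types))
    then have "u \<odot>\<^bsub>N\<^esub> \<eta> q = u \<odot>\<^bsub>N\<^esub> \<zero>\<^bsub>N\<^esub>"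
      using in_R[OF u(1)] c[OF q(1)] by (metis N.l_zero N.smult_closed N.smult_r_null)
    then show ?thesis using smult_cancel[OF u(1)] c q by blast
  qed
  have \<eta>_cong: "\<eta> r = \<eta> r'" if "r \<in> carrier R" "r' \<in> carrier R" "l r = l r'" for r r'
  proof -
    have r: "r = (r \<ominus> r') \<oplus> r'" using that by (simp add: L.R.minus_eq L.R.a_assoc L.R.l_neg)
    have "l (r \<ominus> r') \<oplus>\<^bsub>L\<^esub> l r' = l r'" using that r l_simps(2)[of "r \<ominus> r'" r'] by simp
    then have "l (r \<ominus> r') = \<zero>\<^bsub>L\<^esub>" using that l_simps(1)[of "r \<ominus> r'"] l_simps(1)[of r'] by simp
    then have "\<eta> (r \<ominus> r') = \<zero>\<^bsub>N\<^esub>" using \<eta>_ker that by simp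
    then show ?thesis using that add[of "r \<ominus> r'" r'] r c by simp
  qed
  have z_ex: "\<exists>z\<in>carrier N. Q s y \<oplus>\<^bsub>N\<^esub> s \<odot>\<^bsub>N\<^esub> z = \<eta> r"
    if "s \<in> S" "r \<in> carrier R" "y \<in> carrier L" for s r y
  proof -
    have "\<ominus>\<^bsub>N\<^esub> Q s y \<oplus>\<^bsub>N\<^esub> \<eta> r \<in> (\<lambda>z. s \<odot>\<^bsub>N\<^esub> z) ` carrier N"
      using invertible that Qc c in_R by (simp add: invertible_on_def bij_betw_def)
    then obtain z where "z \<in> carrier N" "s \<odot>\<^bsub>N\<^esub> z = \<ominus>\<^bsub>N\<^esub> Q s y \<oplus>\<^bsub>N\<^esub> \<eta> r" by force
    then show ?thesis using that Qc c in_R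
      by (intro bexI[of _ z]) (simp_all add: N.M.r_neg2)
  qed
  have z_unique: "z = z'"
    if s: "s \<in> S" "t \<in> S" and r: "r \<in> carrier R" "r' \<in> carrier R" and y: "y \<in> carrier L"
      and z: "z \<in> carrier N" "z' \<in> carrier N"
      and e: "s \<odot>\<^bsub>L\<^esub> y = l r" "t \<odot>\<^bsub>L\<^esub> y = l r'"
        "Q s y \<oplus>\<^bsub>N\<^esub> s \<odot>\<^bsub>N\<^esub> z = \<eta> r" "Q t y \<oplus>\<^bsub>N\<^esub> t \<odot>\<^bsub>N\<^esub> z' = \<eta> r'" for s t r r' y z z'
  proof -
    have sR: "s \<in> carrier R" "t \<in> carrier R" using s in_R by auto
    \<comment> \<open>Both sides equal s t y. After \<eta> is expanded at the two numerators with
      \<open>Q\<close> and \<open>C\<close>, everything cancels by \<open>C_sym\<close> except t s z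
      and t s z'.\<close>
    have "l (s \<otimes> r') = l (t \<otimes> r)"
      using sR r y by (simp add: l_simps flip: e L.smult_assoc1) (simp add: L.m_comm)
    then have "\<eta> (s \<otimes> r') = \<eta> (t \<otimes> r)" using \<eta>_cong sR r by simp
    then have "(C s t y \<oplus>\<^bsub>N\<^esub> t \<odot>\<^bsub>N\<^esub> Q s y) \<oplus>\<^bsub>N\<^esub> s \<odot>\<^bsub>N\<^esub> (Q t y \<oplus>\<^bsub>N\<^esub> t \<odot>\<^bsub>N\<^esub> z')
        = (C s t y \<oplus>\<^bsub>N\<^esub> s \<odot>\<^bsub>N\<^esub> Q t y) \<oplus>\<^bsub>N\<^esub> t \<odot>\<^bsub>N\<^esub> (Q s y \<oplus>\<^bsub>N\<^esub> s \<odot>\<^bsub>N\<^esub> z)"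
      using sR r y by (simp add: Q_comm e flip: e(1,2)) (simp add: C_comm C_sym[of s t])
    moreover have "s \<odot>\<^bsub>N\<^esub> (t \<odot>\<^bsub>N\<^esub> z') = t \<odot>\<^bsub>N\<^esub> (s \<odot>\<^bsub>N\<^esub> z')"
      using sR z by (simp add: L.m_comm flip: N.smult_assoc1)
    ultimately have "(C s t y \<oplus>\<^bsub>N\<^esub> (t \<odot>\<^bsub>N\<^esub> Q s y \<oplus>\<^bsub>N\<^esub> s \<odot>\<^bsub>N\<^esub> Q t y)) \<oplus>\<^bsub>N\<^esub> t \<odot>\<^bsub>N\<^esub> (s \<odot>\<^bsub>N\<^esub> z')
       = (C s t y \<oplus>\<^bsub>N\<^esub> (t \<odot>\<^bsub>N\<^esub> Q s y \<oplus>\<^bsub>N\<^esub> s \<odot>\<^bsub>N\<^esub> Q t y)) \<oplus>\<^bsub>N\<^esub> t \<odot>\<^bsub>N\<^esub> (s \<odot>\<^bsub>N\<^esub> z)"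
      using sR z y Cc Qc by (simp add: N.smult_r_distr N.a_ac)
    then have "t \<odot>\<^bsub>N\<^esub> (s \<odot>\<^bsub>N\<^esub> z') = t \<odot>\<^bsub>N\<^esub> (s \<odot>\<^bsub>N\<^esub> z)"
      using sR z y Cc Qc by simp
    then show ?thesis using smult_cancel s sR z by (metis N.smult_closed)
  qed
  define P where "P = (\<lambda>y. THE z. z \<in> carrier N \<and>
     (\<exists>s\<in>S. \<exists>r\<in>carrier R. s \<odot>\<^bsub>L\<^esub> y = l r \<and> Q s y \<oplus>\<^bsub>N\<^esub> s \<odot>\<^bsub>N\<^esub> z = \<eta> r))"
  have P_eq: "P y = z" if "s \<in> S" "r \<in> carrier R" "y \<in> carrier L" "z \<in> carrier N"
      "s \<odot>\<^bsub>L\<^esub> y = l r" "Q s y \<oplus>\<^bsub>N\<^esub> s \<odot>\<^bsub>N\<^esub> z = \<eta> r" for s r y z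
    unfolding P_def using that z_unique by (intro the_equality) blast+
  have Pc: "P y \<in> carrier N" if "y \<in> carrier L" for y
    using denominator[OF that] z_ex that P_eq by metis
  have P_char: "Q s y \<oplus>\<^bsub>N\<^esub> s \<odot>\<^bsub>N\<^esub> P y = \<eta> r"
    if "s \<in> S" "r \<in> carrier R" "y \<in> carrier L" "s \<odot>\<^bsub>L\<^esub> y = l r" for s r y
    using z_ex that P_eq by metis
  have Pl: "P (l r) = \<eta> r" if "r \<in> carrier R" for r
  proof (rule P_eq[OF S_one that])
    have "\<eta> (\<one> \<otimes> r) = Q \<one> (l r) \<oplus>\<^bsub>N\<^esub> \<one> \<odot>\<^bsub>N\<^esub> \<eta> r" using Q_comm[of \<one> r] that by blast
    then show "Q \<one> (l r) \<oplus>\<^bsub>N\<^esub> \<one> \<odot>\<^bsub>N\<^esub> \<eta> r = \<eta> r" using that by simp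
  qed (use that c in \<open>simp_all add: l_simps\<close>)
  have "additive_map L N P"
  proof (rule additive_mapI[OF Pc])
    fix y y' assume y: "y \<in> carrier L" "y' \<in> carrier L"
    obtain s r where s: "s \<in> S" and r: "r \<in> carrier R" and sy: "s \<odot>\<^bsub>L\<^esub> y = l r"
      using denominator[OF y(1)] by blast
    obtain t r' where t: "t \<in> S" and r': "r' \<in> carrier R" and ty: "t \<odot>\<^bsub>L\<^esub> y' = l r'"
      using denominator[OF y(2)] by blast
    note sR = in_R[OF s] in_R[OF t]
    have e: "(s \<otimes> t) \<odot>\<^bsub>L\<^esub> y = l (t \<otimes> r)" "(s \<otimes> t) \<odot>\<^bsub>L\<^esub> y' = l (s \<otimes> r')"
      using sR r r' y by (simp_all add: l_simps L.smult_assoc1 ty flip: sy)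
        (simp add: L.m_comm flip: L.smult_assoc1)
    show "P (y \<oplus>\<^bsub>L\<^esub> y') = P y \<oplus>\<^bsub>N\<^esub> P y'"
    proof (rule P_eq[OF S_mult[OF s t]])
      show "t \<otimes> r \<oplus> s \<otimes> r' \<in> carrier R" using sR r r' by simp
      show "(s \<otimes> t) \<odot>\<^bsub>L\<^esub> (y \<oplus>\<^bsub>L\<^esub> y') = l (t \<otimes> r \<oplus> s \<otimes> r')"
        using sR r r' y e by (simp add: L.smult_r_distr l_simps(2))
      have "\<eta> (t \<otimes> r \<oplus> s \<otimes> r') = (Q (s \<otimes> t) y \<oplus>\<^bsub>N\<^esub> (s \<otimes> t) \<odot>\<^bsub>N\<^esub> P y) \<oplus>\<^bsub>N\<^esub>
          (Q (s \<otimes> t) y' \<oplus>\<^bsub>N\<^esub> (s \<otimes> t) \<odot>\<^bsub>N\<^esub> P y')"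
        using P_char[OF S_mult[OF s t] _ y(1) e(1)] P_char[OF S_mult[OF s t] _ y(2) e(2)] sR r r'
        by (simp add: add)
      then show "Q (s \<otimes> t) (y \<oplus>\<^bsub>L\<^esub> y') \<oplus>\<^bsub>N\<^esub> (s \<otimes> t) \<odot>\<^bsub>N\<^esub> (P y \<oplus>\<^bsub>N\<^esub> P y') = \<eta> (t \<otimes> r \<oplus> s \<otimes> r')"
        using sR y Pc Qc by (simp add: Qadd N.smult_r_distr N.a_ac)
    qed (use y Pc in auto)
  qed
  \<comment> \<open>The commutator [P, f] turns out to be \<open>Q f\<close> itself, whose bound n
    yields the bound \<open>Suc n\<close> for P.\<close>
  moreover have "P (f \<odot>\<^bsub>L\<^esub> y) = Q f y \<oplus>\<^bsub>N\<^esub> f \<odot>\<^bsub>N\<^esub> P y" if f: "f \<in> carrier R" and y: "y \<in> carrier L" for f y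
  proof -
    obtain s r where s: "s \<in> S" and r: "r \<in> carrier R" and sy: "s \<odot>\<^bsub>L\<^esub> y = l r"
      using denominator[OF y(1)] by blast
    note sR = in_R[OF s]
    show ?thesis
    proof (rule P_eq[OF s])
      show "s \<odot>\<^bsub>L\<^esub> (f \<odot>\<^bsub>L\<^esub> y) = l (f \<otimes> r)"
        using sR f r y by (simp add: l_simps flip: sy L.smult_assoc1) (simp add: L.m_comm)
      have "\<eta> (f \<otimes> r) = (C s f y \<oplus>\<^bsub>N\<^esub> s \<odot>\<^bsub>N\<^esub> Q f y) \<oplus>\<^bsub>N\<^esub> f \<odot>\<^bsub>N\<^esub> (Q s y \<oplus>\<^bsub>N\<^esub> s \<odot>\<^bsub>N\<^esub> P y)"
        using sR f r y P_char[OF s r y sy] by (simp add: Q_comm C_comm C_sym[of s f] flip: sy)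
      moreover have "f \<odot>\<^bsub>N\<^esub> (s \<odot>\<^bsub>N\<^esub> P y) = s \<odot>\<^bsub>N\<^esub> (f \<odot>\<^bsub>N\<^esub> P y)"
        using sR f y Pc by (simp add: L.m_comm flip: N.smult_assoc1)
      ultimately show "Q s (f \<odot>\<^bsub>L\<^esub> y) \<oplus>\<^bsub>N\<^esub> s \<odot>\<^bsub>N\<^esub> (Q f y \<oplus>\<^bsub>N\<^esub> f \<odot>\<^bsub>N\<^esub> P y) = \<eta> (f \<otimes> r)"
        using sR f y Pc Qc Cc by (simp add: C_comm N.smult_r_distr N.a_ac)
    qed (use f y r Pc Qc in auto)
  qed
  ultimately have "dop R L N (Suc n) P" using Q by auto
  then show ?case using Pl by blast
qed

end


section \<open>Localizations\<close>

locale multiplicative_subset = cring R for R :: "('a, 'r) ring_scheme" (structure) + fixes S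
  assumes S_carrier: "S \<subseteq> carrier R"
    and S_one: "\<one> \<in> S"
    and S_mult: "\<lbrakk>s \<in> S; t \<in> S\<rbrakk> \<Longrightarrow> s \<otimes> t \<in> S"
begin

abbreviation L where "L \<equiv> localization R S"

abbreviation frac where "frac \<equiv> loc_frac R S"

lemma in_R: "s \<in> S \<Longrightarrow> s \<in> carrier R"
  using S_carrier by auto

text \<open>Without the difference, membership becomes an equation between products, which
  associativity and commutativity alone can handle in the proofs of transitivity and
  well-definedness.\<close>

lemma loc_rel_iff:
  "((r, s), (r', s')) \<in> loc_rel R S \<longleftrightarrow> r \<in> carrier R \<and> s \<in> S \<and> r' \<in> carrier R \<and> s' \<in> S \<and>
     (\<exists>u\<in>S. u \<otimes> (s' \<otimes> r) = u \<otimes> (s \<otimes> r'))"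
proof -
  have "u \<otimes> (s' \<otimes> r \<ominus> s \<otimes> r') = \<zero> \<longleftrightarrow> u \<otimes> (s' \<otimes> r) = u \<otimes> (s \<otimes> r')"
    if "r \<in> carrier R" "s \<in> S" "r' \<in> carrier R" "s' \<in> S" "u \<in> S" for u
  proof -
    have "u \<otimes> (s' \<otimes> r \<ominus> s \<otimes> r') = u \<otimes> (s' \<otimes> r) \<ominus> u \<otimes> (s \<otimes> r')"
      using that in_R by (simp add: minus_eq r_distr r_minus)
    then show ?thesis using that in_R by (simp add: r_right_minus_eq)
  qed
  then show ?thesis unfolding loc_rel_def by blast
qed

lemma loc_rel_equiv: "equiv (carrier R \<times> S) (loc_rel R S)"
proof (rule equivI)
  show "loc_rel R S \<subseteq> (carrier R \<times> S) \<times> (carrier R \<times> S)" by (auto simp: loc_rel_iff)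
  show "refl_on (carrier R \<times> S) (loc_rel R S)" using S_one by (auto simp: refl_on_def loc_rel_iff)
  show "sym (loc_rel R S)"
  proof (rule symI, clarify)
    fix a b c d assume "((a, b), (c, d)) \<in> loc_rel R S"
    then show "((c, d), (a, b)) \<in> loc_rel R S" by (metis loc_rel_iff)
  qed
  show "trans (loc_rel R S)"
  proof (rule transI, clarify)
    fix a b c d e f
    assume 1: "((a, b), (c, d)) \<in> loc_rel R S" and 2: "((c, d), (e, f)) \<in> loc_rel R S"
    obtain u where u: "u \<in> S" "u \<otimes> (d \<otimes> a) = u \<otimes> (b \<otimes> c)" using 1 loc_rel_iff by auto
    obtain v where v: "v \<in> S" "v \<otimes> (f \<otimes> c) = v \<otimes> (d \<otimes> e)" using 2 loc_rel_iff by auto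
    have mem: "a \<in> carrier R" "b \<in> S" "c \<in> carrier R" "d \<in> S" "e \<in> carrier R" "f \<in> S"
      using 1 2 by (auto simp: loc_rel_iff)
    note car = mem mem(2,4,6)[THEN in_R] in_R[OF u(1)] in_R[OF v(1)]
    have "((u \<otimes> v) \<otimes> d) \<otimes> (f \<otimes> a) = (v \<otimes> f) \<otimes> (u \<otimes> (d \<otimes> a))" using car by (simp add: m_ac)
    also have "\<dots> = (u \<otimes> b) \<otimes> (v \<otimes> (f \<otimes> c))" unfolding u using car by (simp add: m_ac)
    also have "\<dots> = ((u \<otimes> v) \<otimes> d) \<otimes> (b \<otimes> e)" unfolding v using car by (simp add: m_ac)
    finally show "((a, b), (e, f)) \<in> loc_rel R S"
      using mem u v S_mult by (auto simp: loc_rel_iff)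
  qed
qed

lemma frac_eq_iff:
  assumes "r \<in> carrier R" "s \<in> S" "r' \<in> carrier R" "s' \<in> S"
  shows "frac r s = frac r' s' \<longleftrightarrow> (\<exists>u\<in>S. u \<otimes> (s' \<otimes> r) = u \<otimes> (s \<otimes> r'))"
  using eq_equiv_class_iff[OF loc_rel_equiv, of "(r, s)" "(r', s')"] assms
  by (simp add: loc_frac_def loc_rel_iff)

lemma mem_frac_iff:
  assumes "r \<in> carrier R" "s \<in> S"
  shows "(a, b) \<in> frac r s \<longleftrightarrow> a \<in> carrier R \<and> b \<in> S \<and> frac a b = frac r s"
  using equiv_class_eq_iff[OF loc_rel_equiv, of "(r, s)" "(a, b)"] assms
  by (auto simp: loc_frac_def)

lemma frac_eqI:
  assumes "r \<in> carrier R" "s \<in> S" "r' \<in> carrier R" "s' \<in> S" "s' \<otimes> r = s \<otimes> r'"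
  shows "frac r s = frac r' s'"
  using assms S_one by (auto simp: frac_eq_iff)

lemma carrier_localization:
  "X \<in> carrier L \<longleftrightarrow> (\<exists>r\<in>carrier R. \<exists>s\<in>S. X = frac r s)"
  by (auto simp: localization_def quotient_def loc_frac_def)

text \<open>The operations of \<open>localization\<close> are unions over all representatives; such
  a union collapses to a single value as soon as every representative gives that value.\<close>

lemma UN_frac:
  assumes "r \<in> carrier R" "s \<in> S"
    and "\<And>a b. \<lbrakk>a \<in> carrier R; b \<in> S; frac a b = frac r s\<rbrakk> \<Longrightarrow> g a b = V"
  shows "(\<Union>(a, b)\<in>frac r s. g a b) = V"
proof (rule UN_constant_eq)
  show "(r, s) \<in> frac r s" using assms by (simp add: mem_frac_iff)
  show "\<forall>p\<in>frac r s. (case p of (a, b) \<Rightarrow> g a b) = V"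
    using assms by (auto simp: mem_frac_iff)
qed

lemma add_frac:
  assumes "r \<in> carrier R" "s \<in> S" "r' \<in> carrier R" "s' \<in> S"
  shows "frac r s \<oplus>\<^bsub>L\<^esub> frac r' s'
    = frac (s' \<otimes> r \<oplus> s \<otimes> r') (s \<otimes> s')"
proof -
  have "frac (b' \<otimes> a \<oplus> b \<otimes> a') (b \<otimes> b') = frac (s' \<otimes> r \<oplus> s \<otimes> r') (s \<otimes> s')"
    if ab: "a \<in> carrier R" "b \<in> S" "frac a b = frac r s"
      "a' \<in> carrier R" "b' \<in> S" "frac a' b' = frac r' s'" for a b a' b'
  proof -
    obtain u where u: "u \<in> S" "u \<otimes> (s \<otimes> a) = u \<otimes> (b \<otimes> r)"
      using ab assms frac_eq_iff[of a b r s] by auto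
    obtain v where v: "v \<in> S" "v \<otimes> (s' \<otimes> a') = v \<otimes> (b' \<otimes> r')"
      using ab assms frac_eq_iff[of a' b' r' s'] by auto
    note car = assms(1,3) ab(1,4) in_R[OF u(1)] in_R[OF v(1)] in_R[OF ab(2)] in_R[OF ab(5)]
      in_R[OF assms(2)] in_R[OF assms(4)]
    have "(u \<otimes> v) \<otimes> ((s \<otimes> s') \<otimes> (b' \<otimes> a \<oplus> b \<otimes> a'))
        = (v \<otimes> s' \<otimes> b') \<otimes> (u \<otimes> (s \<otimes> a)) \<oplus> (u \<otimes> s \<otimes> b) \<otimes> (v \<otimes> (s' \<otimes> a'))"
      using car by (simp add: r_distr m_ac)
    also have "\<dots> = (u \<otimes> v) \<otimes> ((b \<otimes> b') \<otimes> (s' \<otimes> r \<oplus> s \<otimes> r'))"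
      unfolding u v using car by (simp add: r_distr m_ac)
    finally show ?thesis
      using assms ab u v S_mult car by (subst frac_eq_iff) (auto simp: S_mult)
  qed
  then have "(\<Union>(a, b)\<in>frac r s. \<Union>(a', b')\<in>frac r' s'.
      frac (b' \<otimes> a \<oplus> b \<otimes> a') (b \<otimes> b')) = frac (s' \<otimes> r \<oplus> s \<otimes> r') (s \<otimes> s')"
    using assms by (intro UN_frac) blast+
  then show ?thesis by (simp add: localization_def)
qed

lemma smult_frac:
  assumes "r \<in> carrier R" "s \<in> S" "a \<in> carrier R"
  shows "a \<odot>\<^bsub>L\<^esub> frac r s = frac (a \<otimes> r) s"
proof -
  have "frac (a \<otimes> c) d = frac (a \<otimes> r) s"
    if cd: "c \<in> carrier R" "d \<in> S" "frac c d = frac r s" for c d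
  proof -
    obtain u where u: "u \<in> S" "u \<otimes> (s \<otimes> c) = u \<otimes> (d \<otimes> r)"
      using cd assms frac_eq_iff[of c d r s] by auto
    note car = assms(1,3) cd(1) in_R[OF u(1)] in_R[OF cd(2)] in_R[OF assms(2)]
    have "u \<otimes> (s \<otimes> (a \<otimes> c)) = a \<otimes> (u \<otimes> (s \<otimes> c))" using car by (simp add: m_ac)
    also have "\<dots> = u \<otimes> (d \<otimes> (a \<otimes> r))" unfolding u using car by (simp add: m_ac)
    finally show ?thesis using assms cd u by (subst frac_eq_iff) auto
  qed
  then have "(\<Union>(c, d)\<in>frac r s. frac (a \<otimes> c) d) = frac (a \<otimes> r) s"
    using assms by (intro UN_frac) blast+
  then show ?thesis by (simp add: localization_def)
qed

lemma zero_localization: "\<zero>\<^bsub>L\<^esub> = frac \<zero> \<one>"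
  by (simp add: localization_def)

lemma frac_zero: "s \<in> S \<Longrightarrow> frac \<zero> s = \<zero>\<^bsub>L\<^esub>"
  using S_one in_R by (simp add: zero_localization frac_eqI)

lemma frac_closed: "\<lbrakk>r \<in> carrier R; s \<in> S\<rbrakk> \<Longrightarrow> frac r s \<in> carrier L"
  by (auto simp: carrier_localization)

lemma localization_E:
  assumes "X \<in> carrier L"
  obtains r s where "r \<in> carrier R" "s \<in> S" "X = frac r s"
  using assms by (auto simp: carrier_localization)

lemma localization_module: "module R L"
proof (rule moduleI)
  show "cring R" by (rule is_cring)
  show "abelian_group L"
  proof (rule abelian_groupI)
    fix X Y assume "X \<in> carrier L" "Y \<in> carrier L"
    then show "X \<oplus>\<^bsub>L\<^esub> Y \<in> carrier L"
      by (elim localization_E) (simp add: add_frac frac_closed S_mult in_R)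
  next
    show "\<zero>\<^bsub>L\<^esub> \<in> carrier L" by (simp add: zero_localization frac_closed S_one)
  next
    fix X Y Z assume "X \<in> carrier L" "Y \<in> carrier L" "Z \<in> carrier L"
    then show "X \<oplus>\<^bsub>L\<^esub> Y \<oplus>\<^bsub>L\<^esub> Z = X \<oplus>\<^bsub>L\<^esub> (Y \<oplus>\<^bsub>L\<^esub> Z)"
      by (elim localization_E) (simp add: add_frac S_mult in_R r_distr m_ac a_ac)
  next
    fix X Y assume "X \<in> carrier L" "Y \<in> carrier L"
    then show "X \<oplus>\<^bsub>L\<^esub> Y = Y \<oplus>\<^bsub>L\<^esub> X"
      by (elim localization_E) (simp add: add_frac in_R m_ac a_ac)
  next
    fix X assume "X \<in> carrier L"
    then show "\<zero>\<^bsub>L\<^esub> \<oplus>\<^bsub>L\<^esub> X = X"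
      by (elim localization_E) (simp add: zero_localization add_frac in_R S_one)
  next
    fix X assume "X \<in> carrier L"
    then obtain r s where X: "r \<in> carrier R" "s \<in> S" "X = frac r s"
      by (rule localization_E)
    then have "frac (\<ominus> r) s \<oplus>\<^bsub>L\<^esub> X = \<zero>\<^bsub>L\<^esub>"
      by (simp add: add_frac in_R r_minus l_neg frac_zero S_mult)
    then show "\<exists>Y\<in>carrier L. Y \<oplus>\<^bsub>L\<^esub> X = \<zero>\<^bsub>L\<^esub>"
      using X by (intro bexI[of _ "frac (\<ominus> r) s"]) (auto intro: frac_closed)
  qed
  fix a b X Y assume ab: "a \<in> carrier R" "b \<in> carrier R" and X: "X \<in> carrier L" and Y: "Y \<in> carrier L"
  show "a \<odot>\<^bsub>L\<^esub> X \<in> carrier L"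
    using ab X by (elim localization_E) (simp add: smult_frac frac_closed)
  show "(a \<oplus> b) \<odot>\<^bsub>L\<^esub> X = a \<odot>\<^bsub>L\<^esub> X \<oplus>\<^bsub>L\<^esub> b \<odot>\<^bsub>L\<^esub> X"
    using ab X by (elim localization_E)
      (simp add: smult_frac add_frac in_R, rule frac_eqI, simp_all add: in_R S_mult l_distr r_distr m_ac)
  show "a \<odot>\<^bsub>L\<^esub> (X \<oplus>\<^bsub>L\<^esub> Y) = a \<odot>\<^bsub>L\<^esub> X \<oplus>\<^bsub>L\<^esub> a \<odot>\<^bsub>L\<^esub> Y"
    using ab X Y by (elim localization_E) (simp add: smult_frac add_frac in_R S_mult r_distr m_ac)
  show "(a \<otimes> b) \<odot>\<^bsub>L\<^esub> X = a \<odot>\<^bsub>L\<^esub> (b \<odot>\<^bsub>L\<^esub> X)"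
    using ab X by (elim localization_E) (simp add: smult_frac m_assoc)
next
  fix X assume X: "X \<in> carrier L"
  then show "\<one> \<odot>\<^bsub>L\<^esub> X = X"
    by (elim localization_E) (simp add: smult_frac)
qed

lemma frac_one_hom: "(\<lambda>r. frac r \<one>) \<in> mod_hom R (regular_module R) L"
  by (rule mod_homI) (simp_all add: frac_closed S_one add_frac smult_frac)

lemma localization_fraction_module:
  "fraction_module R S L (\<lambda>r. frac r \<one>)"
proof (intro fraction_module.intro fraction_module_axioms.intro localization_module
    S_carrier S_one S_mult frac_one_hom)
  fix X assume "X \<in> carrier L"
  then obtain r s where X: "r \<in> carrier R" "s \<in> S" "X = frac r s"
    by (rule localization_E)
  then have "s \<odot>\<^bsub>L\<^esub> X = frac r \<one>"
    by (simp add: smult_frac in_R) (rule frac_eqI; simp add: in_R S_one)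
  then show "\<exists>s\<in>S. \<exists>r\<in>carrier R. s \<odot>\<^bsub>L\<^esub> X = frac r \<one>"
    using X by blast
next
  fix r assume "r \<in> carrier R" "frac r \<one> = \<zero>\<^bsub>L\<^esub>"
  then show "\<exists>u\<in>S. u \<otimes> r = \<zero>"
    using S_one in_R by (auto simp: zero_localization frac_eq_iff)
qed

lemma invertible_on_localization:
  assumes "T \<subseteq> S"
  shows "invertible_on T L"
  unfolding invertible_on_def
proof (intro ballI)
  fix t assume "t \<in> T"
  then have t: "t \<in> S" "t \<in> carrier R" using assms in_R by auto
  interpret L: module R L by (rule localization_module)
  show "bij_betw (\<lambda>y. t \<odot>\<^bsub>L\<^esub> y) (carrier L) (carrier L)"
  proof (rule bij_betw_byWitness[where f' = "\<lambda>y. SOME z. z \<in> carrier L \<and> t \<odot>\<^bsub>L\<^esub> z = y"])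
    have ex: "\<exists>z. z \<in> carrier L \<and> t \<odot>\<^bsub>L\<^esub> z = X"
      if "X \<in> carrier L" for X
      using that
    proof (rule localization_E)
      fix r s assume X: "r \<in> carrier R" "s \<in> S" "X = frac r s"
      then have "t \<odot>\<^bsub>L\<^esub> frac r (t \<otimes> s) = X"
        using t by (simp add: smult_frac S_mult) (rule frac_eqI; simp add: in_R S_mult m_ac)
      then show ?thesis using X t frac_closed S_mult by blast
    qed
    have inj: "X = Y" if XY: "X \<in> carrier L" "Y \<in> carrier L"
      "t \<odot>\<^bsub>L\<^esub> X = t \<odot>\<^bsub>L\<^esub> Y" for X Y
    proof -
      obtain r s where X: "r \<in> carrier R" "s \<in> S" "X = frac r s"
        using XY(1) by (rule localization_E)
      obtain r' s' where Y: "r' \<in> carrier R" "s' \<in> S" "Y = frac r' s'"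
        using XY(2) by (rule localization_E)
      obtain u where u: "u \<in> S" "u \<otimes> (s' \<otimes> (t \<otimes> r)) = u \<otimes> (s \<otimes> (t \<otimes> r'))"
        using XY(3) X Y t by (auto simp: smult_frac frac_eq_iff)
      then have "(u \<otimes> t) \<otimes> (s' \<otimes> r) = (u \<otimes> t) \<otimes> (s \<otimes> r')"
        using X Y t in_R by (simp add: m_ac)
      then show ?thesis using X Y t u S_mult by (auto simp: frac_eq_iff)
    qed
    show "\<forall>a\<in>carrier L. (SOME z. z \<in> carrier L \<and>
        t \<odot>\<^bsub>L\<^esub> z = t \<odot>\<^bsub>L\<^esub> a) = a"
      using inj by (auto intro!: some_equality)
    show "\<forall>a\<in>carrier L. t \<odot>\<^bsub>L\<^esub> (SOME z. z \<in> carrier L \<and>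
        t \<odot>\<^bsub>L\<^esub> z = a) = a"
      using someI_ex[OF ex] by blast
    show "(\<lambda>y. SOME z. z \<in> carrier L \<and> t \<odot>\<^bsub>L\<^esub> z = y) ` carrier L
        \<subseteq> carrier L"
      using someI_ex[OF ex] by blast
  qed (use t in auto)
qed

end

lemma loc_map_frac:
  assumes "multiplicative_subset R S" "multiplicative_subset R T" "S \<subseteq> T"
    and "r \<in> carrier R" "s \<in> S"
  shows "loc_map R T (loc_frac R S r s) = loc_frac R T r s"
proof -
  interpret S: multiplicative_subset R S by fact
  interpret T: multiplicative_subset R T by fact
  have "loc_frac R T a b = loc_frac R T r s"
    if "a \<in> carrier R" "b \<in> S" "loc_frac R S a b = loc_frac R S r s" for a b
    using that assms S.frac_eq_iff[of a b r s] T.frac_eq_iff[of a b r s] by auto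
  then show ?thesis unfolding loc_map_def using assms by (intro S.UN_frac)
qed

lemma loc_map_hom:
  assumes S: "multiplicative_subset R S" and T: "multiplicative_subset R T" and ST: "S \<subseteq> T"
  shows "loc_map R T \<in> mod_hom R (localization R S) (localization R T)"
proof -
  interpret S: multiplicative_subset R S by fact
  interpret T: multiplicative_subset R T by fact
  note map = loc_map_frac[OF S T ST]
  have in_T: "s \<in> S \<Longrightarrow> s \<in> T" for s using ST by auto
  show ?thesis
  proof (rule mod_homI)
    fix X assume X: "X \<in> carrier (localization R S)"
    then show "loc_map R T X \<in> carrier (localization R T)"
      by (elim S.localization_E) (simp add: map T.frac_closed in_T)
    fix a assume "a \<in> carrier R"
    with X show "loc_map R T (a \<odot>\<^bsub>localization R S\<^esub> X) = a \<odot>\<^bsub>localization R T\<^esub> loc_map R T X"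
      by (elim S.localization_E) (simp add: map S.smult_frac T.smult_frac in_T)
  next
    fix X Y assume "X \<in> carrier (localization R S)" "Y \<in> carrier (localization R S)"
    then show "loc_map R T (X \<oplus>\<^bsub>localization R S\<^esub> Y) = loc_map R T X \<oplus>\<^bsub>localization R T\<^esub> loc_map R T Y"
      by (elim S.localization_E) (simp add: map S.add_frac T.add_frac in_T S.S_mult S.in_R)
  qed
qed


section \<open>The ring of differential operators\<close>

declare dop.simps [simp del]

lemma End_ring_simps:
  "(\<xi> \<otimes>\<^bsub>End_ring R K\<^esub> \<eta>) = compose (carrier R) \<xi> \<eta>"
  "\<one>\<^bsub>End_ring R K\<^esub> = (\<lambda>x\<in>carrier R. x)"
  "\<zero>\<^bsub>End_ring R K\<^esub> = (\<lambda>x\<in>carrier R. \<zero>\<^bsub>R\<^esub>)"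
  "\<xi> \<oplus>\<^bsub>End_ring R K\<^esub> \<eta> = (\<lambda>x\<in>carrier R. \<xi> x \<oplus>\<^bsub>R\<^esub> \<eta> x)"
  by (simp_all add: End_ring_def)

lemma End_ring_carrier:
  "\<xi> \<in> carrier (End_ring R K) \<longleftrightarrow> \<xi> \<in> extensional (carrier R) \<and> additive_map R R \<xi> \<and>
     (\<forall>c\<in>K. \<forall>x\<in>carrier R. \<xi> (c \<otimes>\<^bsub>R\<^esub> x) = c \<otimes>\<^bsub>R\<^esub> \<xi> x)"
  by (auto simp: End_ring_def additive_map_def PiE_def)

lemma End_ring_D:
  assumes "\<xi> \<in> carrier (End_ring R K)"
  shows End_ring_closed: "x \<in> carrier R \<Longrightarrow> \<xi> x \<in> carrier R"
    and End_ring_add: "\<lbrakk>x \<in> carrier R; y \<in> carrier R\<rbrakk> \<Longrightarrow> \<xi> (x \<oplus>\<^bsub>R\<^esub> y) = \<xi> x \<oplus>\<^bsub>R\<^esub> \<xi> y"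
    and End_ring_scalar: "\<lbrakk>c \<in> K; x \<in> carrier R\<rbrakk> \<Longrightarrow> \<xi> (c \<otimes>\<^bsub>R\<^esub> x) = c \<otimes>\<^bsub>R\<^esub> \<xi> x"
    and End_ring_extensional: "\<xi> \<in> extensional (carrier R)"
  using assms by (auto simp: End_ring_carrier additive_map_def)

lemma End_ring_eqI:
  assumes "\<xi> \<in> carrier (End_ring R K)" "\<eta> \<in> carrier (End_ring R K)"
    and "\<And>x. x \<in> carrier R \<Longrightarrow> \<xi> x = \<eta> x"
  shows "\<xi> = \<eta>"
  using assms by (meson End_ring_extensional extensionalityI)

locale operator_ring = cring R for R :: "('a, 'r) ring_scheme" (structure) + fixes K
  assumes K_carrier: "K \<subseteq> carrier R"
begin

abbreviation E where "E \<equiv> End_ring R K"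

lemma in_R: "c \<in> K \<Longrightarrow> c \<in> carrier R"
  using K_carrier by auto

lemma mult_op_End: "f \<in> carrier R \<Longrightarrow> mult_op R f \<in> carrier E"
  using K_carrier by (auto simp: End_ring_carrier mult_op_def r_distr m_lcomm intro!: additive_mapI)

lemma E_closed:
  assumes "\<xi> \<in> carrier E" "\<eta> \<in> carrier E"
  shows "\<xi> \<otimes>\<^bsub>E\<^esub> \<eta> \<in> carrier E" "\<xi> \<oplus>\<^bsub>E\<^esub> \<eta> \<in> carrier E"
proof -
  note [simp] = assms[THEN End_ring_closed] End_ring_add[OF assms(1)] End_ring_add[OF assms(2)]
    End_ring_scalar[OF assms(1)] End_ring_scalar[OF assms(2)]
  show "\<xi> \<otimes>\<^bsub>E\<^esub> \<eta> \<in> carrier E"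
    by (auto simp: End_ring_carrier End_ring_simps compose_def in_R intro!: additive_mapI)
  show "\<xi> \<oplus>\<^bsub>E\<^esub> \<eta> \<in> carrier E"
    by (auto simp: End_ring_carrier End_ring_simps in_R a_ac r_distr intro!: additive_mapI)
qed

lemma E_one: "\<one>\<^bsub>E\<^esub> = mult_op R \<one>"
  by (auto simp: End_ring_simps mult_op_def)

lemma E_zero: "\<zero>\<^bsub>E\<^esub> = mult_op R \<zero>"
  by (auto simp: End_ring_simps mult_op_def)

text \<open>Additive inverses are obtained as products with
  \<open>mult_op R (\<ominus> \<one>)\<close>. Closure under negation thereby follows from closure
  under products, first for all endomorphisms and later for the differential operators.\<close>

lemma E_neg:
  assumes "\<xi> \<in> carrier E"
  shows "(mult_op R (\<ominus> \<one>) \<otimes>\<^bsub>E\<^esub> \<xi>) \<oplus>\<^bsub>E\<^esub> \<xi> = \<zero>\<^bsub>E\<^esub>"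
proof (rule End_ring_eqI)
  show "(mult_op R (\<ominus> \<one>) \<otimes>\<^bsub>E\<^esub> \<xi>) \<oplus>\<^bsub>E\<^esub> \<xi> \<in> carrier E" "\<zero>\<^bsub>E\<^esub> \<in> carrier E"
    using assms mult_op_End[of "\<ominus> \<one>"] mult_op_End[of \<zero>] by (simp_all add: E_closed E_zero)
qed (use assms in \<open>simp add: End_ring_simps mult_op_def compose_def End_ring_closed l_minus l_neg\<close>)

lemma E_ring: "ring E"
proof (rule ringI)
  show "abelian_group E"
  proof (rule abelian_groupI)
    fix \<xi> assume \<xi>: "\<xi> \<in> carrier E"
    show "\<zero>\<^bsub>E\<^esub> \<oplus>\<^bsub>E\<^esub> \<xi> = \<xi>"
      using \<xi> E_closed mult_op_End[of \<zero>]
      by (intro End_ring_eqI[of _ R K]) (simp_all add: E_zero, simp add: End_ring_simps mult_op_def End_ring_closed)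
    show "\<exists>\<eta>\<in>carrier E. \<eta> \<oplus>\<^bsub>E\<^esub> \<xi> = \<zero>\<^bsub>E\<^esub>"
      using E_neg[OF \<xi>] E_closed(1)[OF _ \<xi>] mult_op_End[of "\<ominus> \<one>"] by auto
    fix \<eta> assume \<eta>: "\<eta> \<in> carrier E"
    show "\<xi> \<oplus>\<^bsub>E\<^esub> \<eta> = \<eta> \<oplus>\<^bsub>E\<^esub> \<xi>"
      using \<xi> \<eta> by (auto simp: End_ring_simps End_ring_closed a_comm intro!: restrict_ext)
    fix \<zeta> assume \<zeta>: "\<zeta> \<in> carrier E"
    show "\<xi> \<oplus>\<^bsub>E\<^esub> \<eta> \<oplus>\<^bsub>E\<^esub> \<zeta> = \<xi> \<oplus>\<^bsub>E\<^esub> (\<eta> \<oplus>\<^bsub>E\<^esub> \<zeta>)"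
      using \<xi> \<eta> \<zeta> by (auto simp: End_ring_simps End_ring_closed a_assoc intro!: restrict_ext)
  qed (auto simp: E_zero E_closed mult_op_End)
  show "monoid E"
  proof (rule monoidI)
    fix \<xi> assume \<xi>: "\<xi> \<in> carrier E"
    show "\<one>\<^bsub>E\<^esub> \<otimes>\<^bsub>E\<^esub> \<xi> = \<xi>" "\<xi> \<otimes>\<^bsub>E\<^esub> \<one>\<^bsub>E\<^esub> = \<xi>"
      using \<xi> E_closed mult_op_End[of \<one>]
      by (auto intro!: End_ring_eqI[of _ R K] simp: E_one)
        (simp_all add: End_ring_simps mult_op_def End_ring_closed compose_def)
    fix \<eta> \<zeta> assume \<eta>: "\<eta> \<in> carrier E" and \<zeta>: "\<zeta> \<in> carrier E"
    show "(\<xi> \<otimes>\<^bsub>E\<^esub> \<eta>) \<otimes>\<^bsub>E\<^esub> \<zeta> = \<xi> \<otimes>\<^bsub>E\<^esub> (\<eta> \<otimes>\<^bsub>E\<^esub> \<zeta>)"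
      using \<xi> \<eta> \<zeta> by (auto simp: End_ring_simps End_ring_closed compose_def intro!: restrict_ext)
  qed (auto simp: E_one E_closed mult_op_End)
  fix \<xi> \<eta> \<zeta> assume a: "\<xi> \<in> carrier E" "\<eta> \<in> carrier E" "\<zeta> \<in> carrier E"
  show "(\<xi> \<oplus>\<^bsub>E\<^esub> \<eta>) \<otimes>\<^bsub>E\<^esub> \<zeta> = \<xi> \<otimes>\<^bsub>E\<^esub> \<zeta> \<oplus>\<^bsub>E\<^esub> \<eta> \<otimes>\<^bsub>E\<^esub> \<zeta>"
    using a by (auto simp: End_ring_simps End_ring_closed compose_def intro!: restrict_ext)
  show "\<zeta> \<otimes>\<^bsub>E\<^esub> (\<xi> \<oplus>\<^bsub>E\<^esub> \<eta>) = \<zeta> \<otimes>\<^bsub>E\<^esub> \<xi> \<oplus>\<^bsub>E\<^esub> \<zeta> \<otimes>\<^bsub>E\<^esub> \<eta>"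
    using a by (auto simp: End_ring_simps End_ring_closed End_ring_add compose_def intro!: restrict_ext)
qed

lemma commutator_closed:
  "\<lbrakk>\<xi> \<in> carrier E; f \<in> carrier R\<rbrakk> \<Longrightarrow> commutator E \<xi> (mult_op R f) \<in> carrier E"
  by (simp add: commutator_def ring.ring_simprules E_ring mult_op_End)

text \<open>This trades the commutator in the ring of endomorphisms for the subtraction-free
  identity on which \<open>dop\<close> is based.\<close>

lemma commutator_apply:
  assumes \<xi>: "\<xi> \<in> carrier E" and f: "f \<in> carrier R" and x: "x \<in> carrier R"
  shows "\<xi> (f \<otimes> x) = commutator E \<xi> (mult_op R f) x \<oplus> f \<otimes> \<xi> x"
proof -
  interpret E: ring E by (rule E_ring)
  have "commutator E \<xi> (mult_op R f) \<oplus>\<^bsub>E\<^esub> mult_op R f \<otimes>\<^bsub>E\<^esub> \<xi> = \<xi> \<otimes>\<^bsub>E\<^esub> mult_op R f"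
    using \<xi> mult_op_End[OF f] by (simp add: commutator_def a_minus_def E.a_assoc E.l_neg)
  then have "(commutator E \<xi> (mult_op R f) \<oplus>\<^bsub>E\<^esub> mult_op R f \<otimes>\<^bsub>E\<^esub> \<xi>) x = (\<xi> \<otimes>\<^bsub>E\<^esub> mult_op R f) x"
    by simp
  then show ?thesis
    using x f \<xi> by (simp add: End_ring_simps compose_def mult_op_def End_ring_closed)
qed

sublocale reg: module_pair R "regular_module R" "regular_module R"
  by (intro module_pair.intro regular_module)

abbreviation dop_R where "dop_R \<equiv> dop R (regular_module R) (regular_module R)"

lemma mult_op_hom: "f \<in> carrier R \<Longrightarrow> mult_op R f \<in> mod_hom R (regular_module R) (regular_module R)"
  by (rule mod_homI) (simp_all add: mult_op_def r_distr m_lcomm)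

text \<open>Order at most n corresponds to the strict bound \<open>Suc n\<close>. The substance is
  in the case n = 0: there all commutators vanish, so \<xi> is R-linear and is multiplication by its
  value at \<one>.\<close>

lemma diff_ops_order_iff:
  "\<xi> \<in> diff_ops_order R K n \<longleftrightarrow>
     \<xi> \<in> carrier E \<and> dop_R (Suc n) \<xi>"
proof (induction n arbitrary: \<xi>)
  case 0
  show ?case
  proof
    assume "\<xi> \<in> diff_ops_order R K 0"
    then show "\<xi> \<in> carrier E \<and> dop_R (Suc 0) \<xi>"
      using mult_op_End mult_op_hom reg.mod_hom_dop by auto
  next
    assume a: "\<xi> \<in> carrier E \<and> dop_R (Suc 0) \<xi>"
    have eq: "\<xi> (x \<otimes> \<one>) = x \<otimes> \<xi> \<one>" if "x \<in> carrier R" for x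
    proof -
      obtain \<psi> where \<psi>: "dop_R 0 \<psi>"
          "\<And>y. y \<in> carrier (regular_module R) \<Longrightarrow> \<xi> (x \<odot>\<^bsub>regular_module R\<^esub> y)
            = \<psi> y \<oplus>\<^bsub>regular_module R\<^esub> x \<odot>\<^bsub>regular_module R\<^esub> \<xi> y"
        using dop_SucE[OF conjunct2[OF a] \<open>x \<in> carrier R\<close>] by blast
      have "\<psi> \<one> = \<zero>" "\<xi> \<one> \<in> carrier R"
        using \<psi> End_ring_closed[OF conjunct1[OF a], of \<one>] by (simp_all add: dop.simps(1))
      then show ?thesis
        using \<psi>(2)[of \<one>] \<open>x \<in> carrier R\<close> by simp
    qed
    have c: "\<xi> \<one> \<in> carrier R"
      by (rule End_ring_closed[OF conjunct1[OF a] one_closed])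
    have "\<xi> = mult_op R (\<xi> \<one>)"
    proof (rule End_ring_eqI[OF conjunct1[OF a] mult_op_End[OF c]])
      fix x assume x: "x \<in> carrier R"
      show "\<xi> x = mult_op R (\<xi> \<one>) x"
        using eq[OF x] x m_comm[OF c x] by (simp only: mult_op_def restrict_apply' r_one)
    qed
    then show "\<xi> \<in> diff_ops_order R K 0"
      using End_ring_closed[OF conjunct1[OF a] one_closed] unfolding diff_ops_order.simps by (rule image_eqI)
  qed
next
  case (Suc n)
  show ?case
  proof
    assume a: "\<xi> \<in> diff_ops_order R K (Suc n)"
    then have \<xi>: "\<xi> \<in> carrier E" by simp
    have "\<exists>\<psi>. dop_R (Suc n) \<psi> \<and>
        (\<forall>x\<in>carrier R. \<xi> (f \<otimes> x) = \<psi> x \<oplus> f \<otimes> \<xi> x)" if f: "f \<in> carrier R" for f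
    proof -
      have "commutator E \<xi> (mult_op R f) \<in> diff_ops_order R K n" using a f by simp
      then show ?thesis using Suc.IH commutator_apply[OF \<xi> f] by blast
    qed
    then have "dop_R (Suc (Suc n)) \<xi>"
      using \<xi> unfolding dop.simps(2)[of _ _ _ "Suc n"]
      by (auto simp: End_ring_carrier additive_map_def)
    with \<xi> show "\<xi> \<in> carrier E \<and> dop_R (Suc (Suc n)) \<xi>" ..
  next
    assume a: "\<xi> \<in> carrier E \<and> dop_R (Suc (Suc n)) \<xi>"
    then have \<xi>: "\<xi> \<in> carrier E" by simp
    have "commutator E \<xi> (mult_op R f) \<in> diff_ops_order R K n" if f: "f \<in> carrier R" for f
    proof -
      obtain \<psi> where \<psi>: "dop_R (Suc n) \<psi>"
          "\<And>x. x \<in> carrier R \<Longrightarrow> \<xi> (f \<otimes> x) = \<psi> x \<oplus> f \<otimes> \<xi> x"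
        using dop_SucE[OF conjunct2[OF a] f] unfolding regular_module_simps by blast
      \<comment> \<open>The witness supplied by \<open>dop\<close> is arbitrary outside R, so it
        agrees with the commutator only pointwise on R, and the bound is carried over by
        \<open>dop_cong\<close>.\<close>
      have "\<psi> x = commutator E \<xi> (mult_op R f) x" if x: "x \<in> carrier R" for x
      proof -
        have "\<psi> x \<in> carrier R" "commutator E \<xi> (mult_op R f) x \<in> carrier R"
          using reg.dop_additive[OF \<psi>(1), THEN additive_map_closed] x
            End_ring_closed[OF commutator_closed[OF \<xi> f] x] by simp_all
        then show ?thesis
          using \<psi>(2)[OF x] commutator_apply[OF \<xi> f x] f x End_ring_closed[OF \<xi>] by simp
      qed
      then have "dop_R (Suc n) (commutator E \<xi> (mult_op R f))"
        using reg.dop_cong[OF \<psi>(1)] by simp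
      then show ?thesis using Suc.IH commutator_closed[OF \<xi> f] by blast
    qed
    then show "\<xi> \<in> diff_ops_order R K (Suc n)" using \<xi> by simp
  qed
qed

lemma diff_ops_carrier:
  "\<xi> \<in> carrier (diff_ops R K) \<longleftrightarrow>
     \<xi> \<in> carrier E \<and> (\<exists>n. dop_R n \<xi>)"
proof -
  have "\<xi> \<in> carrier (diff_ops R K) \<longleftrightarrow> (\<exists>n. \<xi> \<in> diff_ops_order R K n)"
    by (simp add: diff_ops_def)
  then show ?thesis unfolding diff_ops_order_iff using reg.dop_Suc by blast
qed

lemma diff_ops_simps:
  "\<xi> \<otimes>\<^bsub>diff_ops R K\<^esub> \<eta> = \<xi> \<otimes>\<^bsub>E\<^esub> \<eta>" "\<xi> \<oplus>\<^bsub>diff_ops R K\<^esub> \<eta> = \<xi> \<oplus>\<^bsub>E\<^esub> \<eta>"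
  "\<one>\<^bsub>diff_ops R K\<^esub> = mult_op R \<one>"
  by (simp_all add: diff_ops_def E_one)

lemma mult_op_diff_ops: "f \<in> carrier R \<Longrightarrow> mult_op R f \<in> carrier (diff_ops R K)"
  using mult_op_End mult_op_hom reg.mod_hom_dop by (auto simp: diff_ops_carrier)

lemma diff_ops_mult:
  assumes "\<xi> \<in> carrier (diff_ops R K)" "\<eta> \<in> carrier (diff_ops R K)"
  shows "\<xi> \<otimes>\<^bsub>E\<^esub> \<eta> \<in> carrier (diff_ops R K)"
proof -
  obtain m n where "dop_R m \<xi>"
    "dop_R n \<eta>"
    using assms by (auto simp: diff_ops_carrier)
  then have "dop_R (n + m) (\<lambda>x. \<xi> (\<eta> x))"
    using dop_comp regular_module by metis
  then have "dop_R (n + m) (\<xi> \<otimes>\<^bsub>E\<^esub> \<eta>)"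
    by (rule reg.dop_cong) (simp add: End_ring_simps compose_def)
  then show ?thesis using assms by (auto simp: diff_ops_carrier E_closed)
qed

lemma diff_ops_add:
  assumes "\<xi> \<in> carrier (diff_ops R K)" "\<eta> \<in> carrier (diff_ops R K)"
  shows "\<xi> \<oplus>\<^bsub>E\<^esub> \<eta> \<in> carrier (diff_ops R K)"
proof -
  obtain m n where "dop_R m \<xi>"
    "dop_R n \<eta>"
    using assms by (auto simp: diff_ops_carrier)
  then have "dop_R (max m n) (\<lambda>x. \<xi> x \<oplus>\<^bsub>regular_module R\<^esub> \<eta> x)"
    using reg.dop_add reg.dop_mono[OF max.cobounded1] reg.dop_mono[OF max.cobounded2] by blast
  then have "dop_R (max m n) (\<xi> \<oplus>\<^bsub>E\<^esub> \<eta>)"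
    by (rule reg.dop_cong) (simp add: End_ring_simps)
  then show ?thesis using assms by (auto simp: diff_ops_carrier E_closed)
qed

lemma diff_ops_ring: "ring (diff_ops R K)"
proof -
  interpret E: ring E by (rule E_ring)
  have "subring (carrier (diff_ops R K)) E"
  proof (rule E.subringI)
    fix \<xi> assume \<xi>: "\<xi> \<in> carrier (diff_ops R K)"
    then have "mult_op R (\<ominus> \<one>) \<otimes>\<^bsub>E\<^esub> \<xi> = \<ominus>\<^bsub>E\<^esub> \<xi>"
      using E_neg E_closed mult_op_End[of "\<ominus> \<one>"] by (metis E.minus_equality a_inv_closed diff_ops_carrier one_closed)
    then show "\<ominus>\<^bsub>E\<^esub> \<xi> \<in> carrier (diff_ops R K)"
      using diff_ops_mult[OF _ \<xi>] mult_op_diff_ops[of "\<ominus> \<one>"] by (metis a_inv_closed one_closed)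
  qed (auto simp: E_one mult_op_diff_ops diff_ops_mult diff_ops_add, simp add: diff_ops_carrier)
  then show ?thesis using E.subring_is_ring by (simp add: diff_ops_def)
qed

end


section \<open>Left actions of differential operators\<close>

text \<open>The unit law is the last clause for f = \<one>, since the identity operator is
  \<open>mult_op R \<one>\<close>. M is any record with the module operations: the action on Cech
  cohomology is an intermediate object, from which only the action transported to the module H is
  kept.\<close>

definition left_D_action ::
  "('a, 'r) ring_scheme \<Rightarrow> 'a set \<Rightarrow> ('a, 'b, 's) module_scheme \<Rightarrow> (('a \<Rightarrow> 'a) \<Rightarrow> 'b \<Rightarrow> 'b) \<Rightarrow> bool"
where
  "left_D_action R K M act \<longleftrightarrow>
     (\<forall>\<xi>\<in>carrier (diff_ops R K). additive_map M M (act \<xi>)) \<and>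
     (\<forall>\<xi>\<in>carrier (diff_ops R K). \<forall>\<eta>\<in>carrier (diff_ops R K). \<forall>x\<in>carrier M.
        act (\<xi> \<otimes>\<^bsub>diff_ops R K\<^esub> \<eta>) x = act \<xi> (act \<eta> x) \<and>
        act (\<xi> \<oplus>\<^bsub>diff_ops R K\<^esub> \<eta>) x = act \<xi> x \<oplus>\<^bsub>M\<^esub> act \<eta> x) \<and>
     (\<forall>f\<in>carrier R. \<forall>x\<in>carrier M. act (mult_op R f) x = f \<odot>\<^bsub>M\<^esub> x)"

lemma left_D_actionD:
  assumes "left_D_action R K M act"
  shows left_D_action_additive: "\<xi> \<in> carrier (diff_ops R K) \<Longrightarrow> additive_map M M (act \<xi>)"
    and left_D_action_closed: "\<lbrakk>\<xi> \<in> carrier (diff_ops R K); x \<in> carrier M\<rbrakk> \<Longrightarrow> act \<xi> x \<in> carrier M"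
    and left_D_action_mult: "\<lbrakk>\<xi> \<in> carrier (diff_ops R K); \<eta> \<in> carrier (diff_ops R K); x \<in> carrier M\<rbrakk>
      \<Longrightarrow> act (\<xi> \<otimes>\<^bsub>diff_ops R K\<^esub> \<eta>) x = act \<xi> (act \<eta> x)"
    and left_D_action_plus: "\<lbrakk>\<xi> \<in> carrier (diff_ops R K); \<eta> \<in> carrier (diff_ops R K); x \<in> carrier M\<rbrakk>
      \<Longrightarrow> act (\<xi> \<oplus>\<^bsub>diff_ops R K\<^esub> \<eta>) x = act \<xi> x \<oplus>\<^bsub>M\<^esub> act \<eta> x"
    and left_D_action_mult_op: "\<lbrakk>f \<in> carrier R; x \<in> carrier M\<rbrakk> \<Longrightarrow> act (mult_op R f) x = f \<odot>\<^bsub>M\<^esub> x"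
  using assms by (auto simp: left_D_action_def additive_map_def)

lemma left_D_actionI:
  assumes "\<And>\<xi>. \<xi> \<in> carrier (diff_ops R K) \<Longrightarrow> additive_map M M (act \<xi>)"
    and "\<And>\<xi> \<eta> x. \<lbrakk>\<xi> \<in> carrier (diff_ops R K); \<eta> \<in> carrier (diff_ops R K); x \<in> carrier M\<rbrakk>
      \<Longrightarrow> act (\<xi> \<otimes>\<^bsub>diff_ops R K\<^esub> \<eta>) x = act \<xi> (act \<eta> x)"
    and "\<And>\<xi> \<eta> x. \<lbrakk>\<xi> \<in> carrier (diff_ops R K); \<eta> \<in> carrier (diff_ops R K); x \<in> carrier M\<rbrakk>
      \<Longrightarrow> act (\<xi> \<oplus>\<^bsub>diff_ops R K\<^esub> \<eta>) x = act \<xi> x \<oplus>\<^bsub>M\<^esub> act \<eta> x"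
    and "\<And>f x. \<lbrakk>f \<in> carrier R; x \<in> carrier M\<rbrakk> \<Longrightarrow> act (mult_op R f) x = f \<odot>\<^bsub>M\<^esub> x"
  shows "left_D_action R K M act"
  using assms by (simp add: left_D_action_def)

text \<open>Existence is \<open>dop_extend\<close>. Finite order belongs to the specification
  because it makes the choice unique on the carrier; a merely additive extension need not be
  determined by its values on R.\<close>

definition loc_act :: "('a, 'r) ring_scheme \<Rightarrow> 'a set \<Rightarrow> ('a \<Rightarrow> 'a) \<Rightarrow> ('a \<times> 'a) set \<Rightarrow> ('a \<times> 'a) set" where
  "loc_act R S \<xi> = (SOME P. (\<exists>n. dop R (localization R S) (localization R S) n P) \<and>
     (\<forall>r\<in>carrier R. P (loc_frac R S r \<one>\<^bsub>R\<^esub>) = loc_frac R S (\<xi> r) \<one>\<^bsub>R\<^esub>))"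

context operator_ring
begin

abbreviation loc where "loc \<equiv> localization R"

text \<open>Every identity about \<open>loc_act\<close> is reduced by this to fractions r/1. The two
  bounds may differ, because sums and composites arrive with bounds of their own; both are raised to
  the maximum.\<close>

lemma dop_localization_eqI:
  assumes S: "multiplicative_subset R S" and T: "multiplicative_subset R T" and ST: "S \<subseteq> T"
    and P: "dop R (loc S) (loc T) m P"
    and P': "dop R (loc S) (loc T) n P'"
    and eq: "\<And>r. r \<in> carrier R \<Longrightarrow> P (loc_frac R S r \<one>) = P' (loc_frac R S r \<one>)"
    and y: "y \<in> carrier (loc S)"
  shows "P y = P' y"
proof -
  interpret fraction_extension R S "loc S" "\<lambda>r. loc_frac R S r \<one>" "loc T"
    by (intro fraction_extension.intro fraction_extension_axioms.intro
      multiplicative_subset.localization_fraction_module[OF S]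
      multiplicative_subset.localization_module[OF T]
      multiplicative_subset.invertible_on_localization[OF T ST])
  show ?thesis
    using dop_eqI[OF LN.dop_mono[OF max.cobounded1 P] LN.dop_mono[OF max.cobounded2 P']] eq y by blast
qed

lemma loc_act:
  assumes S: "multiplicative_subset R S" and \<xi>: "\<xi> \<in> carrier (diff_ops R K)"
  shows loc_act_dop: "\<exists>n. dop R (loc S) (loc S) n (loc_act R S \<xi>)"
    and loc_act_frac: "r \<in> carrier R \<Longrightarrow> loc_act R S \<xi> (loc_frac R S r \<one>) = loc_frac R S (\<xi> r) \<one>"
proof -
  interpret S: multiplicative_subset R S by fact
  interpret fraction_extension R S "loc S" "\<lambda>r. loc_frac R S r \<one>" "loc S"
    by (intro fraction_extension.intro fraction_extension_axioms.intro
      S.localization_fraction_module S.localization_module S.invertible_on_localization order_refl)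
  obtain n where "dop R (regular_module R) (regular_module R) n \<xi>"
    using \<xi> by (auto simp: diff_ops_carrier)
  \<comment> \<open>The map to be extended is \<xi> followed by the R-linear map r \<mapsto> r/1,
    which contributes the strict bound \<open>Suc 0\<close>.\<close>
  then have "dop R (regular_module R) (loc S) (n + Suc 0) (\<lambda>r. loc_frac R S (\<xi> r) \<one>)"
    using dop_comp[OF regular_module regular_module S.localization_module _ RN.mod_hom_dop[OF S.frac_one_hom]]
    by blast
  from dop_extend[OF this]
  have "\<exists>P. (\<exists>n. dop R (loc S) (loc S) n P) \<and>
     (\<forall>r\<in>carrier R. P (loc_frac R S r \<one>) = loc_frac R S (\<xi> r) \<one>)" by blast
  from someI_ex[OF this]
  show "\<exists>n. dop R (loc S) (loc S) n (loc_act R S \<xi>)"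
    and "r \<in> carrier R \<Longrightarrow> loc_act R S \<xi> (loc_frac R S r \<one>) = loc_frac R S (\<xi> r) \<one>"
    unfolding loc_act_def by blast+
qed

lemma diff_ops_End: "\<xi> \<in> carrier (diff_ops R K) \<Longrightarrow> \<xi> \<in> carrier E"
  by (simp add: diff_ops_carrier)

lemma left_D_action_localization:
  assumes S: "multiplicative_subset R S"
  shows "left_D_action R K (loc S) (loc_act R S)"
proof -
  interpret S: multiplicative_subset R S by fact
  interpret LL: module_pair R "loc S" "loc S"
    by (intro module_pair.intro S.localization_module)
  note eqI = dop_localization_eqI[OF S S order_refl]
  show ?thesis
  proof (rule left_D_actionI)
    fix \<xi> assume "\<xi> \<in> carrier (diff_ops R K)"
    then show "additive_map (loc S) (loc S) (loc_act R S \<xi>)"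
      using loc_act_dop[OF S] LL.dop_additive by blast
  next
    fix \<xi> \<eta> y assume \<xi>: "\<xi> \<in> carrier (diff_ops R K)" and \<eta>: "\<eta> \<in> carrier (diff_ops R K)"
      and y: "y \<in> carrier (loc S)"
    obtain m n where mn: "dop R (loc S) (loc S) m (loc_act R S \<xi>)"
        "dop R (loc S) (loc S) n (loc_act R S \<eta>)"
      using loc_act_dop[OF S] \<xi> \<eta> by blast
    obtain k where k: "dop R (loc S) (loc S) k (loc_act R S (\<xi> \<otimes>\<^bsub>E\<^esub> \<eta>))"
      using loc_act_dop[OF S diff_ops_mult[OF \<xi> \<eta>]] by blast
    obtain k' where k': "dop R (loc S) (loc S) k' (loc_act R S (\<xi> \<oplus>\<^bsub>E\<^esub> \<eta>))"
      using loc_act_dop[OF S diff_ops_add[OF \<xi> \<eta>]] by blast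
    note cl = End_ring_closed[OF diff_ops_End[OF \<xi>]] End_ring_closed[OF diff_ops_End[OF \<eta>]]
    show "loc_act R S (\<xi> \<otimes>\<^bsub>diff_ops R K\<^esub> \<eta>) y = loc_act R S \<xi> (loc_act R S \<eta> y)"
      unfolding diff_ops_simps
    proof (rule eqI[OF k dop_comp[OF _ _ _ mn(2,1)] _ y])
      fix r assume "r \<in> carrier R"
      then show "loc_act R S (\<xi> \<otimes>\<^bsub>E\<^esub> \<eta>) (loc_frac R S r \<one>) = loc_act R S \<xi> (loc_act R S \<eta> (loc_frac R S r \<one>))"
        using \<xi> \<eta> cl by (simp add: loc_act_frac[OF S] diff_ops_mult) (simp add: End_ring_simps compose_def)
    qed (rule S.localization_module)+
    show "loc_act R S (\<xi> \<oplus>\<^bsub>diff_ops R K\<^esub> \<eta>) y = loc_act R S \<xi> y \<oplus>\<^bsub>loc S\<^esub> loc_act R S \<eta> y"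
      unfolding diff_ops_simps
    proof (rule eqI[OF k' _ _ y])
      show "dop R (loc S) (loc S) (max m n)
          (\<lambda>y. loc_act R S \<xi> y \<oplus>\<^bsub>loc S\<^esub> loc_act R S \<eta> y)"
        using LL.dop_add LL.dop_mono[OF max.cobounded1 mn(1)] LL.dop_mono[OF max.cobounded2 mn(2)] by blast
      fix r assume "r \<in> carrier R"
      then show "loc_act R S (\<xi> \<oplus>\<^bsub>E\<^esub> \<eta>) (loc_frac R S r \<one>)
          = loc_act R S \<xi> (loc_frac R S r \<one>) \<oplus>\<^bsub>loc S\<^esub> loc_act R S \<eta> (loc_frac R S r \<one>)"
        using \<xi> \<eta> cl by (simp add: loc_act_frac[OF S] diff_ops_add)
          (simp add: End_ring_simps S.add_frac S.S_one)
    qed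
  next
    fix f y assume f: "f \<in> carrier R" and y: "y \<in> carrier (loc S)"
    obtain m where m: "dop R (loc S) (loc S) m (loc_act R S (mult_op R f))"
      using loc_act_dop[OF S mult_op_diff_ops[OF f]] by blast
    show "loc_act R S (mult_op R f) y = f \<odot>\<^bsub>loc S\<^esub> y"
    proof (rule eqI[OF m LL.mod_hom_dop _ y])
      show "(\<odot>\<^bsub>loc S\<^esub>) f \<in> mod_hom R (loc S) (loc S)"
        using f by (intro mod_homI) (simp_all add: module.smult_closed[OF S.localization_module]
            module.smult_r_distr[OF S.localization_module] m_comm
            flip: module.smult_assoc1[OF S.localization_module])
      fix r assume "r \<in> carrier R"
      then show "loc_act R S (mult_op R f) (loc_frac R S r \<one>) = f \<odot>\<^bsub>loc S\<^esub> loc_frac R S r \<one>"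
        using f by (simp add: loc_act_frac[OF S] mult_op_diff_ops S.smult_frac S.S_one) (simp add: mult_op_def)
    qed
  qed
qed

text \<open>Both sides are maps of finite order from the localization at S to the one at T, and both
  send r/1 to (\<xi> r)/1. They coincide by rigidity, because S acts invertibly on the localization
  at T.\<close>

lemma loc_act_loc_map:
  assumes S: "multiplicative_subset R S" and T: "multiplicative_subset R T" and ST: "S \<subseteq> T"
    and \<xi>: "\<xi> \<in> carrier (diff_ops R K)" and y: "y \<in> carrier (loc S)"
  shows "loc_map R T (loc_act R S \<xi> y) = loc_act R T \<xi> (loc_map R T y)"
proof -
  interpret S: multiplicative_subset R S by fact
  interpret T: multiplicative_subset R T by fact
  interpret ST: module_pair R "loc S" "loc T"
    by (intro module_pair.intro S.localization_module T.localization_module)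
  obtain m where m: "dop R (loc S) (loc S) m (loc_act R S \<xi>)"
    using loc_act_dop[OF S \<xi>] by blast
  obtain n where n: "dop R (loc T) (loc T) n (loc_act R T \<xi>)"
    using loc_act_dop[OF T \<xi>] by blast
  have l: "dop R (loc S) (loc T) (Suc 0) (loc_map R T)"
    by (rule ST.mod_hom_dop[OF loc_map_hom[OF S T ST]])
  show ?thesis
  proof (rule dop_localization_eqI[OF S T ST dop_comp[OF _ _ _ m l] dop_comp[OF _ _ _ l n] _ y])
    fix r assume "r \<in> carrier R"
    then show "loc_map R T (loc_act R S \<xi> (loc_frac R S r \<one>)) = loc_act R T \<xi> (loc_map R T (loc_frac R S r \<one>))"
      using \<xi> End_ring_closed[OF diff_ops_End[OF \<xi>]]
      by (simp add: loc_act_frac[OF S] loc_act_frac[OF T] loc_map_frac[OF S T ST] S.S_one)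
  qed (rule S.localization_module T.localization_module)+
qed

end

section \<open>Actions on products and on subquotients\<close>

lemma product_module_simps:
  "carrier (product_module A M) = (\<Pi>\<^sub>E i\<in>A. carrier (M i))"
  "\<zero>\<^bsub>product_module A M\<^esub> = (\<lambda>i\<in>A. \<zero>\<^bsub>M i\<^esub>)"
  "f \<oplus>\<^bsub>product_module A M\<^esub> g = (\<lambda>i\<in>A. f i \<oplus>\<^bsub>M i\<^esub> g i)"
  "a \<odot>\<^bsub>product_module A M\<^esub> f = (\<lambda>i\<in>A. a \<odot>\<^bsub>M i\<^esub> f i)"
  by (simp_all add: product_module_def)

lemma product_module_abelian_group:
  assumes "\<And>i. i \<in> A \<Longrightarrow> abelian_group (M i)"
  shows "abelian_group (product_module A M)"
proof (rule abelian_groupI)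
  let ?P = "product_module A M"
  note r = assms[THEN abelian_group.axioms(1)]
  fix x assume x: "x \<in> carrier ?P"
  then have xi: "x i \<in> carrier (M i)" if "i \<in> A" for i
    using that by (auto simp: product_module_simps)
  show "\<zero>\<^bsub>?P\<^esub> \<oplus>\<^bsub>?P\<^esub> x = x"
    using x by (intro extensionalityI[of _ A])
      (auto simp: product_module_simps PiE_def xi abelian_monoid.l_zero[OF r])
  show "\<exists>y\<in>carrier ?P. y \<oplus>\<^bsub>?P\<^esub> x = \<zero>\<^bsub>?P\<^esub>"
    using xi by (intro bexI[of _ "\<lambda>i\<in>A. \<ominus>\<^bsub>M i\<^esub> x i"])
      (auto simp: product_module_simps abelian_group.l_neg assms abelian_group.a_inv_closed intro!: restrict_ext)
  fix y assume y: "y \<in> carrier ?P"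
  then have yi: "y i \<in> carrier (M i)" if "i \<in> A" for i
    using that by (auto simp: product_module_simps)
  show "x \<oplus>\<^bsub>?P\<^esub> y \<in> carrier ?P"
    by (auto simp: product_module_simps xi yi abelian_monoid.a_closed[OF r])
  show "x \<oplus>\<^bsub>?P\<^esub> y = y \<oplus>\<^bsub>?P\<^esub> x"
    by (auto simp: product_module_simps xi yi abelian_monoid.a_comm[OF r] intro!: restrict_ext)
  fix z assume z: "z \<in> carrier ?P"
  then have zi: "z i \<in> carrier (M i)" if "i \<in> A" for i
    using that by (auto simp: product_module_simps)
  show "x \<oplus>\<^bsub>?P\<^esub> y \<oplus>\<^bsub>?P\<^esub> z = x \<oplus>\<^bsub>?P\<^esub> (y \<oplus>\<^bsub>?P\<^esub> z)"
    by (auto simp: product_module_simps xi yi zi abelian_monoid.a_assoc[OF r] intro!: restrict_ext)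
next
  show "\<zero>\<^bsub>product_module A M\<^esub> \<in> carrier (product_module A M)"
    using assms[THEN abelian_group.axioms(1), THEN abelian_monoid.zero_closed]
    by (auto simp: product_module_simps)
qed

lemma left_D_action_product:
  assumes "\<And>i. i \<in> A \<Longrightarrow> left_D_action R K (M i) (act i)"
  shows "left_D_action R K (product_module A M) (\<lambda>\<xi> c. \<lambda>i\<in>A. act i \<xi> (c i))"
proof (rule left_D_actionI)
  let ?P = "product_module A M"
  fix \<xi> assume \<xi>: "\<xi> \<in> carrier (diff_ops R K)"
  show "additive_map ?P ?P (\<lambda>c. \<lambda>i\<in>A. act i \<xi> (c i))"
  proof (rule additive_mapI)
    fix x assume x: "x \<in> carrier ?P"
    then have xi: "x i \<in> carrier (M i)" if "i \<in> A" for i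
      using that by (auto simp: product_module_simps)
    then show "(\<lambda>i\<in>A. act i \<xi> (x i)) \<in> carrier ?P"
      by (simp add: product_module_simps left_D_action_closed[OF assms \<xi>])
    fix y assume y: "y \<in> carrier ?P"
    then have yi: "y i \<in> carrier (M i)" if "i \<in> A" for i
      using that by (auto simp: product_module_simps)
    show "(\<lambda>i\<in>A. act i \<xi> ((x \<oplus>\<^bsub>?P\<^esub> y) i)) = (\<lambda>i\<in>A. act i \<xi> (x i)) \<oplus>\<^bsub>?P\<^esub> (\<lambda>i\<in>A. act i \<xi> (y i))"
      using xi yi by (auto simp: product_module_simps
        additive_map_add[OF left_D_action_additive[OF assms \<xi>]] intro!: restrict_ext)
  qed
  fix \<eta> x assume \<eta>: "\<eta> \<in> carrier (diff_ops R K)" and x: "x \<in> carrier ?P"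
  have xi: "x i \<in> carrier (M i)" if "i \<in> A" for i
    using that x by (auto simp: product_module_simps)
  show "(\<lambda>i\<in>A. act i (\<xi> \<otimes>\<^bsub>diff_ops R K\<^esub> \<eta>) (x i)) = (\<lambda>i\<in>A. act i \<xi> ((\<lambda>i\<in>A. act i \<eta> (x i)) i))"
    using \<xi> \<eta> xi by (auto simp: left_D_action_mult[OF assms] intro!: restrict_ext)
  show "(\<lambda>i\<in>A. act i (\<xi> \<oplus>\<^bsub>diff_ops R K\<^esub> \<eta>) (x i))
      = (\<lambda>i\<in>A. act i \<xi> (x i)) \<oplus>\<^bsub>?P\<^esub> (\<lambda>i\<in>A. act i \<eta> (x i))"
    using \<xi> \<eta> xi by (auto simp: product_module_simps left_D_action_plus[OF assms] intro!: restrict_ext)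
next
  fix f x assume f: "f \<in> carrier R" and x: "x \<in> carrier (product_module A M)"
  have "x i \<in> carrier (M i)" if "i \<in> A" for i
    using that x by (auto simp: product_module_simps)
  with f show "(\<lambda>i\<in>A. act i (mult_op R f) (x i)) = f \<odot>\<^bsub>product_module A M\<^esub> x"
    by (auto simp: product_module_simps left_D_action_mult_op[OF assms] intro!: restrict_ext)
qed

text \<open>\<open>B\<close> need not lie in \<open>Z\<close>: the quotient is the image of \<open>Z\<close> in \<open>M/B\<close>. For the Cech complex this
  makes it unnecessary to know that the differential squares to zero.\<close>

lemma left_D_action_subquotient:
  assumes M: "abelian_group M" and act: "left_D_action R K M act"
    and cring: "cring R" and KR: "K \<subseteq> carrier R"
    and B: "subgroup B (add_monoid M)" and Z: "Z \<subseteq> carrier M"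
    and B_stable: "\<And>\<xi> b. \<lbrakk>\<xi> \<in> carrier (diff_ops R K); b \<in> B\<rbrakk> \<Longrightarrow> act \<xi> b \<in> B"
    and Z_stable: "\<And>\<xi> z. \<lbrakk>\<xi> \<in> carrier (diff_ops R K); z \<in> Z\<rbrakk> \<Longrightarrow> act \<xi> z \<in> Z"
  shows "left_D_action R K (quotient_module (M\<lparr>carrier := Z\<rparr>) B) (\<lambda>\<xi> X. \<Union>x\<in>X. B +>\<^bsub>M\<^esub> act \<xi> x)"
proof -
  let ?Q = "quotient_module (M\<lparr>carrier := Z\<rparr>) B"
  let ?D = "diff_ops R K"
  interpret operator_ring R K by (intro operator_ring.intro operator_ring_axioms.intro cring KR)
  interpret M: abelian_group M by fact
  interpret B: abelian_subgroup B M
    by (intro abelian_subgroupI3 additive_subgroup.intro B M)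
  have coset [simp]: "B +>\<^bsub>M\<lparr>carrier := Z\<rparr>\<^esub> x = B +>\<^bsub>M\<^esub> x" for x
    by (simp add: a_r_coset_def')
  have Q_carrier: "X \<in> carrier ?Q \<longleftrightarrow> (\<exists>z\<in>Z. X = B +>\<^bsub>M\<^esub> z)" for X
    by (auto simp: quotient_module_def A_RCOSETS_def')
  have Q_add: "(B +>\<^bsub>M\<^esub> x) \<oplus>\<^bsub>?Q\<^esub> (B +>\<^bsub>M\<^esub> y) = B +>\<^bsub>M\<^esub> (x \<oplus>\<^bsub>M\<^esub> y)"
    if "x \<in> carrier M" "y \<in> carrier M" for x y
    using B.a_rcos_sum[OF that] by (simp add: quotient_module_def set_add_def')
  have act_coset: "(\<Union>x\<in>B +>\<^bsub>M\<^esub> z. B +>\<^bsub>M\<^esub> act \<xi> x) = B +>\<^bsub>M\<^esub> act \<xi> z"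
    if \<xi>: "\<xi> \<in> carrier ?D" and z: "z \<in> carrier M" for \<xi> z
  proof (rule UN_constant_eq)
    show "z \<in> B +>\<^bsub>M\<^esub> z" using z B.a_rcos_self by blast
    show "\<forall>x\<in>B +>\<^bsub>M\<^esub> z. B +>\<^bsub>M\<^esub> act \<xi> x = B +>\<^bsub>M\<^esub> act \<xi> z"
    proof
      fix x assume "x \<in> B +>\<^bsub>M\<^esub> z"
      then obtain b where b: "b \<in> B" "x = b \<oplus>\<^bsub>M\<^esub> z" by (auto simp: a_r_coset_def')
      have bM: "b \<in> carrier M" using b B.a_subset by blast
      have "act \<xi> x = act \<xi> b \<oplus>\<^bsub>M\<^esub> act \<xi> z"
        using b bM z additive_map_add[OF left_D_action_additive[OF act \<xi>]] by simp
      then have "act \<xi> x \<in> B +>\<^bsub>M\<^esub> act \<xi> z"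
        using B_stable[OF \<xi> b(1)] by (auto simp: a_r_coset_def')
      then show "B +>\<^bsub>M\<^esub> act \<xi> x = B +>\<^bsub>M\<^esub> act \<xi> z"
        using M.a_repr_independence[OF _ _ B] left_D_action_closed[OF act \<xi> z] by simp
    qed
  qed
  have Z': "z \<in> carrier M" if "z \<in> Z" for z using that Z by blast
  show ?thesis
  proof (rule left_D_actionI)
    fix \<xi> assume \<xi>: "\<xi> \<in> carrier ?D"
    note add = additive_map_add[OF left_D_action_additive[OF act \<xi>]]
    show "additive_map ?Q ?Q (\<lambda>X. \<Union>x\<in>X. B +>\<^bsub>M\<^esub> act \<xi> x)"
    proof (rule additive_mapI)
      fix X assume "X \<in> carrier ?Q"
      then obtain x where x: "x \<in> Z" "X = B +>\<^bsub>M\<^esub> x" by (auto simp: Q_carrier)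
      show "(\<Union>x\<in>X. B +>\<^bsub>M\<^esub> act \<xi> x) \<in> carrier ?Q"
        using Z_stable[OF \<xi> x(1)] unfolding x(2) act_coset[OF \<xi> Z'[OF x(1)]] Q_carrier by blast
    next
      fix X Y assume "X \<in> carrier ?Q" "Y \<in> carrier ?Q"
      then obtain x y where xy: "x \<in> Z" "X = B +>\<^bsub>M\<^esub> x" "y \<in> Z" "Y = B +>\<^bsub>M\<^esub> y"
        by (auto simp: Q_carrier)
      then show "(\<Union>x\<in>X \<oplus>\<^bsub>?Q\<^esub> Y. B +>\<^bsub>M\<^esub> act \<xi> x)
          = (\<Union>x\<in>X. B +>\<^bsub>M\<^esub> act \<xi> x) \<oplus>\<^bsub>?Q\<^esub> (\<Union>x\<in>Y. B +>\<^bsub>M\<^esub> act \<xi> x)"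
        using \<xi> Z' left_D_action_closed[OF act \<xi>] by (simp only: Q_add act_coset add M.a_closed)
    qed
  next
    fix \<xi> \<eta> X assume \<xi>: "\<xi> \<in> carrier ?D" and \<eta>: "\<eta> \<in> carrier ?D" and "X \<in> carrier ?Q"
    then obtain x where x: "x \<in> Z" "X = B +>\<^bsub>M\<^esub> x"
      by (auto simp: Q_carrier)
    have c: "x \<in> carrier M" "act \<xi> x \<in> carrier M" "act \<eta> x \<in> carrier M"
      using x Z' left_D_action_closed[OF act] \<xi> \<eta> by auto
    have D: "\<xi> \<otimes>\<^bsub>?D\<^esub> \<eta> \<in> carrier ?D" "\<xi> \<oplus>\<^bsub>?D\<^esub> \<eta> \<in> carrier ?D"
      using diff_ops_mult[OF \<xi> \<eta>] diff_ops_add[OF \<xi> \<eta>] by (simp_all add: diff_ops_simps)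
    show "(\<Union>x\<in>X. B +>\<^bsub>M\<^esub> act (\<xi> \<otimes>\<^bsub>?D\<^esub> \<eta>) x) = (\<Union>x\<in>\<Union>x\<in>X. B +>\<^bsub>M\<^esub> act \<eta> x. B +>\<^bsub>M\<^esub> act \<xi> x)"
      using x(2) c D \<xi> \<eta> by (simp only: act_coset left_D_action_mult[OF act])
    show "(\<Union>x\<in>X. B +>\<^bsub>M\<^esub> act (\<xi> \<oplus>\<^bsub>?D\<^esub> \<eta>) x)
        = (\<Union>x\<in>X. B +>\<^bsub>M\<^esub> act \<xi> x) \<oplus>\<^bsub>?Q\<^esub> (\<Union>x\<in>X. B +>\<^bsub>M\<^esub> act \<eta> x)"
      using x(2) c D \<xi> \<eta> by (simp only: act_coset Q_add left_D_action_plus[OF act])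
  next
    fix f X assume f: "f \<in> carrier R" and "X \<in> carrier ?Q"
    then obtain x where x: "x \<in> Z" "X = B +>\<^bsub>M\<^esub> x"
      by (auto simp: Q_carrier)
    \<comment> \<open>Scalar multiplication on the quotient is itself a union over the coset, so
      once the coset is known to lie in M the two unions agree term by term.\<close>
    have "y \<in> carrier M" if "y \<in> X" for y
      using that x Z' B.a_subset by (auto simp: a_r_coset_def')
    then show "(\<Union>x\<in>X. B +>\<^bsub>M\<^esub> act (mult_op R f) x) = f \<odot>\<^bsub>?Q\<^esub> X"
      using f by (simp add: quotient_module_def left_D_action_mult_op[OF act])
  qed
qed


section \<open>Local cohomology\<close>

lemma (in cring) monomials_multiplicative:
  assumes xs: "set xs \<subseteq> carrier R" and I: "I \<subseteq> {..<length xs}"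
  shows "multiplicative_subset R (monomials R xs I)"
proof
  have xi: "xs ! i \<in> carrier R" if "i \<in> I" for i
    using that xs I nth_mem by (metis lessThan_iff subsetD)
  show "monomials R xs I \<subseteq> carrier R"
    using xi by (auto simp: monomials_def)
  have "\<one> = (\<Otimes>i\<in>I. (xs ! i) [^] (0::nat))" by simp
  then show "\<one> \<in> monomials R xs I" unfolding monomials_def
    by (intro CollectI exI[of _ "\<lambda>_. 0"]) simp
  fix s t assume "s \<in> monomials R xs I" "t \<in> monomials R xs I"
  then obtain d e :: "nat \<Rightarrow> nat" where "s = (\<Otimes>i\<in>I. (xs ! i) [^] d i)" "t = (\<Otimes>i\<in>I. (xs ! i) [^] e i)"
    by (auto simp: monomials_def)
  then have "s \<otimes> t = (\<Otimes>i\<in>I. (xs ! i) [^] d i \<otimes> (xs ! i) [^] e i)"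
    using xi by (simp add: finprod_multf)
  also have "\<dots> = (\<Otimes>i\<in>I. (xs ! i) [^] (d i + e i))"
    using xi by (intro finprod_cong') (auto simp: nat_pow_mult)
  finally show "s \<otimes> t \<in> monomials R xs I" by (auto simp: monomials_def)
qed

lemma (in cring) monomials_mono:
  assumes xs: "set xs \<subseteq> carrier R" and J: "J \<subseteq> {..<length xs}" and IJ: "I \<subseteq> J"
  shows "monomials R xs I \<subseteq> monomials R xs J"
proof
  have xi: "xs ! i \<in> carrier R" if "i \<in> J" for i
    using that xs J nth_mem by (metis lessThan_iff subsetD)
  fix s assume "s \<in> monomials R xs I"
  then obtain e :: "nat \<Rightarrow> nat" where s: "s = (\<Otimes>i\<in>I. (xs ! i) [^] e i)"
    by (auto simp: monomials_def)
  have "s = (\<Otimes>i\<in>J. (xs ! i) [^] (if i \<in> I then e i else 0))"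
    unfolding s using xi IJ finite_subset[OF J finite_lessThan]
    by (intro finprod_mono_neutral_cong_left) auto
  then show "s \<in> monomials R xs J" by (auto simp: monomials_def)
qed

section \<open>The action on the Cech complex and its cohomology\<close>

context operator_ring
begin

context
  fixes xs assumes xs: "set xs \<subseteq> carrier R"
begin

abbreviation mon where "mon \<equiv> monomials R xs"

abbreviation C where "C \<equiv> cech_module R xs"

lemma cech_multiplicative: "I \<in> cech_indices xs p \<Longrightarrow> multiplicative_subset R (mon I)"
  using monomials_multiplicative[OF xs] by (simp add: cech_indices_def)

lemma cech_module_abelian_group: "abelian_group (C p)"
  unfolding cech_module_def
  by (intro product_module_abelian_group module.axioms(2)[where R = R]
    multiplicative_subset.localization_module cech_multiplicative)

definition cech_act where
  "cech_act p \<xi> c = (\<lambda>I\<in>cech_indices xs p. loc_act R (mon I) \<xi> (c I))"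

lemma cech_action: "left_D_action R K (C p) (cech_act p)"
  unfolding cech_module_def cech_act_def
  by (intro left_D_action_product left_D_action_localization cech_multiplicative)

definition cech_term where
  "cech_term J c j = (let y = loc_map R (mon J) (c (J - {j}))
     in if even (card {i \<in> J. i < j}) then y else \<ominus>\<^bsub>loc (mon J)\<^esub> y)"

lemma cech_diff_eq:
  "cech_diff R xs p c = (\<lambda>J\<in>cech_indices xs (Suc p).
     finsum (loc (mon J)) (cech_term J c) J)"
  by (simp add: cech_diff_def cech_term_def[abs_def])

lemma cech_face:
  assumes "J \<in> cech_indices xs (Suc p)" "j \<in> J"
  shows "J - {j} \<in> cech_indices xs p" "mon (J - {j}) \<subseteq> mon J"
  using assms monomials_mono[OF xs, of J "J - {j}"] finite_subset[OF _ finite_lessThan, of J "length xs"]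
  by (auto simp: cech_indices_def)

text \<open>A summand of the Cech differential is a localization map with a sign. The action
  commutes with the map by \<open>loc_act_loc_map\<close> and with the sign by additivity.\<close>

lemma cech_term:
  assumes J: "J \<in> cech_indices xs (Suc p)" and j: "j \<in> J"
    and c: "c \<in> carrier (C p)"
  shows cech_term_closed: "cech_term J c j \<in> carrier (loc (mon J))"
    and cech_term_add: "c' \<in> carrier (C p) \<Longrightarrow>
      cech_term J (c \<oplus>\<^bsub>C p\<^esub> c') j
        = cech_term J c j \<oplus>\<^bsub>loc (mon J)\<^esub> cech_term J c' j"
    and cech_term_act: "\<xi> \<in> carrier (diff_ops R K) \<Longrightarrow>
      cech_term J (cech_act p \<xi> c) j = loc_act R (mon J) \<xi> (cech_term J c j)"
proof -
  let ?S = "mon (J - {j})" and ?T = "mon J"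
  note S = cech_multiplicative[OF cech_face(1)[OF J j]] and T = cech_multiplicative[OF J]
    and ST = cech_face(2)[OF J j] and I = cech_face(1)[OF J j]
  interpret L: module R "localization R ?T" by (rule multiplicative_subset.localization_module[OF T])
  note hom = loc_map_hom[OF S T ST]
  have cI: "d (J - {j}) \<in> carrier (localization R ?S)" if "d \<in> carrier (C p)" for d
    using that I by (auto simp: cech_module_def product_module_simps)
  note mc = mod_hom_closed[OF hom cI]
  show "cech_term J c j \<in> carrier (localization R ?T)"
    using mc[OF c] by (simp add: cech_term_def Let_def)
  { assume c': "c' \<in> carrier (C p)"
    have "(c \<oplus>\<^bsub>C p\<^esub> c') (J - {j}) = c (J - {j}) \<oplus>\<^bsub>localization R ?S\<^esub> c' (J - {j})"
      using I by (simp add: cech_module_def product_module_simps)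
    then show "cech_term J (c \<oplus>\<^bsub>C p\<^esub> c') j
        = cech_term J c j \<oplus>\<^bsub>localization R ?T\<^esub> cech_term J c' j"
      using mc[OF c] mc[OF c'] mod_hom_add[OF hom cI[OF c] cI[OF c']]
      by (simp add: cech_term_def Let_def L.M.minus_add) }
  { assume \<xi>: "\<xi> \<in> carrier (diff_ops R K)"
    have "loc_map R ?T (cech_act p \<xi> c (J - {j})) = loc_act R ?T \<xi> (loc_map R ?T (c (J - {j})))"
      using I loc_act_loc_map[OF S T ST \<xi> cI[OF c]] by (simp add: cech_act_def)
    then show "cech_term J (cech_act p \<xi> c) j = loc_act R ?T \<xi> (cech_term J c j)"
      using mc[OF c] additive_map_minus[OF L.abelian_group_axioms L.abelian_group_axioms
          left_D_action_additive[OF left_D_action_localization[OF T] \<xi>]]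
      by (simp add: cech_term_def Let_def) }
qed

lemma cech_diff_additive: "additive_map (C p) (C (Suc p)) (cech_diff R xs p)"
proof (rule additive_mapI)
  fix c assume c: "c \<in> carrier (C p)"
  have L: "abelian_group (loc (mon J))" if "J \<in> cech_indices xs (Suc p)" for J
    using multiplicative_subset.localization_module[OF cech_multiplicative[OF that]] module.axioms(2) by blast
  note L' = L[THEN abelian_group.axioms(1)]
  have t: "cech_term J d \<in> J \<rightarrow> carrier (loc (mon J))"
    if "J \<in> cech_indices xs (Suc p)" "d \<in> carrier (C p)" for J d
    using cech_term_closed that by blast
  show "cech_diff R xs p c \<in> carrier (C (Suc p))"
    using abelian_monoid.finsum_closed[OF L' t[OF _ c]]
    by (auto simp: cech_diff_eq cech_module_def product_module_simps)
  fix c' assume c': "c' \<in> carrier (C p)"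
  have "finsum (loc (mon J)) (cech_term J (c \<oplus>\<^bsub>C p\<^esub> c')) J
      = finsum (loc (mon J)) (cech_term J c) J
          \<oplus>\<^bsub>loc (mon J)\<^esub> finsum (loc (mon J)) (cech_term J c') J"
    if J: "J \<in> cech_indices xs (Suc p)" for J
  proof -
    interpret L: abelian_group "loc (mon J)" by (rule L[OF J])
    have "finsum (loc (mon J)) (cech_term J (c \<oplus>\<^bsub>C p\<^esub> c')) J
      = (\<Oplus>\<^bsub>loc (mon J)\<^esub>j\<in>J. cech_term J c j \<oplus>\<^bsub>loc (mon J)\<^esub> cech_term J c' j)"
      using t[OF J c] t[OF J c'] by (intro L.finsum_cong') (auto simp: cech_term_add[OF J _ c c'])
    also have "\<dots> = finsum (loc (mon J)) (cech_term J c) J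
          \<oplus>\<^bsub>loc (mon J)\<^esub> finsum (loc (mon J)) (cech_term J c') J"
      by (rule L.finsum_addf[OF t[OF J c] t[OF J c']])
    finally show ?thesis .
  qed
  then show "cech_diff R xs p (c \<oplus>\<^bsub>C p\<^esub> c')
      = cech_diff R xs p c \<oplus>\<^bsub>C (Suc p)\<^esub> cech_diff R xs p c'"
    unfolding cech_diff_eq cech_module_def[of R xs "Suc p"] product_module_simps
    by (intro restrict_ext) simp
qed

lemma cech_diff_act:
  assumes \<xi>: "\<xi> \<in> carrier (diff_ops R K)" and c: "c \<in> carrier (C p)"
  shows "cech_diff R xs p (cech_act p \<xi> c) = cech_act (Suc p) \<xi> (cech_diff R xs p c)"
  unfolding cech_diff_eq cech_act_def[of "Suc p"]
proof (rule restrict_ext)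
  fix J assume J: "J \<in> cech_indices xs (Suc p)"
  let ?L = "loc (mon J)"
  interpret L: module R ?L
    by (rule multiplicative_subset.localization_module[OF cech_multiplicative[OF J]])
  have fin: "finite J" using J finite_subset by (auto simp: cech_indices_def)
  note add = left_D_action_additive[OF left_D_action_localization[OF cech_multiplicative[OF J]] \<xi>]
  have t: "cech_term J c \<in> J \<rightarrow> carrier ?L" using cech_term_closed[OF J _ c] by blast
  have "finsum ?L (cech_term J (cech_act p \<xi> c)) J = (\<Oplus>\<^bsub>?L\<^esub>j\<in>J. loc_act R (mon J) \<xi> (cech_term J c j))"
    using t additive_map_closed[OF add] by (intro L.M.finsum_cong') (auto simp: cech_term_act[OF J _ c \<xi>])
  also have "\<dots> = loc_act R (mon J) \<xi> (finsum ?L (cech_term J c) J)"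
    by (rule additive_map_finsum[OF L.abelian_group_axioms L.abelian_group_axioms add fin t, symmetric])
  finally show "finsum ?L (cech_term J (cech_act p \<xi> c)) J = loc_act R (mon J) \<xi>
      ((\<lambda>J\<in>cech_indices xs (Suc p). finsum (loc (mon J)) (cech_term J c) J) J)"
    using J by simp
qed

lemma cech_boundaries_subgroup: "subgroup (cech_boundaries R xs p) (add_monoid (C p))"
proof (cases p)
  case 0
  interpret C: abelian_group "C 0" by (rule cech_module_abelian_group)
  show ?thesis unfolding 0 by (intro C.add.subgroupI) (auto simp: cech_boundaries_def)
next
  case (Suc q)
  interpret C: abelian_group "C q" by (rule cech_module_abelian_group)
  interpret D: abelian_group "C p" by (rule cech_module_abelian_group)
  note d = cech_diff_additive[of q, folded Suc]
  have b: "cech_boundaries R xs p = cech_diff R xs q ` carrier (C q)"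
    by (simp add: cech_boundaries_def Suc)
  show ?thesis unfolding b
    using additive_map_closed[OF d] additive_map_add[OF d, symmetric]
      additive_map_minus[OF C.abelian_group_axioms D.abelian_group_axioms d, symmetric]
    by (intro D.add.subgroupI) (auto simp flip: a_inv_def)
qed

lemma cech_cohomology_action: "\<exists>act. left_D_action R K (cech_cohomology R xs p) act"
  unfolding cech_cohomology_def
proof (rule exI, rule left_D_action_subquotient[OF cech_module_abelian_group cech_action is_cring K_carrier
    cech_boundaries_subgroup])
  note zero = additive_map_zero[OF cech_module_abelian_group cech_module_abelian_group
      left_D_action_additive[OF cech_action]]
  note closed = left_D_action_closed[OF cech_action]
  show "cech_cocycles R xs p \<subseteq> carrier (C p)" by (auto simp: cech_cocycles_def)
  fix \<xi> z assume \<xi>: "\<xi> \<in> carrier (diff_ops R K)"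
  show "cech_act p \<xi> z \<in> cech_cocycles R xs p" if "z \<in> cech_cocycles R xs p"
    using that \<xi> by (simp add: cech_cocycles_def cech_diff_act closed zero)
  show "cech_act p \<xi> z \<in> cech_boundaries R xs p" if "z \<in> cech_boundaries R xs p"
  proof (cases p)
    case 0
    then show ?thesis using that zero[OF \<xi>] by (simp add: cech_boundaries_def)
  next
    case (Suc q)
    then show ?thesis using that \<xi> closed[OF \<xi>]
      by (auto simp: cech_boundaries_def simp flip: cech_diff_act)
  qed
qed

end

end


section \<open>Linear functionals over the coefficient field\<close>

text \<open>Since K lies inside R, a functional is a map to R with values in K, and the arithmetic
  of R serves as that of K. The domain V is a parameter so that functionals can be restricted to
  kernels and to the subspaces \<open>killed n\<close>.\<close>

definition K_linear ::
  "('a, 'r) ring_scheme \<Rightarrow> 'a set \<Rightarrow> ('a, 'b, 's) module_scheme \<Rightarrow> 'b set \<Rightarrow> ('b \<Rightarrow> 'a) \<Rightarrow> bool"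
where
  "K_linear R K M V f \<longleftrightarrow> (\<forall>v\<in>V. f v \<in> K) \<and>
     (\<forall>v\<in>V. \<forall>w\<in>V. f (v \<oplus>\<^bsub>M\<^esub> w) = f v \<oplus>\<^bsub>R\<^esub> f w) \<and>
     (\<forall>c\<in>K. \<forall>v\<in>V. f (c \<odot>\<^bsub>M\<^esub> v) = c \<otimes>\<^bsub>R\<^esub> f v)"

lemma K_linearD:
  assumes "K_linear R K M V f"
  shows K_linear_mem: "v \<in> V \<Longrightarrow> f v \<in> K"
    and K_linear_add: "\<lbrakk>v \<in> V; w \<in> V\<rbrakk> \<Longrightarrow> f (v \<oplus>\<^bsub>M\<^esub> w) = f v \<oplus>\<^bsub>R\<^esub> f w"
    and K_linear_smult: "\<lbrakk>c \<in> K; v \<in> V\<rbrakk> \<Longrightarrow> f (c \<odot>\<^bsub>M\<^esub> v) = c \<otimes>\<^bsub>R\<^esub> f v"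
  using assms by (auto simp: K_linear_def)

lemma K_linear_subset: "\<lbrakk>K_linear R K M V f; W \<subseteq> V\<rbrakk> \<Longrightarrow> K_linear R K M W f"
  unfolding K_linear_def by blast

locale field_module = module R M for R :: "('a, 'r) ring_scheme" (structure) and M :: "('a, 'b, 's) module_scheme" +
  fixes K assumes K_subfield: "subfield K R"
begin

lemma K_in_R: "c \<in> K \<Longrightarrow> c \<in> carrier R"
  using subfieldE(3)[OF K_subfield] by blast

lemma K_closed:
  "\<one> \<in> K" "\<zero> \<in> K" "c \<in> K \<Longrightarrow> \<ominus> c \<in> K" "\<lbrakk>c \<in> K; d \<in> K\<rbrakk> \<Longrightarrow> c \<oplus> d \<in> K"
  "\<lbrakk>c \<in> K; d \<in> K\<rbrakk> \<Longrightarrow> c \<otimes> d \<in> K"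
  using subringE[OF subcring.axioms(1)[OF subdomain.axioms(1)[OF subfield.axioms(1)[OF K_subfield]]]]
  by auto

lemma K_inverse:
  assumes "c \<in> K" "c \<noteq> \<zero>"
  obtains d where "d \<in> K" "d \<otimes> c = \<one>"
proof -
  have "c \<in> Units (R\<lparr>carrier := K\<rparr>)"
    using subfield.subfield_Units[OF K_subfield] assms by blast
  then show ?thesis using that by (auto simp: Units_def)
qed

definition subspace where
  "subspace V \<longleftrightarrow> V \<subseteq> carrier M \<and> \<zero>\<^bsub>M\<^esub> \<in> V \<and> (\<forall>v\<in>V. \<forall>w\<in>V. v \<oplus>\<^bsub>M\<^esub> w \<in> V) \<and> (\<forall>c\<in>K. \<forall>v\<in>V. c \<odot>\<^bsub>M\<^esub> v \<in> V)"

lemma subspaceD: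
  assumes "subspace V"
  shows "v \<in> V \<Longrightarrow> v \<in> carrier M" "\<zero>\<^bsub>M\<^esub> \<in> V" "\<lbrakk>v \<in> V; w \<in> V\<rbrakk> \<Longrightarrow> v \<oplus>\<^bsub>M\<^esub> w \<in> V"
    "\<lbrakk>c \<in> K; v \<in> V\<rbrakk> \<Longrightarrow> c \<odot>\<^bsub>M\<^esub> v \<in> V"
  using assms by (auto simp: subspace_def)

text \<open>If w is normalized to f w = 1, the vector v - f(v) w lies in the kernel of f, hence in
  that of g, so d = g w works. If f vanishes identically, so does g.\<close>

lemma K_linear_multiple:
  assumes V: "subspace V" and f: "K_linear R K M V f" and g: "K_linear R K M V g"
    and ker: "\<And>v. \<lbrakk>v \<in> V; f v = \<zero>\<rbrakk> \<Longrightarrow> g v = \<zero>"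
  shows "\<exists>d\<in>K. \<forall>v\<in>V. g v = d \<otimes> f v"
proof (cases "\<forall>v\<in>V. f v = \<zero>")
  case True
  then show ?thesis using ker by (intro bexI[of _ \<zero>]) (auto simp: K_closed)
next
  case False
  then obtain u where u: "u \<in> V" "f u \<noteq> \<zero>" by blast
  then obtain b where b: "b \<in> K" "b \<otimes> f u = \<one>"
    using K_inverse K_linear_mem[OF f] by blast
  define w where "w = b \<odot>\<^bsub>M\<^esub> u"
  have w: "w \<in> V" "f w = \<one>"
    using u b subspaceD(4)[OF V] K_linear_smult[OF f] by (auto simp: w_def)
  have "g v = g w \<otimes> f v" if v: "v \<in> V" for v
  proof -
    note mem = K_linear_mem[OF f v] K_linear_mem[OF g v] K_linear_mem[OF g w(1)]
    note car = mem[THEN K_in_R]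
    have s: "(\<ominus> f v) \<odot>\<^bsub>M\<^esub> w \<in> V" "\<ominus> f v \<in> K"
      using mem w subspaceD(4)[OF V] K_closed by auto
    have "f (v \<oplus>\<^bsub>M\<^esub> (\<ominus> f v) \<odot>\<^bsub>M\<^esub> w) = \<zero>"
      using v s w car by (simp add: K_linear_add[OF f] K_linear_smult[OF f] R.r_neg)
    then have "g (v \<oplus>\<^bsub>M\<^esub> (\<ominus> f v) \<odot>\<^bsub>M\<^esub> w) = \<zero>"
      using ker subspaceD(3)[OF V v s(1)] by blast
    then have "g v \<oplus> \<ominus> (f v \<otimes> g w) = \<zero>"
      using v s w car by (simp add: K_linear_add[OF g] K_linear_smult[OF g] R.l_minus)
    then show ?thesis using car by (metis R.m_closed R.m_comm R.minus_eq R.r_right_minus_eq)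
  qed
  then show ?thesis using K_linear_mem[OF g w(1)] by blast
qed

lemma K_linear_finsum:
  assumes "finite F" "\<And>i. i \<in> F \<Longrightarrow> K_linear R K M V (f i)" "\<And>i. i \<in> F \<Longrightarrow> c i \<in> K"
  shows "K_linear R K M V (\<lambda>v. \<Oplus>i\<in>F. c i \<otimes> f i v)"
  using assms
proof (induction F rule: finite_induct)
  case empty
  then show ?case by (auto simp: K_linear_def K_closed K_in_R)
next
  case (insert i F)
  note IH = insert.IH[OF insert.prems] and fi = insert.prems(1)[OF insertI1] and ci = insert.prems(2)[OF insertI1]
  have fc: "(\<lambda>j. c j \<otimes> f j v) \<in> F \<rightarrow> carrier R" "c i \<otimes> f i v \<in> carrier R" "f i v \<in> carrier R" if "v \<in> V" for v
    using insert.prems K_linear_mem[OF insert.prems(1) that] by (auto simp: K_in_R)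
  \<comment> \<open>V is not assumed to be a subspace here, so v + w and d v may lie outside it. At
    these points the values of the functionals are in R by linearity, which is what the second
    alternative records.\<close>
  have e: "(\<Oplus>j\<in>insert i F. c j \<otimes> f j v) = c i \<otimes> f i v \<oplus> (\<Oplus>j\<in>F. c j \<otimes> f j v)"
    if "v \<in> V \<or> (\<forall>j\<in>insert i F. f j v \<in> carrier R)" for v
    using insert.hyps insert.prems fc that by (subst R.finsum_insert) (auto simp: K_in_R)
  have IHm: "(\<Oplus>j\<in>F. c j \<otimes> f j v) \<in> K" if "v \<in> V" for v
    using K_linear_mem[OF IH[simplified] that] by simp
  show ?case unfolding K_linear_def
  proof (intro conjI ballI)
    fix v assume v: "v \<in> V"
    show "(\<Oplus>j\<in>insert i F. c j \<otimes> f j v) \<in> K"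
      using v e K_closed ci K_linear_mem[OF fi v] IHm[OF v] by auto
    { fix w assume w: "w \<in> V"
      have vw: "f j (v \<oplus>\<^bsub>M\<^esub> w) \<in> carrier R" if "j \<in> insert i F" for j
        using K_linear_add[OF insert.prems(1)[OF that] v w] K_linear_mem[OF insert.prems(1)[OF that]] v w
        by (simp add: K_in_R)
      show "(\<Oplus>j\<in>insert i F. c j \<otimes> f j (v \<oplus>\<^bsub>M\<^esub> w))
          = (\<Oplus>j\<in>insert i F. c j \<otimes> f j v) \<oplus> (\<Oplus>j\<in>insert i F. c j \<otimes> f j w)"
        using v w e vw fc ci K_linear_add[OF IH v w] K_linear_add[OF fi v w]
          IHm[OF v, THEN K_in_R] IHm[OF w, THEN K_in_R]
        by (simp add: R.r_distr R.a_ac K_in_R) }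
    fix d assume d: "d \<in> K"
    have dv: "f j (d \<odot>\<^bsub>M\<^esub> v) \<in> carrier R" if "j \<in> insert i F" for j
      using K_linear_smult[OF insert.prems(1)[OF that] d v] K_linear_mem[OF insert.prems(1)[OF that] v] d
      by (simp add: K_in_R)
    show "(\<Oplus>j\<in>insert i F. c j \<otimes> f j (d \<odot>\<^bsub>M\<^esub> v)) = d \<otimes> (\<Oplus>j\<in>insert i F. c j \<otimes> f j v)"
      using v d e dv fc ci K_linear_smult[OF IH d v] K_linear_smult[OF fi d v] IHm[OF v, THEN K_in_R]
      by (simp add: R.r_distr R.m_lcomm K_in_R)
  qed
qed

lemma K_linear_diff:
  assumes "subspace V" "K_linear R K M V f" "K_linear R K M V g"
  shows "K_linear R K M V (\<lambda>v. f v \<ominus> g v)"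
  unfolding K_linear_def
proof (intro conjI ballI)
  fix v assume v: "v \<in> V"
  note mem = K_linear_mem[OF assms(2)] K_linear_mem[OF assms(3)]
  note car = mem[THEN K_in_R]
  show "f v \<ominus> g v \<in> K" using mem v K_closed by (simp add: R.minus_eq)
  show "f (v \<oplus>\<^bsub>M\<^esub> w) \<ominus> g (v \<oplus>\<^bsub>M\<^esub> w) = f v \<ominus> g v \<oplus> (f w \<ominus> g w)" if w: "w \<in> V" for w
    using v w car by (simp add: R.minus_eq K_linear_add[OF assms(2)] K_linear_add[OF assms(3)] R.minus_add R.a_ac)
  show "f (d \<odot>\<^bsub>M\<^esub> v) \<ominus> g (d \<odot>\<^bsub>M\<^esub> v) = d \<otimes> (f v \<ominus> g v)" if d: "d \<in> K" for d
    using v d car by (simp add: R.minus_eq K_linear_smult[OF assms(2)] K_linear_smult[OF assms(3)] R.r_distr R.r_minus K_in_R)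
qed

text \<open>Restricting everything to the kernel of one functional \<open>f i\<close> removes it
  from the list, and this is why V varies in the induction. The combination found there differs from
  g by a functional that vanishes on the kernel of \<open>f i\<close>, hence by a multiple of
  \<open>f i\<close>.\<close>

lemma K_linear_span:
  assumes "finite F" "subspace V" "\<And>i. i \<in> F \<Longrightarrow> K_linear R K M V (f i)" "K_linear R K M V g"
    and "\<And>v. \<lbrakk>v \<in> V; \<And>i. i \<in> F \<Longrightarrow> f i v = \<zero>\<rbrakk> \<Longrightarrow> g v = \<zero>"
  shows "\<exists>c\<in>F \<rightarrow> K. \<forall>v\<in>V. g v = (\<Oplus>i\<in>F. c i \<otimes> f i v)"
  using assms
proof (induction F arbitrary: V rule: finite_induct)
  case empty
  then show ?case by simp
next
  case (insert i F)
  define W where "W = {v \<in> V. f i v = \<zero>}"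
  have fi: "K_linear R K M V (f i)" using insert.prems by blast
  have WV: "W \<subseteq> V" by (auto simp: W_def)
  have W: "subspace W"
    unfolding subspace_def W_def
  proof (intro conjI ballI)
    have "f i (\<zero> \<odot>\<^bsub>M\<^esub> \<zero>\<^bsub>M\<^esub>) = \<zero> \<otimes> f i \<zero>\<^bsub>M\<^esub>"
      using K_linear_smult[OF fi] subspaceD(2)[OF insert.prems(1)] K_closed by blast
    then have "f i \<zero>\<^bsub>M\<^esub> = \<zero>"
      using K_linear_mem[OF fi, of "\<zero>\<^bsub>M\<^esub>"] subspaceD(2)[OF insert.prems(1)] by (simp add: K_in_R)
    then show "\<zero>\<^bsub>M\<^esub> \<in> {v \<in> V. f i v = \<zero>}" using subspaceD(2)[OF insert.prems(1)] by blast
  qed (use subspaceD[OF insert.prems(1)] K_linear_add[OF fi] K_linear_smult[OF fi] in \<open>auto simp: K_in_R\<close>)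
  have "\<exists>c\<in>F \<rightarrow> K. \<forall>v\<in>W. g v = (\<Oplus>i\<in>F. c i \<otimes> f i v)"
    using insert.prems WV by (intro insert.IH[OF W]) (auto intro: K_linear_subset simp: W_def)
  then obtain c where c: "c \<in> F \<rightarrow> K" "\<And>v. v \<in> W \<Longrightarrow> g v = (\<Oplus>i\<in>F. c i \<otimes> f i v)" by blast
  have cK: "\<And>j. j \<in> F \<Longrightarrow> c j \<in> K" using c(1) by blast
  let ?h = "\<lambda>v. \<Oplus>i\<in>F. c i \<otimes> f i v"
  have h: "K_linear R K M V ?h"
    using insert.hyps insert.prems c by (intro K_linear_finsum) auto
  note hm = K_linear_mem[OF h, THEN K_in_R] and gm = K_linear_mem[OF insert.prems(3), THEN K_in_R]
    and fm = K_linear_mem[OF fi, THEN K_in_R]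
  obtain d where d: "d \<in> K" "\<And>v. v \<in> V \<Longrightarrow> g v \<ominus> ?h v = d \<otimes> f i v"
    using K_linear_multiple[OF insert.prems(1) fi K_linear_diff[OF insert.prems(1,3) h]] c hm gm W_def
    by (auto simp: R.r_right_minus_eq)
  have "g v = (\<Oplus>j\<in>insert i F. (c(i := d)) j \<otimes> f j v)" if v: "v \<in> V" for v
  proof -
    have "(\<Oplus>j\<in>insert i F. (c(i := d)) j \<otimes> f j v) = d \<otimes> f i v \<oplus> (\<Oplus>j\<in>F. (c(i := d)) j \<otimes> f j v)"
      using insert.hyps cK d(1) fm[OF v] K_linear_mem[OF insert.prems(2) v]
      by (subst R.finsum_insert) (auto simp: K_in_R)
    also have "(\<Oplus>j\<in>F. (c(i := d)) j \<otimes> f j v) = ?h v"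
      using insert.hyps cK K_linear_mem[OF insert.prems(2) v]
      by (intro R.finsum_cong') (auto simp: K_in_R)
    also have "d \<otimes> f i v \<oplus> ?h v = g v"
      using d(2)[OF v, symmetric] hm[OF v] gm[OF v] by (simp add: R.minus_eq R.a_assoc R.l_neg)
    finally show ?thesis by simp
  qed
  then show ?case using c(1) d(1) by (intro bexI[of _ "c(i := d)"]) auto
qed

text \<open>A subspace T that is maximal among those avoiding s is a complement of the line K s, and
  \<tau> is the coordinate along that line.\<close>

lemma K_linear_exists:
  assumes s: "s \<in> carrier M" "s \<noteq> \<zero>\<^bsub>M\<^esub>"
  shows "\<exists>\<tau>. K_linear R K M (carrier M) \<tau> \<and> \<tau> s = \<one>"
proof -
  let ?A = "{T. subspace T \<and> s \<notin> T}"
  have "\<exists>T\<in>?A. \<forall>X\<in>?A. T \<subseteq> X \<longrightarrow> X = T"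
  proof (rule subset_Zorn_nonempty)
    have "{\<zero>\<^bsub>M\<^esub>} \<in> ?A" using s by (auto simp: subspace_def K_in_R)
    then show "?A \<noteq> {}" by blast
    fix C assume C: "C \<noteq> {}" "subset.chain ?A C"
    then have sub: "\<And>T. T \<in> C \<Longrightarrow> subspace T" "\<And>T. T \<in> C \<Longrightarrow> s \<notin> T"
      and tot: "\<And>X Y. \<lbrakk>X \<in> C; Y \<in> C\<rbrakk> \<Longrightarrow> X \<subseteq> Y \<or> Y \<subseteq> X"
      by (auto simp: subset_chain_def)
    have "v \<oplus>\<^bsub>M\<^esub> w \<in> \<Union>C" if vw: "v \<in> \<Union>C" "w \<in> \<Union>C" for v w
    proof -
      obtain X Y where XY: "X \<in> C" "v \<in> X" "Y \<in> C" "w \<in> Y" using vw by blast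
      then have "\<exists>Z\<in>C. v \<in> Z \<and> w \<in> Z" using tot[of X Y] by blast
      then show ?thesis using subspaceD(3)[OF sub(1)] by blast
    qed
    moreover have "\<Union>C \<subseteq> carrier M" using subspaceD(1)[OF sub(1)] by blast
    moreover have "\<zero>\<^bsub>M\<^esub> \<in> \<Union>C" using C(1) subspaceD(2)[OF sub(1)] by blast
    moreover have "c \<odot>\<^bsub>M\<^esub> v \<in> \<Union>C" if "c \<in> K" "v \<in> \<Union>C" for c v
      using that subspaceD(4)[OF sub(1)] by blast
    ultimately have "subspace (\<Union>C)" by (simp only: subspace_def) blast
    then show "\<Union>C \<in> ?A" using sub(2) by blast
  qed
  then obtain T where T: "subspace T" "s \<notin> T"
    and max: "\<And>X. \<lbrakk>subspace X; s \<notin> X; T \<subseteq> X\<rbrakk> \<Longrightarrow> X = T" by blast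
  note sub = subspaceD[OF T(1)]
  have neg: "\<ominus>\<^bsub>M\<^esub> t \<in> T" if "t \<in> T" for t
    using sub(1)[of t] sub(4)[of "\<ominus> \<one>" t] that by (simp add: K_closed smult_l_minus)
  have ex: "\<exists>c\<in>K. \<exists>t\<in>T. e = t \<oplus>\<^bsub>M\<^esub> c \<odot>\<^bsub>M\<^esub> s" if e: "e \<in> carrier M" for e
  proof (cases "e \<in> T")
    case True
    then show ?thesis using s(1) e K_closed(2) by (intro bexI[of _ \<zero>] bexI[of _ e]) simp_all
  next
    case False
    \<comment> \<open>By maximality T + K e contains s for every e outside T. The coefficient of e
      in the resulting relation is nonzero because s is not in T, so the relation can be solved for
      e.\<close>
    let ?X = "{t \<oplus>\<^bsub>M\<^esub> c \<odot>\<^bsub>M\<^esub> e | t c. t \<in> T \<and> c \<in> K}"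
    have X: "subspace ?X" unfolding subspace_def
    proof (intro conjI ballI)
      show "?X \<subseteq> carrier M" using sub(1) e K_in_R by blast
      show "\<zero>\<^bsub>M\<^esub> \<in> ?X" using sub(1)[OF sub(2)] sub(2) e K_closed(1,2) by (intro CollectI exI[of _ "\<zero>\<^bsub>M\<^esub>"] exI[of _ \<zero>]) auto
    next
      fix v w assume "v \<in> ?X" "w \<in> ?X"
      then obtain t c t' c' where tc: "t \<in> T" "c \<in> K" "v = t \<oplus>\<^bsub>M\<^esub> c \<odot>\<^bsub>M\<^esub> e"
        "t' \<in> T" "c' \<in> K" "w = t' \<oplus>\<^bsub>M\<^esub> c' \<odot>\<^bsub>M\<^esub> e" by blast
      have "v \<oplus>\<^bsub>M\<^esub> w = (t \<oplus>\<^bsub>M\<^esub> t') \<oplus>\<^bsub>M\<^esub> (c \<oplus> c') \<odot>\<^bsub>M\<^esub> e"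
        using tc e sub(1) by (simp add: K_in_R smult_l_distr M.a_ac)
      then show "v \<oplus>\<^bsub>M\<^esub> w \<in> ?X" using tc sub(3) K_closed(4) by blast
    next
      fix d v assume d: "d \<in> K" and "v \<in> ?X"
      then obtain t c where tc: "t \<in> T" "c \<in> K" "v = t \<oplus>\<^bsub>M\<^esub> c \<odot>\<^bsub>M\<^esub> e" by blast
      have "d \<odot>\<^bsub>M\<^esub> v = d \<odot>\<^bsub>M\<^esub> t \<oplus>\<^bsub>M\<^esub> (d \<otimes> c) \<odot>\<^bsub>M\<^esub> e"
        using tc e d sub(1) by (simp add: K_in_R smult_r_distr smult_assoc1)
      then show "d \<odot>\<^bsub>M\<^esub> v \<in> ?X" using tc d sub(4) K_closed(5) by blast
    qed
    have TX: "T \<subseteq> ?X"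
    proof
      fix t assume "t \<in> T"
      then show "t \<in> ?X" using sub(1)[of t] e K_closed(2)
        by (intro CollectI exI[of _ t] exI[of _ \<zero>]) auto
    qed
    have "e \<in> ?X" using sub(1)[OF sub(2)] sub(2) e K_closed(1,2) by (intro CollectI exI[of _ "\<zero>\<^bsub>M\<^esub>"] exI[of _ \<one>]) auto
    then have "?X \<noteq> T" using False by blast
    then have "s \<in> ?X" using max[OF X _ TX] by blast
    then obtain t c where tc: "t \<in> T" "c \<in> K" "s = t \<oplus>\<^bsub>M\<^esub> c \<odot>\<^bsub>M\<^esub> e" by blast
    have "c \<noteq> \<zero>" using tc T(2) sub(1) e by auto
    then obtain d where d: "d \<in> K" "d \<otimes> c = \<one>" using K_inverse tc by blast
    have "d \<odot>\<^bsub>M\<^esub> s = d \<odot>\<^bsub>M\<^esub> t \<oplus>\<^bsub>M\<^esub> e"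
      using tc d e sub(1) by (simp add: K_in_R smult_r_distr flip: smult_assoc1)
    then have "e = \<ominus>\<^bsub>M\<^esub> (d \<odot>\<^bsub>M\<^esub> t) \<oplus>\<^bsub>M\<^esub> d \<odot>\<^bsub>M\<^esub> s"
      using e d(1) tc(1) sub(1) by (simp add: K_in_R M.r_neg1)
    then show ?thesis using d(1) tc(1) sub(4) neg by blast
  qed
  have unique: "c = c'" if "c \<in> K" "c' \<in> K" "t \<in> T" "t' \<in> T"
      "t \<oplus>\<^bsub>M\<^esub> c \<odot>\<^bsub>M\<^esub> s = t' \<oplus>\<^bsub>M\<^esub> c' \<odot>\<^bsub>M\<^esub> s" for c c' t t'
  proof (rule ccontr)
    assume "c \<noteq> c'"
    then have "c \<ominus> c' \<noteq> \<zero>" "c \<ominus> c' \<in> K" using that K_in_R K_closed by (auto simp: R.minus_eq R.r_right_minus_eq)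
      (metis K_in_R R.minus_eq R.r_right_minus_eq)
    then obtain d where d: "d \<in> K" "d \<otimes> (c \<ominus> c') = \<one>" using K_inverse by blast
    note car = that(1,2)[THEN K_in_R] that(3,4)[THEN sub(1)] s(1) K_in_R[OF d(1)]
    have "(c \<ominus> c') \<odot>\<^bsub>M\<^esub> s = \<ominus>\<^bsub>M\<^esub> t \<oplus>\<^bsub>M\<^esub> (t \<oplus>\<^bsub>M\<^esub> c \<odot>\<^bsub>M\<^esub> s) \<oplus>\<^bsub>M\<^esub> \<ominus>\<^bsub>M\<^esub> (c' \<odot>\<^bsub>M\<^esub> s)"
      using car by (simp add: R.minus_eq smult_l_distr smult_l_minus M.r_neg1)
    also have "\<dots> = \<ominus>\<^bsub>M\<^esub> t \<oplus>\<^bsub>M\<^esub> t'"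
      unfolding that(5) using car by (simp add: M.a_assoc M.r_neg)
    finally have "(c \<ominus> c') \<odot>\<^bsub>M\<^esub> s \<in> T" using that neg sub(3) by simp
    then have "d \<odot>\<^bsub>M\<^esub> ((c \<ominus> c') \<odot>\<^bsub>M\<^esub> s) \<in> T" using sub(4) d by blast
    then have "s \<in> T" using d car by (simp flip: smult_assoc1)
    then show False using T by blast
  qed
  define \<tau> where "\<tau> = (\<lambda>e. THE c. c \<in> K \<and> (\<exists>t\<in>T. e = t \<oplus>\<^bsub>M\<^esub> c \<odot>\<^bsub>M\<^esub> s))"
  have \<tau>: "\<tau> (t \<oplus>\<^bsub>M\<^esub> c \<odot>\<^bsub>M\<^esub> s) = c" if "c \<in> K" "t \<in> T" for c t
    unfolding \<tau>_def using that unique by (intro the_equality) blast+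
  have "K_linear R K M (carrier M) \<tau>" unfolding K_linear_def
  proof (intro conjI ballI)
    fix v assume "v \<in> carrier M"
    then obtain c t where v: "c \<in> K" "t \<in> T" "v = t \<oplus>\<^bsub>M\<^esub> c \<odot>\<^bsub>M\<^esub> s" using ex by blast
    show "\<tau> v \<in> K" using v \<tau> by simp
    { fix w assume "w \<in> carrier M"
      then obtain c' t' where w: "c' \<in> K" "t' \<in> T" "w = t' \<oplus>\<^bsub>M\<^esub> c' \<odot>\<^bsub>M\<^esub> s" using ex by blast
      have "v \<oplus>\<^bsub>M\<^esub> w = (t \<oplus>\<^bsub>M\<^esub> t') \<oplus>\<^bsub>M\<^esub> (c \<oplus> c') \<odot>\<^bsub>M\<^esub> s"
        using v w s sub(1) by (simp add: K_in_R smult_l_distr M.a_ac)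
      then show "\<tau> (v \<oplus>\<^bsub>M\<^esub> w) = \<tau> v \<oplus> \<tau> w" using v w \<tau> K_closed sub(3) by simp }
    fix d assume d: "d \<in> K"
    have "d \<odot>\<^bsub>M\<^esub> v = d \<odot>\<^bsub>M\<^esub> t \<oplus>\<^bsub>M\<^esub> (d \<otimes> c) \<odot>\<^bsub>M\<^esub> s"
      using v d s sub(1) by (simp add: K_in_R smult_r_distr smult_assoc1)
    then show "\<tau> (d \<odot>\<^bsub>M\<^esub> v) = d \<otimes> \<tau> v" using v d \<tau> K_closed sub(4) by simp
  qed
  moreover have "\<tau> s = \<one>" using \<tau>[of \<one> "\<zero>\<^bsub>M\<^esub>"] s sub(2) K_closed by simp
  ultimately show ?thesis by blast
qed

end


section \<open>Injective hulls of the residue field\<close>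

lemma Hom_module_simps:
  "f \<in> carrier (Hom_module R M N) \<longleftrightarrow> f \<in> mod_hom R M N \<and> f \<in> extensional (carrier M)"
  "\<zero>\<^bsub>Hom_module R M N\<^esub> = (\<lambda>x\<in>carrier M. \<zero>\<^bsub>N\<^esub>)"
  "f \<oplus>\<^bsub>Hom_module R M N\<^esub> g = (\<lambda>x\<in>carrier M. f x \<oplus>\<^bsub>N\<^esub> g x)"
  "a \<odot>\<^bsub>Hom_module R M N\<^esub> f = (\<lambda>x\<in>carrier M. a \<odot>\<^bsub>N\<^esub> f x)"
  by (simp_all add: Hom_module_def)

lemma (in module_pair) restrict_Hom_module:
  assumes "f \<in> mod_hom R M N"
  shows "restrict f (carrier M) \<in> carrier (Hom_module R M N)"
  using mod_homD[OF assms] by (auto simp: Hom_module_simps intro!: mod_homI)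

lemma (in module_pair) module_Hom_module: "module R (Hom_module R M N)"
proof (rule moduleI)
  let ?H = "Hom_module R M N"
  have closed: "f x \<in> carrier N" if "f \<in> carrier ?H" "x \<in> carrier M" for f x
    using that mod_hom_closed by (auto simp: Hom_module_simps)
  show "cring R" by (rule M.R.is_cring)
  show "abelian_group ?H"
  proof (rule abelian_groupI)
    fix f assume f: "f \<in> carrier ?H"
    then have fh: "f \<in> mod_hom R M N" by (simp add: Hom_module_simps)
    show "\<zero>\<^bsub>?H\<^esub> \<oplus>\<^bsub>?H\<^esub> f = f"
      using f closed[OF f] by (intro extensionalityI[of _ "carrier M"]) (auto simp: Hom_module_simps)
    have "(\<lambda>x. \<ominus>\<^bsub>N\<^esub> f x) \<in> mod_hom R M N"
      using mod_homD[OF fh] by (intro mod_homI) (auto simp: N.M.minus_add N.smult_r_minus)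
    from restrict_Hom_module[OF this]
    show "\<exists>g\<in>carrier ?H. g \<oplus>\<^bsub>?H\<^esub> f = \<zero>\<^bsub>?H\<^esub>"
    proof (rule bexI[rotated])
      show "(\<lambda>x\<in>carrier M. \<ominus>\<^bsub>N\<^esub> f x) \<oplus>\<^bsub>?H\<^esub> f = \<zero>\<^bsub>?H\<^esub>"
        unfolding Hom_module_simps(2,3) using closed[OF f] by (intro restrict_ext) (simp add: N.M.l_neg)
    qed
    fix g assume g: "g \<in> carrier ?H"
    then have gh: "g \<in> mod_hom R M N" by (simp add: Hom_module_simps)
    have "(\<lambda>x. f x \<oplus>\<^bsub>N\<^esub> g x) \<in> mod_hom R M N"
      using mod_homD[OF fh] mod_homD[OF gh] by (intro mod_homI) (auto simp: N.M.a_ac N.smult_r_distr)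
    then show "f \<oplus>\<^bsub>?H\<^esub> g \<in> carrier ?H"
      using restrict_Hom_module by (auto simp: Hom_module_simps(3))
    show "f \<oplus>\<^bsub>?H\<^esub> g = g \<oplus>\<^bsub>?H\<^esub> f"
      using closed f g by (auto simp: Hom_module_simps N.M.a_comm intro!: restrict_ext)
    fix h assume h: "h \<in> carrier ?H"
    show "f \<oplus>\<^bsub>?H\<^esub> g \<oplus>\<^bsub>?H\<^esub> h = f \<oplus>\<^bsub>?H\<^esub> (g \<oplus>\<^bsub>?H\<^esub> h)"
      using closed[OF f] closed[OF g] closed[OF h]
      by (auto simp: Hom_module_simps(3) N.M.a_assoc intro!: restrict_ext)
  next
    have "(\<lambda>_. \<zero>\<^bsub>N\<^esub>) \<in> mod_hom R M N" by (intro mod_homI) auto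
    then show "\<zero>\<^bsub>?H\<^esub> \<in> carrier ?H"
      using restrict_Hom_module by (auto simp: Hom_module_simps(2))
  qed
  fix a f assume a: "a \<in> carrier R" and f: "f \<in> carrier ?H"
  have fh: "f \<in> mod_hom R M N" using f by (simp add: Hom_module_simps)
  have "(\<lambda>x. a \<odot>\<^bsub>N\<^esub> f x) \<in> mod_hom R M N"
    using a mod_homD[OF fh]
    by (intro mod_homI) (auto simp: N.smult_r_distr M.R.m_comm simp flip: N.smult_assoc1)
  then show "a \<odot>\<^bsub>?H\<^esub> f \<in> carrier ?H"
    using restrict_Hom_module by (auto simp: Hom_module_simps(4))
  { fix b assume b: "b \<in> carrier R"
    show "(a \<oplus> b) \<odot>\<^bsub>?H\<^esub> f = a \<odot>\<^bsub>?H\<^esub> f \<oplus>\<^bsub>?H\<^esub> b \<odot>\<^bsub>?H\<^esub> f"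
      using a b closed[OF f] by (auto simp: Hom_module_simps N.smult_l_distr intro!: restrict_ext)
    show "(a \<otimes> b) \<odot>\<^bsub>?H\<^esub> f = a \<odot>\<^bsub>?H\<^esub> (b \<odot>\<^bsub>?H\<^esub> f)"
      using a b closed[OF f] by (auto simp: Hom_module_simps N.smult_assoc1 intro!: restrict_ext) }
  fix g assume g: "g \<in> carrier ?H"
  show "a \<odot>\<^bsub>?H\<^esub> (f \<oplus>\<^bsub>?H\<^esub> g) = a \<odot>\<^bsub>?H\<^esub> f \<oplus>\<^bsub>?H\<^esub> a \<odot>\<^bsub>?H\<^esub> g"
    using a closed[OF f] closed[OF g] by (auto simp: Hom_module_simps N.smult_r_distr intro!: restrict_ext)
next
  fix f assume f: "f \<in> carrier (Hom_module R M N)"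
  then show "\<one> \<odot>\<^bsub>Hom_module R M N\<^esub> f = f"
    using mod_hom_closed[of f R M N] by (intro extensionalityI[of _ "carrier M"]) (auto simp: Hom_module_simps)
qed

text \<open>A nonempty chain of ideals in a Noetherian ring contains its own union, so Zorn's lemma
  applies to any nonempty family of ideals, whether or not it is closed under unions of
  chains.\<close>

lemma (in noetherian_ring) exists_maximal_in:
  assumes "A \<noteq> {}" "\<And>I. I \<in> A \<Longrightarrow> ideal I R"
  shows "\<exists>I\<in>A. \<forall>J\<in>A. I \<subseteq> J \<longrightarrow> J = I"
proof (rule subset_Zorn_nonempty[OF assms(1)])
  fix C assume C: "C \<noteq> {}" "subset.chain A C"
  then have "subset.chain {I. ideal I R} C"
    using assms(2) by (auto simp: subset_chain_def)
  then show "\<Union>C \<in> A"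
    using ideal_chain_is_trivial[OF C(1)] C(2) unfolding subset_chain_def by blast
qed

lemma (in noetherian_local_ring) one_notin_maximal: "\<one> \<notin> \<mm>"
  using maximalideal.I_notcarr[OF maximal] ideal.one_imp_carrier[OF maximalideal.axioms(1)[OF maximal]]
  by metis

text \<open>If a were not invertible, it would generate a proper ideal. A proper ideal maximal among
  those above it is a maximal ideal of R, hence equal to \<mm>, which does not contain a.\<close>

lemma (in noetherian_local_ring) unit_if_not_in_maximal:
  assumes a: "a \<in> carrier R" "a \<notin> \<mm>"
  shows "\<exists>b\<in>carrier R. b \<otimes> a = \<one>"
proof (rule ccontr)
  assume no: "\<not> (\<exists>b\<in>carrier R. b \<otimes> a = \<one>)"
  let ?A = "{I. ideal I R \<and> PIdl a \<subseteq> I \<and> I \<noteq> carrier R}"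
  have "\<one> \<notin> PIdl a" using no unfolding cgenideal_def by force
  then have "PIdl a \<noteq> carrier R" using one_closed by metis
  then have "PIdl a \<in> ?A" using cgenideal_ideal[OF a(1)] by simp
  then have "?A \<noteq> {}" by blast
  then have "\<exists>J\<in>?A. \<forall>I\<in>?A. J \<subseteq> I \<longrightarrow> I = J" by (rule exists_maximal_in) simp
  then obtain J where J': "J \<in> ?A" "\<forall>I\<in>?A. J \<subseteq> I \<longrightarrow> I = J"
    by (rule bexE)
  have J: "ideal J R" "PIdl a \<subseteq> J" "J \<noteq> carrier R"
    using J'(1) by simp_all
  have "maximalideal J R"
  proof (rule maximalidealI)
    show "ideal J R" by (rule J(1))
    show "carrier R \<noteq> J" using J(3) by simp
    fix I assume I: "ideal I R" "J \<subseteq> I" "I \<subseteq> carrier R"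
    show "I = J \<or> I = carrier R"
    proof (cases "I = carrier R")
      case False
      then have "I \<in> ?A" using I J(2) by simp
      then show ?thesis using J'(2) I(2) by simp
    qed simp
  qed
  then have "J = \<mm>" by (rule unique_maximal)
  then show False using J(2) cgenideal_self[OF a(1)] a(2) by blast
qed

lemma (in cring) cring_idealI:
  assumes "I \<subseteq> carrier R" "\<zero> \<in> I" "\<And>a b. \<lbrakk>a \<in> I; b \<in> I\<rbrakk> \<Longrightarrow> a \<oplus> b \<in> I"
    "\<And>a r. \<lbrakk>a \<in> I; r \<in> carrier R\<rbrakk> \<Longrightarrow> r \<otimes> a \<in> I"
  shows "ideal I R"
proof (rule idealI)
  show "ring R" by (rule ring_axioms)
  have "\<ominus> a \<in> I" if "a \<in> I" for a
    using assms(4)[OF that, of "\<ominus> \<one>"] that assms(1) by (auto simp: l_minus)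
  then show "subgroup I (add_monoid R)"
    using assms by (intro add.subgroupI) (auto simp flip: a_inv_def)
  show "a \<otimes> r \<in> I" if "a \<in> I" "r \<in> carrier R" for a r
    using assms(4)[OF that] that assms(1) m_comm[of a r] by auto
qed (use assms in auto)

section \<open>Powers of the maximal ideal\<close>

context complete_local_ring
begin

definition mpow :: "nat \<Rightarrow> 'a set" where "mpow n = \<mm> [^]\<^bsub>ideals_set R\<^esub> n"

lemma ideal_m: "ideal \<mm> R"
  by (rule maximalideal.axioms(1)[OF maximal])

lemma mpow_0: "mpow 0 = carrier R" and mpow_Suc: "mpow (Suc n) = ideal_prod R (mpow n) \<mm>"
  by (simp_all add: mpow_def nat_pow_def ideals_set_def)

lemma mpow_ideal: "ideal (mpow n) R"
  by (induction n) (simp_all add: mpow_0 mpow_Suc oneideal ideal_prod_is_ideal ideal_m)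

lemma mpow_in_R: "a \<in> mpow n \<Longrightarrow> a \<in> carrier R"
  by (rule ideal.Icarr[OF mpow_ideal])

lemma mpow_mono: "n \<le> k \<Longrightarrow> mpow k \<subseteq> mpow n"
proof (induction k rule: dec_induct)
  case (step k)
  then show ?case using ideal_prod_inter[OF mpow_ideal ideal_m] by (auto simp: mpow_Suc)
qed simp

end

text \<open>E plays the role of the injective hull of the residue field, and \<open>s\<close> that
  of the image of 1. \<open>essential\<close> is essentiality for cyclic submodules, rescaled so as
  to hit \<open>s\<close> itself, and \<open>ideal_extension\<close> is injectivity in the form of
  Baer's criterion.\<close>

locale matlis = complete_local_ring R \<mm> + E: field_module R E K
  for R :: "('a, 'r) ring_scheme" (structure) and \<mm> and E :: "('a, 'e, 's) module_scheme" and K +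
  fixes s
  assumes K_residue: "r \<in> carrier R \<Longrightarrow> \<exists>c\<in>K. \<exists>x\<in>\<mm>. r = c \<oplus> x"
    and s_closed: "s \<in> carrier E" and s_nonzero: "s \<noteq> \<zero>\<^bsub>E\<^esub>"
    and s_socle: "x \<in> \<mm> \<Longrightarrow> x \<odot>\<^bsub>E\<^esub> s = \<zero>\<^bsub>E\<^esub>"
    and essential: "\<lbrakk>e \<in> carrier E; e \<noteq> \<zero>\<^bsub>E\<^esub>\<rbrakk> \<Longrightarrow> \<exists>r\<in>carrier R. r \<odot>\<^bsub>E\<^esub> e = s"
    and ideal_extension: "\<lbrakk>ideal I R; f \<in> mod_hom R ((regular_module R)\<lparr>carrier := I\<rparr>) E\<rbrakk>
      \<Longrightarrow> \<exists>g\<in>mod_hom R (regular_module R) E. \<forall>x\<in>I. g x = f x"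
begin

lemma m_in_R: "x \<in> \<mm> \<Longrightarrow> x \<in> carrier R"
  by (rule ideal.Icarr[OF ideal_m])

text \<open>Some multiple r e equals s. In r = c + x with c in K and x in \<mm> the part x kills e,
  so c e = s, and c can be inverted in K.\<close>

lemma socle:
  assumes e: "e \<in> carrier E" and m: "\<And>x. x \<in> \<mm> \<Longrightarrow> x \<odot>\<^bsub>E\<^esub> e = \<zero>\<^bsub>E\<^esub>"
  shows "\<exists>c\<in>K. e = c \<odot>\<^bsub>E\<^esub> s"
proof (cases "e = \<zero>\<^bsub>E\<^esub>")
  case True
  then show ?thesis using s_closed E.K_closed(2) by (intro bexI[of _ \<zero>]) auto
next
  case False
  obtain r where r: "r \<in> carrier R" "r \<odot>\<^bsub>E\<^esub> e = s" using essential[OF e False] by blast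
  obtain c x where cx: "c \<in> K" "x \<in> \<mm>" "r = c \<oplus> x" using K_residue[OF r(1)] by blast
  have s: "c \<odot>\<^bsub>E\<^esub> e = s"
    using r cx e m[OF cx(2)] m_in_R[OF cx(2)] E.K_in_R[OF cx(1)] by (simp add: E.smult_l_distr)
  then have "c \<noteq> \<zero>" using s_nonzero e by auto
  then obtain d where d: "d \<in> K" "d \<otimes> c = \<one>" using E.K_inverse[OF cx(1)] by blast
  then have "e = d \<odot>\<^bsub>E\<^esub> s"
    using s e cx E.K_in_R by (metis E.smult_assoc1 E.smult_one)
  then show ?thesis using d by blast
qed

definition kills :: "nat \<Rightarrow> 'e \<Rightarrow> bool" where
  "kills n e \<longleftrightarrow> (\<forall>a\<in>mpow n. a \<odot>\<^bsub>E\<^esub> e = \<zero>\<^bsub>E\<^esub>)"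

text \<open>Only products of an element of \<mm>^n with one of \<mm> have to be tested, since their
  sums make up \<mm>^(n+1).\<close>

lemma kills_Suc:
  assumes e: "e \<in> carrier E" and k: "\<And>x. x \<in> \<mm> \<Longrightarrow> kills n (x \<odot>\<^bsub>E\<^esub> e)"
  shows "kills (Suc n) e"
  unfolding kills_def mpow_Suc
proof
  fix a assume "a \<in> ideal_prod R (mpow n) \<mm>"
  then have "a \<in> carrier R \<and> a \<odot>\<^bsub>E\<^esub> e = \<zero>\<^bsub>E\<^esub>"
  proof (induction a rule: ideal_prod.induct)
    case (prod i j)
    then show ?case using k[OF prod(2)] e mpow_in_R m_in_R by (simp add: kills_def E.smult_assoc1)
  next
    case (sum a b)
    then show ?case using e by (simp add: E.smult_l_distr)
  qed
  then show "a \<odot>\<^bsub>E\<^esub> e = \<zero>\<^bsub>E\<^esub>" by simp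
qed

lemma kills_mono: "\<lbrakk>kills n e; n \<le> k\<rbrakk> \<Longrightarrow> kills k e"
  using mpow_mono unfolding kills_def by blast

lemma kills_smult: "\<lbrakk>kills n e; e \<in> carrier E; r \<in> carrier R\<rbrakk> \<Longrightarrow> kills n (r \<odot>\<^bsub>E\<^esub> e)"
  unfolding kills_def using mpow_in_R ideal.I_r_closed[OF mpow_ideal] by (simp flip: E.smult_assoc1)

lemma kills_add: "\<lbrakk>kills n e; kills n e'; e \<in> carrier E; e' \<in> carrier E\<rbrakk> \<Longrightarrow> kills n (e \<oplus>\<^bsub>E\<^esub> e')"
  unfolding kills_def using mpow_in_R by (simp add: E.smult_r_distr)

lemma ideal_annihilator: "e \<in> carrier E \<Longrightarrow> ideal {a \<in> carrier R. a \<odot>\<^bsub>E\<^esub> e = \<zero>\<^bsub>E\<^esub>} R"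
  by (rule cring_idealI) (auto simp: E.smult_l_distr E.smult_assoc1)

text \<open>The exponent may depend on x. It becomes uniform because \<mm> is finitely generated:
  the largest exponent N over the generators works for all of \<mm>, as the x for which \<mm>^N
  kills x e form an ideal.\<close>

lemma kills_Suc_exists:
  assumes e: "e \<in> carrier E" and k: "\<And>x. x \<in> \<mm> \<Longrightarrow> \<exists>n. kills n (x \<odot>\<^bsub>E\<^esub> e)"
  shows "\<exists>n. kills n e"
proof -
  obtain A where A: "A \<subseteq> carrier R" "finite A" "\<mm> = Idl A"
    using finetely_gen[OF ideal_m] by blast
  have Am: "A \<subseteq> \<mm>" using genideal_self[OF A(1)] A(3) by simp
  obtain n where n: "\<And>x. x \<in> A \<Longrightarrow> kills (n x) (x \<odot>\<^bsub>E\<^esub> e)"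
    using k Am by (metis subsetD)
  obtain N where N: "\<And>x. x \<in> A \<Longrightarrow> n x \<le> N"
    using A(2) by (meson finite_imageI finite_nat_set_iff_bounded_le image_eqI)
  have "ideal {x \<in> carrier R. kills N (x \<odot>\<^bsub>E\<^esub> e)} R"
    using e by (intro cring_idealI)
      (auto simp: E.smult_l_distr E.smult_assoc1 kills_add kills_smult, auto simp: kills_def mpow_in_R)
  moreover have "A \<subseteq> {x \<in> carrier R. kills N (x \<odot>\<^bsub>E\<^esub> e)}"
    using n N kills_mono A(1) by blast
  ultimately have "\<mm> \<subseteq> {x \<in> carrier R. kills N (x \<odot>\<^bsub>E\<^esub> e)}"
    using genideal_minimal A(3) by blast
  then have "kills (Suc N) e" using e by (intro kills_Suc) auto
  then show ?thesis by blast
qed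

text \<open>Take \<open>e'\<close> among the non-torsion multiples of \<open>e\<close> with maximal annihilator, and \<open>x \<in> \<mm>\<close>
  with \<open>x e'\<close> not torsion. By maximality \<open>x e'\<close> has the same annihilator as \<open>e'\<close>. But some multiple
  \<open>r x e'\<close> is the socle element \<open>s\<close>, and \<open>x\<close> kills \<open>s\<close>.\<close>

lemma torsion:
  assumes e: "e \<in> carrier E"
  shows "\<exists>n. kills n e"
proof (rule ccontr)
  assume nt: "\<nexists>n. kills n e"
  let ?ann = "\<lambda>e. {a \<in> carrier R. a \<odot>\<^bsub>E\<^esub> e = \<zero>\<^bsub>E\<^esub>}"
  let ?A = "{?ann (r \<odot>\<^bsub>E\<^esub> e) | r. r \<in> carrier R \<and> (\<nexists>n. kills n (r \<odot>\<^bsub>E\<^esub> e))}"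
  have "?ann (\<one> \<odot>\<^bsub>E\<^esub> e) \<in> ?A" using nt e by (intro CollectI exI[of _ \<one>]) simp
  then have "?A \<noteq> {}" by blast
  moreover have "ideal I R" if "I \<in> ?A" for I using that e ideal_annihilator by auto
  ultimately have "\<exists>I\<in>?A. \<forall>J\<in>?A. I \<subseteq> J \<longrightarrow> J = I" by (rule exists_maximal_in)
  then obtain I where I: "I \<in> ?A" "\<forall>J\<in>?A. I \<subseteq> J \<longrightarrow> J = I"
    by (rule bexE)
  from I(1) obtain r where r: "r \<in> carrier R" "\<nexists>n. kills n (r \<odot>\<^bsub>E\<^esub> e)" "I = ?ann (r \<odot>\<^bsub>E\<^esub> e)" by blast
  let ?e = "r \<odot>\<^bsub>E\<^esub> e"
  have e': "?e \<in> carrier E" using r e by simp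
  obtain x where x: "x \<in> \<mm>" "\<nexists>n. kills n (x \<odot>\<^bsub>E\<^esub> ?e)"
    using kills_Suc_exists[OF e'] r(2) by blast
  note xR = m_in_R[OF x(1)]
  have xe: "x \<odot>\<^bsub>E\<^esub> ?e = (x \<otimes> r) \<odot>\<^bsub>E\<^esub> e" using xR r e by (simp add: E.smult_assoc1)
  have "?ann (x \<odot>\<^bsub>E\<^esub> ?e) \<in> ?A" using x xe xR r(1) by auto
  moreover have "I \<subseteq> ?ann (x \<odot>\<^bsub>E\<^esub> ?e)"
  proof
    fix a assume "a \<in> I"
    then have a: "a \<in> carrier R" "a \<odot>\<^bsub>E\<^esub> ?e = \<zero>\<^bsub>E\<^esub>" using r(3) by auto
    have "a \<odot>\<^bsub>E\<^esub> (x \<odot>\<^bsub>E\<^esub> ?e) = x \<odot>\<^bsub>E\<^esub> (a \<odot>\<^bsub>E\<^esub> ?e)"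
      using a(1) xR e' m_comm[of a x] by (metis E.smult_assoc1)
    then show "a \<in> ?ann (x \<odot>\<^bsub>E\<^esub> ?e)" using a xR by simp
  qed
  ultimately have ann: "?ann (x \<odot>\<^bsub>E\<^esub> ?e) = ?ann ?e" using I(2) r(3) by simp
  have "x \<odot>\<^bsub>E\<^esub> ?e \<noteq> \<zero>\<^bsub>E\<^esub>"
  proof
    assume "x \<odot>\<^bsub>E\<^esub> ?e = \<zero>\<^bsub>E\<^esub>"
    then have "kills 0 (x \<odot>\<^bsub>E\<^esub> ?e)" by (simp add: kills_def mpow_0)
    then show False using x(2) by blast
  qed
  then obtain t where t: "t \<in> carrier R" "t \<odot>\<^bsub>E\<^esub> (x \<odot>\<^bsub>E\<^esub> ?e) = s"
    using essential e' xR by blast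
  \<comment> \<open>Thus t x annihilates x e', hence also e', because the two annihilators agree;
    but (t x) e' is the nonzero element s.\<close>
  have "(t \<otimes> x) \<odot>\<^bsub>E\<^esub> (x \<odot>\<^bsub>E\<^esub> ?e) = x \<odot>\<^bsub>E\<^esub> s"
    using t xR e' m_comm[of t x] by (metis E.smult_assoc1 E.smult_closed)
  then have "t \<otimes> x \<in> ?ann (x \<odot>\<^bsub>E\<^esub> ?e)" using s_socle[OF x(1)] t xR by simp
  then have "(t \<otimes> x) \<odot>\<^bsub>E\<^esub> ?e = \<zero>\<^bsub>E\<^esub>" using ann by blast
  then show False using t xR e' s_nonzero by (simp add: E.smult_assoc1)
qed

end


section \<open>Extension of homomorphisms\<close>

lemma (in module) submodule_finsum:
  assumes "submodule N R M" "finite A" "\<And>i. i \<in> A \<Longrightarrow> f i \<in> N"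
  shows "(\<Oplus>\<^bsub>M\<^esub>i\<in>A. f i) \<in> N"
  using assms(2,3)
proof (induction A rule: finite_induct)
  case empty
  then show ?case using submoduleE(2,3,5)[OF assms(1)] submoduleE(1)[OF assms(1)]
    by (metis M.finsum_empty M.r_neg ex_in_conv subsetD)
next
  case (insert i A)
  then show ?case using submoduleE(1,5)[OF assms(1)]
    by (subst M.finsum_insert) auto
qed

locale matlis_module = matlis R \<mm> E K s + W: module R W
  for R :: "('a, 'r) ring_scheme" (structure) and \<mm> and E :: "('a, 'e, 's) module_scheme" and K s
    and W :: "('a, 'w, 't) module_scheme"
begin

text \<open>The extension lives on N + R w and sends n + r w to f n + g r. Two representations of an
  element differ by some d with d w in N, where g d = f (d w) by \<open>fg\<close>, so the value is
  well defined. The map g is left open because it comes from Baer's criterion in one application and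
  is r \<mapsto> r s in the other.\<close>

lemma extend_by_element:
  assumes N: "submodule N R W" and f: "f \<in> mod_hom R (W\<lparr>carrier := N\<rparr>) E" and w: "w \<in> carrier W"
    and g: "g \<in> mod_hom R (regular_module R) E"
    and fg: "\<And>r. \<lbrakk>r \<in> carrier R; r \<odot>\<^bsub>W\<^esub> w \<in> N\<rbrakk> \<Longrightarrow> g r = f (r \<odot>\<^bsub>W\<^esub> w)"
  obtains N' f' where "submodule N' R W" "N \<subseteq> N'" "w \<in> N'" "f' \<in> mod_hom R (W\<lparr>carrier := N'\<rparr>) E"
    "\<And>x. x \<in> N \<Longrightarrow> f' x = f x" "f' w = g \<one>"
proof -
  note NE = W.submoduleE[OF N]
  have NW: "n \<in> carrier W" if "n \<in> N" for n using that NE(1) by blast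
  have N0: "\<zero>\<^bsub>W\<^esub> \<in> N" using NE(2,3,5) NW by (metis W.M.r_neg ex_in_conv)
  have fc: "f n \<in> carrier E" and fs: "r \<in> carrier R \<Longrightarrow> f (r \<odot>\<^bsub>W\<^esub> n) = r \<odot>\<^bsub>E\<^esub> f n" if "n \<in> N" for n r
    using mod_homD[OF f] that by auto
  have fa: "f (n \<oplus>\<^bsub>W\<^esub> n') = f n \<oplus>\<^bsub>E\<^esub> f n'" if "n \<in> N" "n' \<in> N" for n n'
    using mod_homD[OF f] that by auto
  have gc: "g r \<in> carrier E" if "r \<in> carrier R" for r
    using mod_hom_closed[OF g] that by simp
  have ga: "g (r \<oplus> r') = g r \<oplus>\<^bsub>E\<^esub> g r'" "g (r \<otimes> r') = r \<odot>\<^bsub>E\<^esub> g r'"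
    if "r \<in> carrier R" "r' \<in> carrier R" for r r'
    using mod_hom_add[OF g] mod_hom_smult[OF g] that by simp_all
  define N' where "N' = {n \<oplus>\<^bsub>W\<^esub> r \<odot>\<^bsub>W\<^esub> w | n r. n \<in> N \<and> r \<in> carrier R}"
  have sum: "(n \<oplus>\<^bsub>W\<^esub> r \<odot>\<^bsub>W\<^esub> w) \<oplus>\<^bsub>W\<^esub> (n' \<oplus>\<^bsub>W\<^esub> r' \<odot>\<^bsub>W\<^esub> w) = (n \<oplus>\<^bsub>W\<^esub> n') \<oplus>\<^bsub>W\<^esub> (r \<oplus> r') \<odot>\<^bsub>W\<^esub> w"
    if "n \<in> N" "n' \<in> N" "r \<in> carrier R" "r' \<in> carrier R" for n n' r r'
    using that w NW by (simp add: W.smult_l_distr W.M.a_ac)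
  have smult: "a \<odot>\<^bsub>W\<^esub> (n \<oplus>\<^bsub>W\<^esub> r \<odot>\<^bsub>W\<^esub> w) = a \<odot>\<^bsub>W\<^esub> n \<oplus>\<^bsub>W\<^esub> (a \<otimes> r) \<odot>\<^bsub>W\<^esub> w"
    if "n \<in> N" "r \<in> carrier R" "a \<in> carrier R" for n r a
    using that w NW by (simp add: W.smult_r_distr W.smult_assoc1)
  have N'W: "N' \<subseteq> carrier W" using w NW by (auto simp: N'_def)
  have N'add: "x \<oplus>\<^bsub>W\<^esub> y \<in> N'" if "x \<in> N'" "y \<in> N'" for x y
  proof -
    obtain n r n' r' where "n \<in> N" "r \<in> carrier R" "x = n \<oplus>\<^bsub>W\<^esub> r \<odot>\<^bsub>W\<^esub> w"
      "n' \<in> N" "r' \<in> carrier R" "y = n' \<oplus>\<^bsub>W\<^esub> r' \<odot>\<^bsub>W\<^esub> w"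
      using \<open>x \<in> N'\<close> \<open>y \<in> N'\<close> unfolding N'_def by blast
    then show ?thesis using sum[of n n' r r'] NE(5)[of n n'] a_closed[of r r']
      unfolding N'_def by blast
  qed
  have N'smult: "a \<odot>\<^bsub>W\<^esub> x \<in> N'" if "a \<in> carrier R" "x \<in> N'" for a x
  proof -
    obtain n r where "n \<in> N" "r \<in> carrier R" "x = n \<oplus>\<^bsub>W\<^esub> r \<odot>\<^bsub>W\<^esub> w"
      using \<open>x \<in> N'\<close> unfolding N'_def by blast
    then show ?thesis using smult[of n r a] NE(4)[of a n] m_closed[of a r] \<open>a \<in> carrier R\<close>
      unfolding N'_def by blast
  qed
  have NN': "n \<in> N'" if "n \<in> N" for n
    using that w NW[OF that] unfolding N'_def by (intro CollectI exI[of _ n] exI[of _ \<zero>]) simp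
  have wN': "w \<in> N'"
    using w N0 unfolding N'_def by (intro CollectI exI[of _ "\<zero>\<^bsub>W\<^esub>"] exI[of _ \<one>]) simp
  have "submodule N' R W"
  proof (rule W.submoduleI[OF N'W NN'[OF N0] _ N'add N'smult])
    fix x assume x: "x \<in> N'"
    then have "x \<in> carrier W" using N'W by blast
    then show "\<ominus>\<^bsub>W\<^esub> x \<in> N'" using N'smult[of "\<ominus> \<one>" x] x by (simp add: W.smult_l_minus)
  qed
  have unique: "f n \<oplus>\<^bsub>E\<^esub> g r = f n' \<oplus>\<^bsub>E\<^esub> g r'"
    if n: "n \<in> N" "n' \<in> N" and r: "r \<in> carrier R" "r' \<in> carrier R"
      and e: "n \<oplus>\<^bsub>W\<^esub> r \<odot>\<^bsub>W\<^esub> w = n' \<oplus>\<^bsub>W\<^esub> r' \<odot>\<^bsub>W\<^esub> w" for n n' r r'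
  proof -
    define d where "d = r \<oplus> \<ominus> r'"
    have d: "d \<in> carrier R" "r = d \<oplus> r'" using r by (simp_all add: d_def a_assoc l_neg)
    have "n \<oplus>\<^bsub>W\<^esub> d \<odot>\<^bsub>W\<^esub> w \<oplus>\<^bsub>W\<^esub> r' \<odot>\<^bsub>W\<^esub> w = n' \<oplus>\<^bsub>W\<^esub> r' \<odot>\<^bsub>W\<^esub> w"
      using e n d r w NW by (simp add: W.smult_l_distr W.M.a_assoc)
    then have n': "n \<oplus>\<^bsub>W\<^esub> d \<odot>\<^bsub>W\<^esub> w = n'"
      using n d r w NW by simp
    then have "d \<odot>\<^bsub>W\<^esub> w = \<ominus>\<^bsub>W\<^esub> n \<oplus>\<^bsub>W\<^esub> n'"
      using n d w NW by (auto simp: W.M.r_neg1)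
    then have dN: "d \<odot>\<^bsub>W\<^esub> w \<in> N" using NE(3,5) n by simp
    have "f n' = f n \<oplus>\<^bsub>E\<^esub> g d" using fa[OF n(1) dN] fg[OF d(1) dN] n' by simp
    then show ?thesis using d r n fc gc by (simp add: ga E.M.a_assoc)
  qed
  define f' where "f' = (\<lambda>x. THE e. \<exists>n\<in>N. \<exists>r\<in>carrier R. x = n \<oplus>\<^bsub>W\<^esub> r \<odot>\<^bsub>W\<^esub> w \<and> e = f n \<oplus>\<^bsub>E\<^esub> g r)"
  have f': "f' (n \<oplus>\<^bsub>W\<^esub> r \<odot>\<^bsub>W\<^esub> w) = f n \<oplus>\<^bsub>E\<^esub> g r" if "n \<in> N" "r \<in> carrier R" for n r
    unfolding f'_def
  proof (rule the_equality)
    show "\<exists>n'\<in>N. \<exists>r'\<in>carrier R. n \<oplus>\<^bsub>W\<^esub> r \<odot>\<^bsub>W\<^esub> w = n' \<oplus>\<^bsub>W\<^esub> r' \<odot>\<^bsub>W\<^esub> w \<and> f n \<oplus>\<^bsub>E\<^esub> g r = f n' \<oplus>\<^bsub>E\<^esub> g r'"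
      using that by blast
    fix e assume "\<exists>n'\<in>N. \<exists>r'\<in>carrier R. n \<oplus>\<^bsub>W\<^esub> r \<odot>\<^bsub>W\<^esub> w = n' \<oplus>\<^bsub>W\<^esub> r' \<odot>\<^bsub>W\<^esub> w \<and> e = f n' \<oplus>\<^bsub>E\<^esub> g r'"
    then obtain n' r' where "n' \<in> N" "r' \<in> carrier R" "n \<oplus>\<^bsub>W\<^esub> r \<odot>\<^bsub>W\<^esub> w = n' \<oplus>\<^bsub>W\<^esub> r' \<odot>\<^bsub>W\<^esub> w"
      "e = f n' \<oplus>\<^bsub>E\<^esub> g r'" by blast
    then show "e = f n \<oplus>\<^bsub>E\<^esub> g r" using unique[OF that(1) _ that(2)] by simp
  qed
  have f'hom: "f' \<in> mod_hom R (W\<lparr>carrier := N'\<rparr>) E"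
  proof (rule mod_homI; simp)
    fix x assume "x \<in> N'"
    then obtain n r where x: "n \<in> N" "r \<in> carrier R" "x = n \<oplus>\<^bsub>W\<^esub> r \<odot>\<^bsub>W\<^esub> w" unfolding N'_def by blast
    show "f' x \<in> carrier E" using x fc gc by (simp add: f')
    show "f' (a \<odot>\<^bsub>W\<^esub> x) = a \<odot>\<^bsub>E\<^esub> f' x" if a: "a \<in> carrier R" for a
      using x a fc gc NE(4) by (simp add: f' smult fs ga E.smult_r_distr)
    fix y assume "y \<in> N'"
    then obtain n' r' where y: "n' \<in> N" "r' \<in> carrier R" "y = n' \<oplus>\<^bsub>W\<^esub> r' \<odot>\<^bsub>W\<^esub> w" unfolding N'_def by blast
    show "f' (x \<oplus>\<^bsub>W\<^esub> y) = f' x \<oplus>\<^bsub>E\<^esub> f' y"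
      using x y fc gc NE(5) by (simp add: f' sum fa ga E.M.a_ac)
  qed
  have g0: "g \<zero> = \<zero>\<^bsub>E\<^esub>" using ga(2)[of \<zero> \<zero>] gc[of \<zero>] by simp
  have f0: "f \<zero>\<^bsub>W\<^esub> = \<zero>\<^bsub>E\<^esub>" using fs[OF N0, of \<zero>] fc[OF N0] by simp
  have "f' n = f n" if "n \<in> N" for n
    using f'[OF that, of \<zero>] NW[OF that] w fc[OF that] g0 by simp
  moreover have "f' w = g \<one>"
    using f'[OF N0, of \<one>] w gc[of \<one>] f0 by simp
  ultimately show ?thesis
    using that[of N' f'] \<open>submodule N' R W\<close> NN' wN' f'hom by blast
qed

text \<open>Adding one generator at a time avoids a second transfinite argument. For a generator w
  the elements r with r w in the current submodule form an ideal, and r \<mapsto> h (r w) extends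
  from this ideal to R by \<open>ideal_extension\<close>.\<close>

lemma extend_finite:
  assumes "finite G" "G \<subseteq> carrier W" "submodule N R W" "f \<in> mod_hom R (W\<lparr>carrier := N\<rparr>) E"
  shows "\<exists>N' f'. submodule N' R W \<and> N \<subseteq> N' \<and> G \<subseteq> N' \<and> f' \<in> mod_hom R (W\<lparr>carrier := N'\<rparr>) E \<and>
    (\<forall>x\<in>N. f' x = f x)"
  using assms(1,2)
proof (induction G rule: finite_induct)
  case empty
  then show ?case using assms(3,4) by blast
next
  case (insert w G)
  then obtain P h where P: "submodule P R W" "N \<subseteq> P" "G \<subseteq> P" "h \<in> mod_hom R (W\<lparr>carrier := P\<rparr>) E"
    "\<And>x. x \<in> N \<Longrightarrow> h x = f x" by auto
  have w: "w \<in> carrier W" using insert.prems by simp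
  note PE = W.submoduleE[OF P(1)]
  let ?I = "{r \<in> carrier R. r \<odot>\<^bsub>W\<^esub> w \<in> P}"
  have P0: "\<zero>\<^bsub>W\<^esub> \<in> P" using W.submodule_finsum[OF P(1), of "{}"] by simp
  have I: "ideal ?I R"
    by (rule cring_idealI) (use w P0 PE in \<open>auto simp: W.smult_l_distr W.smult_assoc1\<close>)
  have "(\<lambda>r. h (r \<odot>\<^bsub>W\<^esub> w)) \<in> mod_hom R ((regular_module R)\<lparr>carrier := ?I\<rparr>) E"
    using mod_homD[OF P(4)] w
    by (intro mod_homI) (auto simp: regular_module_def W.smult_l_distr W.smult_assoc1)
  then obtain g where g: "g \<in> mod_hom R (regular_module R) E"
    "\<And>r. r \<in> ?I \<Longrightarrow> g r = h (r \<odot>\<^bsub>W\<^esub> w)"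
    using ideal_extension[OF I] by blast
  have gh: "g r = h (r \<odot>\<^bsub>W\<^esub> w)" if "r \<in> carrier R" "r \<odot>\<^bsub>W\<^esub> w \<in> P" for r
    using g(2) that by simp
  obtain N' f' where N': "submodule N' R W" "P \<subseteq> N'" "w \<in> N'" "f' \<in> mod_hom R (W\<lparr>carrier := N'\<rparr>) E"
    "\<And>x. x \<in> P \<Longrightarrow> f' x = h x"
    using extend_by_element[OF P(1,4) w g(1) gh] by metis
  have "\<forall>x\<in>N. f' x = f x" using N'(5) P(2,5) by auto
  then show ?case using N' P(2,3) by (intro exI[of _ N'] exI[of _ f']) auto
qed

text \<open>The annihilator of a nonzero w contains no unit, so it lies in \<mm>, which kills s.
  Hence r w \<mapsto> r s is well defined on R w, and it extends to W through the finitely many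
  generators.\<close>

lemma separating_hom:
  assumes fg: "finitely_generated R W" and w: "w \<in> carrier W" "w \<noteq> \<zero>\<^bsub>W\<^esub>"
  shows "\<exists>\<phi>\<in>mod_hom R W E. \<phi> w = s"
proof -
  obtain G where G: "finite G" "G \<subseteq> carrier W" "\<And>N. \<lbrakk>submodule N R W; G \<subseteq> N\<rbrakk> \<Longrightarrow> N = carrier W"
    using fg unfolding finitely_generated_def by blast
  have Z: "submodule {\<zero>\<^bsub>W\<^esub>} R W"
    by (rule W.submoduleI) auto
  have f: "(\<lambda>_. \<zero>\<^bsub>E\<^esub>) \<in> mod_hom R (W\<lparr>carrier := {\<zero>\<^bsub>W\<^esub>}\<rparr>) E"
    by (rule mod_homI) auto
  have g: "(\<lambda>r. r \<odot>\<^bsub>E\<^esub> s) \<in> mod_hom R (regular_module R) E"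
    by (rule mod_homI) (simp_all add: s_closed E.smult_l_distr E.smult_assoc1)
  have ann: "r \<odot>\<^bsub>E\<^esub> s = \<zero>\<^bsub>E\<^esub>" if r: "r \<in> carrier R" "r \<odot>\<^bsub>W\<^esub> w \<in> {\<zero>\<^bsub>W\<^esub>}" for r
  proof (rule s_socle, rule ccontr)
    assume "r \<notin> \<mm>"
    then obtain b where b: "b \<in> carrier R" "b \<otimes> r = \<one>" using unit_if_not_in_maximal[OF r(1)] by blast
    have "w = b \<odot>\<^bsub>W\<^esub> (r \<odot>\<^bsub>W\<^esub> w)" using b r(1) w(1) by (simp flip: W.smult_assoc1)
    then show False using r b w by simp
  qed
  obtain N1 f1 where 1: "submodule N1 R W" "w \<in> N1" "f1 \<in> mod_hom R (W\<lparr>carrier := N1\<rparr>) E"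
    "f1 w = \<one> \<odot>\<^bsub>E\<^esub> s"
    using extend_by_element[OF Z f w(1) g ann] by metis
  obtain N2 f2 where 2: "submodule N2 R W" "G \<subseteq> N2" "f2 \<in> mod_hom R (W\<lparr>carrier := N2\<rparr>) E"
    "\<And>x. x \<in> N1 \<Longrightarrow> f2 x = f1 x"
    using extend_finite[OF G(1,2) 1(1,3)] by blast
  have "f2 \<in> mod_hom R W E" using 2(3) G(3)[OF 2(1,2)] by (simp add: mod_hom_def)
  moreover have "f2 w = s" using 2(4)[OF 1(2)] 1(4) s_closed by simp
  ultimately show ?thesis by blast
qed

end


section \<open>Matlis duality\<close>

locale matlis_dual = matlis_module R \<mm> E K s W
  for R :: "('a, 'r) ring_scheme" (structure) and \<mm> and E :: "('a, 'e, 's) module_scheme" and K s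
    and W :: "('a, 'w, 't) module_scheme" +
  fixes \<tau> G
  assumes \<tau>: "K_linear R K E (carrier E) \<tau>" and \<tau>_s: "\<tau> s = \<one>"
    and G: "finite G" "G \<subseteq> carrier W" "\<lbrakk>submodule N R W; G \<subseteq> N\<rbrakk> \<Longrightarrow> N = carrier W"
begin

sublocale WE: module_pair R W E
  by (intro module_pair.intro W.module_axioms E.module_axioms)

abbreviation H where "H \<equiv> Hom_module R W E"

sublocale H: field_module R H K
  by (intro field_module.intro field_module_axioms.intro WE.module_Hom_module E.K_subfield)

lemma gen: "g \<in> G \<Longrightarrow> g \<in> carrier W"
  using G(2) by blast

lemma H_hom: "\<phi> \<in> carrier H \<Longrightarrow> \<phi> \<in> mod_hom R W E"
  by (simp add: Hom_module_simps)

lemmas H_closed = mod_hom_closed[OF H_hom]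
  and H_add = mod_hom_add[OF H_hom]
  and H_smult = mod_hom_smult[OF H_hom]

lemma \<tau>_in_R: "e \<in> carrier E \<Longrightarrow> \<tau> e \<in> carrier R"
  using K_linear_mem[OF \<tau>] E.K_in_R by blast

lemma \<tau>_zero: "\<tau> \<zero>\<^bsub>E\<^esub> = \<zero>"
  using K_linear_smult[OF \<tau> E.K_closed(2), of "\<zero>\<^bsub>E\<^esub>"] \<tau>_in_R by simp

lemma pairing_additive: "\<phi> \<in> carrier H \<Longrightarrow> additive_map W R (\<lambda>w. \<tau> (\<phi> w))"
  by (intro additive_mapI) (simp_all add: H_closed \<tau>_in_R H_add K_linear_add[OF \<tau>])

text \<open>A homomorphism that sends w to s pairs with w to \<tau> s = 1, which is nonzero in
  K.\<close>

lemma pairing_nondegenerate: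
  assumes w: "w \<in> carrier W" and 0: "\<And>\<phi>. \<phi> \<in> carrier H \<Longrightarrow> \<tau> (\<phi> w) = \<zero>"
  shows "w = \<zero>\<^bsub>W\<^esub>"
proof (rule ccontr)
  assume nz: "w \<noteq> \<zero>\<^bsub>W\<^esub>"
  have "finitely_generated R W" using G unfolding finitely_generated_def by blast
  then obtain \<phi> where "\<phi> \<in> mod_hom R W E" "\<phi> w = s" using separating_hom w nz by blast
  then have "\<one> = \<zero>"
    using 0[OF WE.restrict_Hom_module] w \<tau>_s by force
  then show False using subfieldE(6)[OF E.K_subfield] by simp
qed

text \<open>This is the annihilator of \<mm>^n in H, equivalently the set of maps in H that vanish
  on \<mm>^n W. These subspaces increase with n, and \<open>represent\<close> climbs along
  them.\<close>

definition killed :: "nat \<Rightarrow> ('w \<Rightarrow> 'e) set" where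
  "killed n = {\<phi> \<in> carrier H. \<forall>w\<in>carrier W. kills n (\<phi> w)}"

lemma killed_subspace: "H.subspace (killed n)"
proof -
  have "kills n \<zero>\<^bsub>E\<^esub>" by (simp add: kills_def mpow_in_R)
  then show ?thesis unfolding H.subspace_def killed_def
    using H.zero_closed H.M.a_closed H.smult_closed
    by (auto simp: E.K_in_R simp: Hom_module_simps(2-4) kills_add kills_smult H_closed)
qed

text \<open>The elements w for which I annihilates \<phi> w form a submodule, and this submodule
  contains the generators.\<close>

lemma vanish_on_generators:
  assumes \<phi>: "\<phi> \<in> carrier H" and I: "ideal I R"
    and 0: "\<And>a g. \<lbrakk>a \<in> I; g \<in> G\<rbrakk> \<Longrightarrow> a \<odot>\<^bsub>E\<^esub> \<phi> g = \<zero>\<^bsub>E\<^esub>"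
    and w: "w \<in> carrier W" and a: "a \<in> I"
  shows "a \<odot>\<^bsub>E\<^esub> \<phi> w = \<zero>\<^bsub>E\<^esub>"
proof -
  have IR: "a \<in> carrier R" if "a \<in> I" for a using ideal.Icarr[OF I that] .
  let ?N = "{w \<in> carrier W. \<forall>a\<in>I. a \<odot>\<^bsub>E\<^esub> \<phi> w = \<zero>\<^bsub>E\<^esub>}"
  have "\<phi> \<zero>\<^bsub>W\<^esub> = \<zero>\<^bsub>E\<^esub>"
    using additive_map_zero[OF W.abelian_group_axioms E.abelian_group_axioms mod_hom_additive[OF H_hom[OF \<phi>]]] .
  moreover have "\<phi> (\<ominus>\<^bsub>W\<^esub> x) = \<ominus>\<^bsub>E\<^esub> \<phi> x" if "x \<in> carrier W" for x
    using additive_map_minus[OF W.abelian_group_axioms E.abelian_group_axioms mod_hom_additive[OF H_hom[OF \<phi>]] that] .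
  moreover have "a \<odot>\<^bsub>E\<^esub> (b \<odot>\<^bsub>E\<^esub> \<phi> x) = \<zero>\<^bsub>E\<^esub>" if "b \<in> carrier R" "x \<in> ?N" "a \<in> I" for a b x
    using that H_closed[OF \<phi>, of x] IR[OF that(3)] ideal.I_r_closed[OF I that(3,1)] E.smult_assoc1[of a b "\<phi> x"]
    by force
  ultimately have "submodule ?N R W"
    using IR H_closed[OF \<phi>]
    by (intro W.submoduleI)
      (auto simp: H_add[OF \<phi>] H_smult[OF \<phi>] E.smult_r_distr E.smult_r_minus)
  then have "?N = carrier W" using G(3) 0 gen by blast
  then show ?thesis using w a by blast
qed

text \<open>Torsion in E bounds the exponent on each generator separately; the maximum over the
  finite set G then serves for all of W.\<close>

lemma killed_exhausts:
  assumes \<phi>: "\<phi> \<in> carrier H"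
  shows "\<exists>n. \<phi> \<in> killed n"
proof -
  obtain n where n: "\<And>g. g \<in> G \<Longrightarrow> kills (n g) (\<phi> g)"
    using torsion[OF H_closed[OF \<phi> gen]] by metis
  obtain N where "\<And>g. g \<in> G \<Longrightarrow> n g \<le> N"
    using G(1) by (meson finite_imageI finite_nat_set_iff_bounded_le image_eqI)
  then have "kills N (\<phi> g)" if "g \<in> G" for g using n kills_mono that by blast
  then have "kills N (\<phi> w)" if "w \<in> carrier W" for w
    using vanish_on_generators[OF \<phi> mpow_ideal[of N] _ that] by (simp add: kills_def)
  then show ?thesis using \<phi> by (auto simp: killed_def)
qed

text \<open>Completeness provides limits in R, so elements of W are approximated through coefficient
  vectors on G. Such a vector need not be unique, and only congruences between chosen vectors are
  ever compared.\<close>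

definition comb :: "('w \<Rightarrow> 'a) \<Rightarrow> 'w" where
  "comb \<rho> = (\<Oplus>\<^bsub>W\<^esub>g\<in>G. \<rho> g \<odot>\<^bsub>W\<^esub> g)"

lemma comb_closed: "\<rho> \<in> G \<rightarrow> carrier R \<Longrightarrow> comb \<rho> \<in> carrier W"
  unfolding comb_def using gen by (intro W.M.finsum_closed) auto

lemma comb_cong: "\<lbrakk>\<And>g. g \<in> G \<Longrightarrow> \<rho> g = \<sigma> g; \<sigma> \<in> G \<rightarrow> carrier R\<rbrakk> \<Longrightarrow> comb \<rho> = comb \<sigma>"
  unfolding comb_def using gen by (intro W.M.finsum_cong') auto

lemma comb_add:
  assumes "\<rho> \<in> G \<rightarrow> carrier R" "\<sigma> \<in> G \<rightarrow> carrier R"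
  shows "comb (\<lambda>g. \<rho> g \<oplus> \<sigma> g) = comb \<rho> \<oplus>\<^bsub>W\<^esub> comb \<sigma>"
proof -
  have "comb (\<lambda>g. \<rho> g \<oplus> \<sigma> g) = (\<Oplus>\<^bsub>W\<^esub>g\<in>G. \<rho> g \<odot>\<^bsub>W\<^esub> g \<oplus>\<^bsub>W\<^esub> \<sigma> g \<odot>\<^bsub>W\<^esub> g)"
    unfolding comb_def using assms gen by (intro W.M.finsum_cong') (auto simp: W.smult_l_distr Pi_iff)
  also have "\<dots> = comb \<rho> \<oplus>\<^bsub>W\<^esub> comb \<sigma>"
    unfolding comb_def using assms gen by (intro W.M.finsum_addf) auto
  finally show ?thesis .
qed

lemma comb_smult:
  assumes "\<rho> \<in> G \<rightarrow> carrier R" "r \<in> carrier R"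
  shows "r \<odot>\<^bsub>W\<^esub> comb \<rho> = comb (\<lambda>g. r \<otimes> \<rho> g)"
proof -
  have "r \<odot>\<^bsub>W\<^esub> comb \<rho> = (\<Oplus>\<^bsub>W\<^esub>g\<in>G. r \<odot>\<^bsub>W\<^esub> (\<rho> g \<odot>\<^bsub>W\<^esub> g))"
    unfolding comb_def using assms gen G(1) by (intro W.finsum_smult_ldistr) auto
  also have "\<dots> = comb (\<lambda>g. r \<otimes> \<rho> g)"
    unfolding comb_def using assms gen by (intro W.M.finsum_cong') (auto simp: W.smult_assoc1 Pi_iff)
  finally show ?thesis .
qed

text \<open>This is \<mm>^n W, written so that one coefficient in \<mm>^n per generator can be read
  off.\<close>

abbreviation combs where "combs n \<equiv> {comb \<sigma> | \<sigma>. \<sigma> \<in> G \<rightarrow> mpow n}"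

lemma comb_submodule: "submodule (combs n) R W"
proof -
  note I = mpow_ideal[of n]
  have car: "\<sigma> \<in> G \<rightarrow> carrier R" if "\<sigma> \<in> G \<rightarrow> mpow n" for \<sigma> using that mpow_in_R by blast
  have sm: "r \<odot>\<^bsub>W\<^esub> x \<in> combs n"
    if "r \<in> carrier R" "x \<in> combs n" for r x
  proof -
    obtain \<sigma> where \<sigma>: "\<sigma> \<in> G \<rightarrow> mpow n" "x = comb \<sigma>" using \<open>x \<in> _\<close> by blast
    have "(\<lambda>g. r \<otimes> \<sigma> g) \<in> G \<rightarrow> mpow n" using \<sigma>(1) ideal.I_l_closed[OF I _ that(1)] by blast
    then show ?thesis using comb_smult[OF car[OF \<sigma>(1)] that(1)] \<sigma>(2) by blast
  qed
  show ?thesis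
  proof (rule W.submoduleI)
    show sub: "combs n \<subseteq> carrier W" using comb_closed[OF car] by blast
    have "(\<lambda>_. \<zero>) \<in> G \<rightarrow> mpow n"
      using additive_subgroup.zero_closed[OF ideal.axioms(1)[OF I]] by blast
    moreover have "comb (\<lambda>_. \<zero>) = \<zero>\<^bsub>W\<^esub>"
    proof -
      have "comb (\<lambda>_. \<zero>) = (\<Oplus>\<^bsub>W\<^esub>g\<in>G. \<zero>\<^bsub>W\<^esub>)"
        unfolding comb_def using gen by (intro W.M.finsum_cong') auto
      then show ?thesis by (simp add: W.M.finsum_zero)
    qed
    ultimately show "\<zero>\<^bsub>W\<^esub> \<in> combs n" by force
    show "\<ominus>\<^bsub>W\<^esub> x \<in> combs n" if x: "x \<in> combs n" for x
      using sm[OF _ x, of "\<ominus> \<one>"] subsetD[OF sub x] W.smult_l_minus[of \<one> x] by simp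
    show "x \<oplus>\<^bsub>W\<^esub> y \<in> combs n"
      if xy: "x \<in> combs n" "y \<in> combs n" for x y
    proof -
      obtain \<sigma> \<rho> where \<sigma>: "\<sigma> \<in> G \<rightarrow> mpow n" "x = comb \<sigma>" "\<rho> \<in> G \<rightarrow> mpow n" "y = comb \<rho>" using xy by blast
      have "(\<lambda>g. \<sigma> g \<oplus> \<rho> g) \<in> G \<rightarrow> mpow n"
        using \<sigma> additive_subgroup.a_closed[OF ideal.axioms(1)[OF I]] by blast
      then show ?thesis using comb_add[OF car[OF \<sigma>(1)] car[OF \<sigma>(3)]] \<sigma>(2,4)
        by (intro CollectI exI[of _ "\<lambda>g. \<sigma> g \<oplus> \<rho> g"]) simp
    qed
  qed (rule sm)
qed

lemma comb_single:
  assumes "a \<in> mpow n" "g \<in> G"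
  shows "a \<odot>\<^bsub>W\<^esub> g \<in> combs n"
proof -
  let ?\<sigma> = "\<lambda>h. if g = h then a else \<zero>"
  have "comb ?\<sigma> = (\<Oplus>\<^bsub>W\<^esub>h\<in>G. if g = h then a \<odot>\<^bsub>W\<^esub> h else \<zero>\<^bsub>W\<^esub>)"
    unfolding comb_def using assms gen mpow_in_R by (intro W.M.finsum_cong') auto
  also have "\<dots> = a \<odot>\<^bsub>W\<^esub> g"
    using assms gen mpow_in_R G(1) by (intro W.M.add.finprod_singleton) auto
  finally have "a \<odot>\<^bsub>W\<^esub> g = comb ?\<sigma>" by simp
  moreover have "?\<sigma> \<in> G \<rightarrow> mpow n"
    using assms additive_subgroup.zero_closed[OF ideal.axioms(1)[OF mpow_ideal]] by auto
  ultimately show ?thesis by blast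
qed

lemma killed_comb:
  assumes "\<phi> \<in> killed n" "\<sigma> \<in> G \<rightarrow> mpow n"
  shows "\<phi> (comb \<sigma>) = \<zero>\<^bsub>E\<^esub>"
proof -
  have \<phi>: "\<phi> \<in> carrier H" using assms by (simp add: killed_def)
  have \<sigma>: "\<sigma> g \<in> mpow n" "\<sigma> g \<in> carrier R" if "g \<in> G" for g
    using assms(2) mpow_in_R that by blast+
  have "\<phi> (comb \<sigma>) = (\<Oplus>\<^bsub>E\<^esub>g\<in>G. \<phi> (\<sigma> g \<odot>\<^bsub>W\<^esub> g))"
    unfolding comb_def using \<sigma> gen
    by (intro additive_map_finsum[OF W.abelian_group_axioms E.abelian_group_axioms
      mod_hom_additive[OF H_hom[OF \<phi>]] G(1)]) auto
  also have "\<dots> = (\<Oplus>\<^bsub>E\<^esub>g\<in>G. \<zero>\<^bsub>E\<^esub>)"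
    using \<sigma> assms(1) gen by (intro E.M.finsum_cong') (auto simp: H_smult[OF \<phi>] killed_def kills_def)
  finally show ?thesis by (simp add: E.M.finsum_zero)
qed

text \<open>An operator \<open>a \<odot> \<phi> g\<close> with \<open>a \<in> \<mm>\<^sup>n\<close> lands in the socle when \<open>\<phi>\<close> is killed by \<open>\<mm>\<close> to the
  power \<open>n + 1\<close>, and \<open>\<tau>\<close> is injective there. Hence a functional vanishing on \<open>killed n\<close> vanishes on
  the common kernel of the finitely many functionals \<open>\<phi> \<mapsto> \<tau> (a \<odot> \<phi> g)\<close>, with \<open>a\<close> and \<open>g\<close> ranging
  over generators, and is a linear combination of them.\<close>

lemma represent_step:
  assumes l: "K_linear R K H (carrier H) l" and 0: "\<And>\<phi>. \<phi> \<in> killed n \<Longrightarrow> l \<phi> = \<zero>"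
  shows "\<exists>\<sigma>\<in>G \<rightarrow> mpow n. \<forall>\<phi>\<in>killed (Suc n). l \<phi> = \<tau> (\<phi> (comb \<sigma>))"
proof -
  obtain A where A: "A \<subseteq> carrier R" "finite A" "mpow n = Idl A"
    using finetely_gen[OF mpow_ideal] by blast
  have An: "A \<subseteq> mpow n" using genideal_self[OF A(1)] A(3) by simp
  let ?f = "\<lambda>p \<phi>. \<tau> (fst p \<odot>\<^bsub>E\<^esub> \<phi> (snd p))"
  have killed_H: "killed k \<subseteq> carrier H" for k by (auto simp: killed_def)
  have f: "K_linear R K H (carrier H) (?f p)" if "p \<in> A \<times> G" for p
  proof -
    have p: "fst p \<in> carrier R" "snd p \<in> carrier W" using that A(1) gen by auto
    show ?thesis unfolding K_linear_def
    proof (intro conjI ballI)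
      fix \<phi> assume \<phi>: "\<phi> \<in> carrier H"
      show "?f p \<phi> \<in> K" using K_linear_mem[OF \<tau>] p H_closed[OF \<phi>] by simp
      show "?f p (\<phi> \<oplus>\<^bsub>H\<^esub> \<psi>) = ?f p \<phi> \<oplus> ?f p \<psi>" if \<psi>: "\<psi> \<in> carrier H" for \<psi>
        using p H_closed[OF \<phi>] H_closed[OF \<psi>]
        by (simp add: Hom_module_simps(3) E.smult_r_distr K_linear_add[OF \<tau>])
      fix c assume c: "c \<in> K"
      have "fst p \<odot>\<^bsub>E\<^esub> (c \<odot>\<^bsub>E\<^esub> \<phi> (snd p)) = c \<odot>\<^bsub>E\<^esub> (fst p \<odot>\<^bsub>E\<^esub> \<phi> (snd p))"
        using p H_closed[OF \<phi>] E.K_in_R[OF c] m_comm[of c "fst p"] by (metis E.smult_assoc1)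
      then show "?f p (c \<odot>\<^bsub>H\<^esub> \<phi>) = c \<otimes> ?f p \<phi>"
        using p c H_closed[OF \<phi>] by (simp add: Hom_module_simps(4) K_linear_smult[OF \<tau>])
    qed
  qed
  have ker: "l \<phi> = \<zero>" if \<phi>k: "\<phi> \<in> killed (Suc n)" and z: "\<And>p. p \<in> A \<times> G \<Longrightarrow> ?f p \<phi> = \<zero>" for \<phi>
  proof -
    have \<phi>: "\<phi> \<in> carrier H" using \<phi>k killed_H by blast
    have "a \<odot>\<^bsub>E\<^esub> \<phi> g = \<zero>\<^bsub>E\<^esub>" if a: "a \<in> A" and g: "g \<in> G" for a g
    proof -
      have aR: "a \<in> carrier R" using a A(1) by blast
      have e: "\<phi> g \<in> carrier E" using H_closed[OF \<phi> gen[OF g]] .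
      have "x \<odot>\<^bsub>E\<^esub> (a \<odot>\<^bsub>E\<^esub> \<phi> g) = \<zero>\<^bsub>E\<^esub>" if x: "x \<in> \<mm>" for x
      proof -
        have "a \<otimes> x \<in> mpow (Suc n)"
          unfolding mpow_Suc using a An x by (intro ideal_prod.prod) auto
        then have "(a \<otimes> x) \<odot>\<^bsub>E\<^esub> \<phi> g = \<zero>\<^bsub>E\<^esub>" using \<phi>k gen[OF g] by (auto simp: killed_def kills_def)
        then show ?thesis using aR m_in_R[OF x] e m_comm[of a x] by (simp add: E.smult_assoc1)
      qed
      then obtain c where c: "c \<in> K" "a \<odot>\<^bsub>E\<^esub> \<phi> g = c \<odot>\<^bsub>E\<^esub> s"
        using socle[of "a \<odot>\<^bsub>E\<^esub> \<phi> g"] aR e by auto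
      have "\<tau> (a \<odot>\<^bsub>E\<^esub> \<phi> g) = c"
        using c K_linear_smult[OF \<tau> c(1) s_closed] \<tau>_s E.K_in_R by simp
      then have "c = \<zero>" using z[of "(a, g)"] a g by simp
      then show ?thesis using c(2) s_closed by simp
    qed
    then have "A \<subseteq> {a \<in> carrier R. a \<odot>\<^bsub>E\<^esub> \<phi> g = \<zero>\<^bsub>E\<^esub>}" if "g \<in> G" for g using that A(1) by blast
    then have sub: "mpow n \<subseteq> {a \<in> carrier R. a \<odot>\<^bsub>E\<^esub> \<phi> g = \<zero>\<^bsub>E\<^esub>}" if "g \<in> G" for g
      unfolding A(3) using that by (intro genideal_minimal[OF ideal_annihilator[OF H_closed[OF \<phi> gen]]])
    have "a \<odot>\<^bsub>E\<^esub> \<phi> g = \<zero>\<^bsub>E\<^esub>" if "a \<in> mpow n" "g \<in> G" for a g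
      using subsetD[OF sub[OF that(2)] that(1)] by simp
    from vanish_on_generators[OF \<phi> mpow_ideal this]
    have "kills n (\<phi> w)" if "w \<in> carrier W" for w
      using that by (simp add: kills_def)
    then show ?thesis using 0 \<phi> by (simp add: killed_def)
  qed
  have "\<exists>c\<in>A \<times> G \<rightarrow> K. \<forall>\<phi>\<in>killed (Suc n). l \<phi> = (\<Oplus>p\<in>A \<times> G. c p \<otimes> ?f p \<phi>)"
  proof (rule H.K_linear_span[OF _ killed_subspace])
    show "finite (A \<times> G)" using A(2) G(1) by simp
    show "K_linear R K H (killed (Suc n)) (?f p)" if "p \<in> A \<times> G" for p
      by (rule K_linear_subset[OF f[OF that] killed_H])
    show "K_linear R K H (killed (Suc n)) l"
      by (rule K_linear_subset[OF l killed_H])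
  qed (rule ker)
  then obtain c where c: "c \<in> A \<times> G \<rightarrow> K" "\<And>\<phi>. \<phi> \<in> killed (Suc n) \<Longrightarrow> l \<phi> = (\<Oplus>p\<in>A \<times> G. c p \<otimes> ?f p \<phi>)"
    by (elim bexE) simp
  have cR: "c p \<in> carrier R" if "p \<in> A \<times> G" for p using c(1) that E.K_in_R by blast
  have pR: "fst p \<in> carrier R" "snd p \<in> carrier W" if "p \<in> A \<times> G" for p using that A(1) gen by auto
  \<comment> \<open>This element of \<mm>^n W realizes the combination: c \<tau> (a \<phi> g) =
    \<tau> (\<phi> (c a g)), because \<tau> is K-linear and \<phi> is R-linear.\<close>
  let ?w = "\<Oplus>\<^bsub>W\<^esub>p\<in>A \<times> G. (c p \<otimes> fst p) \<odot>\<^bsub>W\<^esub> snd p"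
  have "?w \<in> combs n"
  proof (rule W.submodule_finsum[OF comb_submodule])
    fix p assume p: "p \<in> A \<times> G"
    have "c p \<otimes> fst p \<in> mpow n"
      using p An cR[OF p] by (intro ideal.I_l_closed[OF mpow_ideal]) auto
    then show "(c p \<otimes> fst p) \<odot>\<^bsub>W\<^esub> snd p \<in> combs n"
      using p by (intro comb_single) auto
  qed (use A(2) G(1) in simp)
  then obtain \<sigma> where \<sigma>: "\<sigma> \<in> G \<rightarrow> mpow n" "?w = comb \<sigma>" by blast
  have "l \<phi> = \<tau> (\<phi> (comb \<sigma>))" if "\<phi> \<in> killed (Suc n)" for \<phi>
  proof -
    have \<phi>: "\<phi> \<in> carrier H" using that killed_H by blast
    have "\<tau> (\<phi> ?w) = (\<Oplus>p\<in>A \<times> G. \<tau> (\<phi> ((c p \<otimes> fst p) \<odot>\<^bsub>W\<^esub> snd p)))"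
      using cR pR A(2) G(1)
      by (intro additive_map_finsum[OF W.abelian_group_axioms abelian_group_axioms pairing_additive[OF \<phi>]]) auto
    also have "\<dots> = (\<Oplus>p\<in>A \<times> G. c p \<otimes> ?f p \<phi>)"
    proof (intro finsum_cong' refl)
      show "(\<lambda>p. c p \<otimes> ?f p \<phi>) \<in> A \<times> G \<rightarrow> carrier R"
        using cR pR H_closed[OF \<phi>] \<tau>_in_R by auto
      fix p assume p: "p \<in> A \<times> G"
      have "c p \<in> K" using c(1) p by blast
      then show "\<tau> (\<phi> ((c p \<otimes> fst p) \<odot>\<^bsub>W\<^esub> snd p)) = c p \<otimes> ?f p \<phi>"
        using cR[OF p] pR[OF p] H_closed[OF \<phi>]
        by (simp add: H_smult[OF \<phi>] E.smult_assoc1 K_linear_smult[OF \<tau>])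
    qed
    finally show ?thesis using c(2)[OF that] \<sigma>(2) by simp
  qed
  then show ?thesis using \<sigma>(1) by blast
qed

lemma pairing_K_linear:
  assumes w: "w \<in> carrier W"
  shows "K_linear R K H (carrier H) (\<lambda>\<phi>. \<tau> (\<phi> w))"
  unfolding K_linear_def using w H_closed K_linear_mem[OF \<tau>]
  by (auto simp: Hom_module_simps(3,4) K_linear_add[OF \<tau>] K_linear_smult[OF \<tau>])

text \<open>Successive approximation: if the coefficients \<rho> represent l on
  \<open>killed n\<close>, the error vanishes there, and \<open>represent_step\<close> represents it
  on \<open>killed (Suc n)\<close> by coefficients in \<mm>^n. Adding these corrections gives a
  convergent sequence in R. Its limit differs from stage n by coefficients in \<mm>^n, which maps in
  \<open>killed n\<close> do not see.\<close>

lemma represent: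
  assumes l: "K_linear R K H (carrier H) l"
  shows "\<exists>w\<in>carrier W. \<forall>\<phi>\<in>carrier H. l \<phi> = \<tau> (\<phi> w)"
proof -
  have Hsub: "H.subspace (carrier H)"
    unfolding H.subspace_def by (auto simp: E.K_in_R)
  let ?P = "\<lambda>n \<rho>. \<rho> \<in> G \<rightarrow> carrier R \<and> (\<forall>\<phi>\<in>killed n. l \<phi> = \<tau> (\<phi> (comb \<rho>)))"
  let ?Q = "\<lambda>n \<rho> \<rho>'. \<forall>g\<in>G. \<rho>' g \<ominus> \<rho> g \<in> mpow n"
  have "\<exists>\<rho>. \<forall>n. ?P n (\<rho> n) \<and> ?Q n (\<rho> n) (\<rho> (Suc n))"
  proof (rule dependent_nat_choice)
    have l0: "l \<zero>\<^bsub>H\<^esub> = \<zero>"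
      using K_linear_smult[OF l E.K_closed(2), of "\<zero>\<^bsub>H\<^esub>"] K_linear_mem[OF l, of "\<zero>\<^bsub>H\<^esub>"] E.K_in_R by simp
    \<comment> \<open>The start is free: \<mm>^0 is R, so \<open>killed 0\<close> contains only the
      zero map and zero coefficients represent l there.\<close>
    have "l \<phi> = \<tau> (\<phi> (comb (\<lambda>_. \<zero>)))" if "\<phi> \<in> killed 0" for \<phi>
    proof -
      have \<phi>: "\<phi> \<in> carrier H" using that by (simp add: killed_def)
      have "\<phi> w = \<zero>\<^bsub>E\<^esub>" if "w \<in> carrier W" for w
      proof -
        have "\<one> \<odot>\<^bsub>E\<^esub> \<phi> w = \<zero>\<^bsub>E\<^esub>"
          using \<open>\<phi> \<in> killed 0\<close> that by (simp add: killed_def kills_def mpow_0)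
        then show ?thesis using H_closed[OF \<phi> that] by simp
      qed
      then have "\<phi> = \<zero>\<^bsub>H\<^esub>" "\<phi> (comb (\<lambda>_. \<zero>)) = \<zero>\<^bsub>E\<^esub>"
        using \<phi> comb_closed[of "\<lambda>_. \<zero>"]
        by (auto intro: extensionalityI[of _ "carrier W"] simp: Hom_module_simps)
      then show ?thesis using l0 \<tau>_zero by simp
    qed
    then show "\<exists>\<rho>. ?P 0 \<rho>" by (intro exI[of _ "\<lambda>_. \<zero>"]) auto
  next
    fix \<rho> n assume P: "?P n \<rho>"
    note \<rho>W = comb_closed[OF conjunct1[OF P]]
    let ?l = "\<lambda>\<phi>. l \<phi> \<ominus> \<tau> (\<phi> (comb \<rho>))"
    have cl: "l \<phi> \<in> carrier R" "\<tau> (\<phi> (comb \<rho>)) \<in> carrier R" if "\<phi> \<in> carrier H" for \<phi>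
      using K_linear_mem[OF l that] K_linear_mem[OF pairing_K_linear[OF \<rho>W] that] E.K_in_R by auto
    have "?l \<phi> = \<zero>" if "\<phi> \<in> killed n" for \<phi>
    proof -
      have "\<phi> \<in> carrier H" using that by (simp add: killed_def)
      then show ?thesis using P that cl by (simp add: r_right_minus_eq)
    qed
    then obtain \<sigma> where \<sigma>: "\<sigma> \<in> G \<rightarrow> mpow n" "\<And>\<phi>. \<phi> \<in> killed (Suc n) \<Longrightarrow> ?l \<phi> = \<tau> (\<phi> (comb \<sigma>))"
      using represent_step[OF H.K_linear_diff[OF Hsub l pairing_K_linear[OF \<rho>W]]] by blast
    have \<sigma>R: "\<sigma> \<in> G \<rightarrow> carrier R" using \<sigma>(1) mpow_in_R by blast
    let ?\<rho>' = "\<lambda>g. \<rho> g \<oplus> \<sigma> g"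
    have "?\<rho>' \<in> G \<rightarrow> carrier R" using P \<sigma>R by blast
    moreover have "l \<phi> = \<tau> (\<phi> (comb ?\<rho>'))" if "\<phi> \<in> killed (Suc n)" for \<phi>
    proof -
      have \<phi>: "\<phi> \<in> carrier H" using that by (simp add: killed_def)
      have "\<tau> (\<phi> (comb ?\<rho>')) = \<tau> (\<phi> (comb \<rho>)) \<oplus> \<tau> (\<phi> (comb \<sigma>))"
        unfolding comb_add[OF conjunct1[OF P] \<sigma>R]
        by (rule additive_map_add[OF pairing_additive[OF \<phi>] \<rho>W comb_closed[OF \<sigma>R]])
      also have "\<dots> = l \<phi>"
        unfolding \<sigma>(2)[OF that, symmetric] using cl[OF \<phi>] by (simp add: minus_eq a_lcomm r_neg)
      finally show ?thesis by simp
    qed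
    moreover have "?\<rho>' g \<ominus> \<rho> g \<in> mpow n" if g: "g \<in> G" for g
    proof -
      have "\<rho> g \<in> carrier R" "\<sigma> g \<in> carrier R" using P \<sigma>R g by blast+
      then have "?\<rho>' g \<ominus> \<rho> g = \<sigma> g"
        by (simp add: minus_eq a_comm[of "\<rho> g" "\<sigma> g"] a_assoc r_neg)
      then show ?thesis using \<sigma>(1) g by auto
    qed
    ultimately show "\<exists>\<rho>'. ?P (Suc n) \<rho>' \<and> ?Q n \<rho> \<rho>'" by blast
  qed
  then obtain \<rho> where P: "\<And>n. ?P n (\<rho> n)" and Q: "\<And>n g. g \<in> G \<Longrightarrow> \<rho> (Suc n) g \<ominus> \<rho> n g \<in> mpow n"
    by blast
  have "\<exists>x\<in>carrier R. \<forall>n. x \<ominus> \<rho> n g \<in> mpow n" if g: "g \<in> G" for g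
  proof -
    have "\<rho> n g \<in> carrier R" for n using P g by blast
    then show ?thesis using limits[of "\<lambda>n. \<rho> n g"] Q[OF g] unfolding mpow_def by blast
  qed
  then obtain x where x: "\<And>g. g \<in> G \<Longrightarrow> x g \<in> carrier R" "\<And>g n. g \<in> G \<Longrightarrow> x g \<ominus> \<rho> n g \<in> mpow n"
    by metis
  have xR: "x \<in> G \<rightarrow> carrier R" using x(1) by blast
  have "l \<phi> = \<tau> (\<phi> (comb x))" if \<phi>: "\<phi> \<in> carrier H" for \<phi>
  proof -
    obtain n where n: "\<phi> \<in> killed n" using killed_exhausts[OF \<phi>] by blast
    let ?d = "\<lambda>g. x g \<ominus> \<rho> n g"
    have d: "?d \<in> G \<rightarrow> mpow n" using x(2) by blast
    have dR: "?d \<in> G \<rightarrow> carrier R" using d mpow_in_R by blast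
    have \<rho>R: "\<rho> n \<in> G \<rightarrow> carrier R" using P by blast
    have "comb x = comb (\<lambda>g. \<rho> n g \<oplus> ?d g)"
    proof (rule comb_cong)
      fix g assume "g \<in> G"
      then have "\<rho> n g \<in> carrier R" "x g \<in> carrier R" using P x by blast+
      then show "x g = \<rho> n g \<oplus> ?d g" by (simp add: minus_eq a_lcomm r_neg)
    qed (use \<rho>R dR in auto)
    then have "\<tau> (\<phi> (comb x)) = \<tau> (\<phi> (comb (\<rho> n))) \<oplus> \<tau> (\<phi> (comb ?d))"
      unfolding comb_add[OF \<rho>R dR]
      using additive_map_add[OF pairing_additive[OF \<phi>] comb_closed[OF \<rho>R] comb_closed[OF dR]] by simp
    also have "\<dots> = l \<phi>"
      using killed_comb[OF n d] \<tau>_zero P n \<tau>_in_R[OF H_closed[OF \<phi> comb_closed[OF \<rho>R]]] by simp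
    finally show ?thesis by simp
  qed
  then show ?thesis using comb_closed[OF xR] by blast
qed

end


section \<open>The right module structure\<close>

lemma left_D_action_transport:
  assumes act: "left_D_action R K N act" and M: "module R M"
    and f: "f \<in> mod_hom R M N" and bij: "bij_betw f (carrier M) (carrier N)"
  shows "\<exists>act'. left_D_action R K M act'"
proof
  interpret M: module R M by fact
  define act' where "act' = (\<lambda>\<xi> x. inv_into (carrier M) f (act \<xi> (f x)))"
  note fc = mod_hom_closed[OF f]
  have eqI: "x = y" if "x \<in> carrier M" "y \<in> carrier M" "f x = f y" for x y
    using bij that by (auto simp: bij_betw_def dest: inj_onD)
  have closed: "act' \<xi> x \<in> carrier M" and f_act': "f (act' \<xi> x) = act \<xi> (f x)"
    if "\<xi> \<in> carrier (diff_ops R K)" "x \<in> carrier M" for \<xi> x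
    using left_D_action_closed[OF act that(1) fc[OF that(2)]] bij
    by (auto simp: act'_def bij_betw_def inv_into_into f_inv_into_f)
  show "left_D_action R K M act'"
  proof (rule left_D_actionI)
    fix \<xi> assume \<xi>: "\<xi> \<in> carrier (diff_ops R K)"
    show "additive_map M M (act' \<xi>)"
    proof (rule additive_mapI[OF closed[OF \<xi>]])
      fix x y assume xy: "x \<in> carrier M" "y \<in> carrier M"
      show "act' \<xi> (x \<oplus>\<^bsub>M\<^esub> y) = act' \<xi> x \<oplus>\<^bsub>M\<^esub> act' \<xi> y"
        by (rule eqI) (use xy \<xi> in \<open>simp_all add: closed f_act' mod_hom_add[OF f] fc
          additive_map_add[OF left_D_action_additive[OF act \<xi>]]\<close>)
    qed
    fix \<eta> x assume \<eta>: "\<eta> \<in> carrier (diff_ops R K)" and x: "x \<in> carrier M"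
    have "act (\<xi> \<otimes>\<^bsub>diff_ops R K\<^esub> \<eta>) (f x) = f (act' \<xi> (act' \<eta> x))"
      using x \<xi> \<eta> by (simp add: closed f_act' fc left_D_action_mult[OF act])
    then show "act' (\<xi> \<otimes>\<^bsub>diff_ops R K\<^esub> \<eta>) x = act' \<xi> (act' \<eta> x)"
      using closed[OF \<xi> closed[OF \<eta> x]] bij unfolding act'_def
      by (simp add: bij_betw_def inv_into_f_f)
    have "act (\<xi> \<oplus>\<^bsub>diff_ops R K\<^esub> \<eta>) (f x) = f (act' \<xi> x \<oplus>\<^bsub>M\<^esub> act' \<eta> x)"
      using x \<xi> \<eta> by (simp add: closed f_act' fc mod_hom_add[OF f] left_D_action_plus[OF act])
    then show "act' (\<xi> \<oplus>\<^bsub>diff_ops R K\<^esub> \<eta>) x = act' \<xi> x \<oplus>\<^bsub>M\<^esub> act' \<eta> x"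
      using closed[OF \<xi> x] closed[OF \<eta> x] bij unfolding act'_def
      by (simp add: bij_betw_def inv_into_f_f)
  next
    fix r x assume r: "r \<in> carrier R" and x: "x \<in> carrier M"
    have "act (mult_op R r) (f x) = f (r \<odot>\<^bsub>M\<^esub> x)"
      using r x by (simp add: left_D_action_mult_op[OF act] fc mod_hom_smult[OF f])
    then show "act' (mult_op R r) x = r \<odot>\<^bsub>M\<^esub> x"
      using r x bij by (simp add: act'_def bij_betw_def inv_into_f_f)
  qed
qed

text \<open>Since \<mm> is finitely generated, the generators selected by \<open>SOME\<close> in
  \<open>local_cohomology\<close> do generate \<mm> and lie in R, so the action on their Cech
  cohomology applies.\<close>

lemma (in noetherian_local_ring) local_cohomology_action:
  assumes "K \<subseteq> carrier R"
  shows "\<exists>act. left_D_action R K (local_cohomology R \<mm> p) act"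
proof -
  interpret operator_ring R K by (intro operator_ring.intro operator_ring_axioms.intro is_cring assms)
  have "\<exists>xs. set xs \<subseteq> carrier R \<and> Idl (set xs) = \<mm>"
    using finetely_gen[OF maximalideal.axioms(1)[OF maximal]] finite_list by metis
  from someI_ex[OF this] show ?thesis
    unfolding local_cohomology_def using cech_cohomology_action by blast
qed

text \<open>The element \<open>s\<close> is the image of 1 from the residue field. A nonzero cyclic
  submodule R e contains a nonzero element of the embedded residue field; this is c s with c in K
  because R = K + \<mm> and \<mm> kills s, and c can be divided out.\<close>

lemma matlis_exists:
  fixes R :: "('a, 'r) ring_scheme" (structure) and E :: "('a, 'e, 's) module_scheme"
  assumes "complete_local_ring R \<mm>" and K: "coefficient_field R \<mm> K"
    and E: "injective_hull R (residue_module R \<mm>) E"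
  shows "\<exists>s. matlis R \<mm> E K s"
proof -
  interpret complete_local_ring R \<mm> by fact
  note I = ideal_m
  interpret m: abelian_subgroup \<mm> R
    by (intro abelian_subgroupI3 ideal.axioms(1)[OF I] is_abelian_group)
  let ?k = "residue_module R \<mm>"
  have K_sub: "subfield K R" and K_iso: "(\<lambda>x. \<mm> +>\<^bsub>R\<^esub> x) \<in> ring_iso (R\<lparr>carrier := K\<rparr>) (R Quot \<mm>)"
    using K by (auto simp: coefficient_field_def)
  have KR: "c \<in> carrier R" if "c \<in> K" for c using subfieldE(3)[OF K_sub] that by blast
  have mR: "x \<in> carrier R" if "x \<in> \<mm>" for x using ideal.Icarr[OF I that] .
  have inj: "injective_module R E" using E by (simp add: injective_hull_def)
  interpret E: module R E using inj by (simp add: injective_module_def)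
  interpret E: field_module R E K
    by (intro field_module.intro field_module_axioms.intro E.module_axioms K_sub)
  obtain \<iota> where \<iota>: "\<iota> \<in> mod_hom R ?k E" "inj_on \<iota> (carrier ?k)"
    and ess: "\<And>A. \<lbrakk>submodule A R E; A \<noteq> {\<zero>\<^bsub>E\<^esub>}\<rbrakk> \<Longrightarrow> A \<inter> \<iota> ` carrier ?k \<noteq> {\<zero>\<^bsub>E\<^esub>}"
    using E by (auto simp: injective_hull_def)
  have coset: "\<mm> +>\<^bsub>regular_module R\<^esub> y = \<mm> +> y" for y
    by (simp add: a_r_coset_def')
  have k_carrier: "X \<in> carrier ?k \<longleftrightarrow> (\<exists>y\<in>carrier R. X = \<mm> +> y)" for X
    by (auto simp: residue_module_def quotient_module_def A_RCOSETS_def' coset)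
  have k_smult: "y \<odot>\<^bsub>?k\<^esub> (\<mm> +> \<one>) = \<mm> +> y" if y: "y \<in> carrier R" for y
  proof -
    have "(\<Union>x\<in>\<mm> +> \<one>. \<mm> +> (y \<otimes> x)) = \<mm> +> y"
    proof (rule UN_constant_eq)
      show "\<one> \<in> \<mm> +> \<one>" using m.a_rcos_self by blast
      show "\<forall>x\<in>\<mm> +> \<one>. \<mm> +> (y \<otimes> x) = \<mm> +> y"
      proof
        fix x assume "x \<in> \<mm> +> \<one>"
        then obtain z where z: "z \<in> \<mm>" "x = z \<oplus> \<one>" by (auto simp: a_r_coset_def')
        have "y \<otimes> x = y \<otimes> z \<oplus> y" using z mR y by (simp add: r_distr)
        then have "y \<otimes> x \<in> \<mm> +> y"
          using ideal.I_l_closed[OF I z(1) y] by (auto simp: a_r_coset_def')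
        then show "\<mm> +> (y \<otimes> x) = \<mm> +> y"
          using a_repr_independence[OF _ y m.a_subgroup] by simp
      qed
    qed
    then show ?thesis by (simp add: residue_module_def quotient_module_def coset)
  qed
  define s where "s = \<iota> (\<mm> +> \<one>)"
  have one_k: "\<mm> +> \<one> \<in> carrier ?k" using k_carrier by blast
  have s: "s \<in> carrier E" using mod_hom_closed[OF \<iota>(1) one_k] by (simp add: s_def)
  have \<iota>_eq: "\<iota> (\<mm> +> y) = y \<odot>\<^bsub>E\<^esub> s" if "y \<in> carrier R" for y
    using mod_hom_smult[OF \<iota>(1) that one_k] k_smult[OF that] by (simp add: s_def)
  have coset_m: "\<mm> +> x = \<mm> +> \<zero>" if "x \<in> \<mm>" for x
    using a_repr_independence[OF _ zero_closed m.a_subgroup, of x] that mR[OF that]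
    by (force simp: a_r_coset_def')
  have residue: "\<exists>c\<in>K. \<exists>x\<in>\<mm>. r = c \<oplus> x" if r: "r \<in> carrier R" for r
  proof -
    have "\<mm> +> r \<in> carrier (R Quot \<mm>)" using r by (auto simp: FactRing_def A_RCOSETS_def')
    moreover have "(\<lambda>x. \<mm> +> x) ` K = carrier (R Quot \<mm>)"
      using K_iso by (simp add: ring_iso_def bij_betw_def)
    ultimately obtain c where c: "c \<in> K" "\<mm> +> c = \<mm> +> r"
      by (metis (no_types, lifting) imageE)
    then have "r \<in> \<mm> +> c" using m.a_rcos_self[OF r] by simp
    then obtain x where x: "x \<in> \<mm>" "r = x \<oplus> c" by (auto simp: a_r_coset_def')
    then have "r = c \<oplus> x" using a_comm[OF mR[OF x(1)] KR[OF c(1)]] by simp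
    then show ?thesis using c(1) x(1) by blast
  qed
  have "matlis R \<mm> E K s"
  proof (intro matlis.intro matlis_axioms.intro complete_local_ring_axioms E.field_module_axioms)
    show "\<exists>c\<in>K. \<exists>x\<in>\<mm>. r = c \<oplus> x" if "r \<in> carrier R" for r by (rule residue[OF that])
    show "s \<in> carrier E" by (rule s)
    show "x \<odot>\<^bsub>E\<^esub> s = \<zero>\<^bsub>E\<^esub>" if x: "x \<in> \<mm>" for x
      using \<iota>_eq[OF mR[OF x]] coset_m[OF x] \<iota>_eq[OF zero_closed] s by simp
    show "s \<noteq> \<zero>\<^bsub>E\<^esub>"
    proof
      assume "s = \<zero>\<^bsub>E\<^esub>"
      then have "\<iota> (\<mm> +> \<one>) = \<iota> (\<mm> +> \<zero>)" using \<iota>_eq[OF zero_closed] by (simp add: s_def)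
      moreover have "\<mm> +> \<zero> \<in> carrier ?k" using k_carrier by blast
      ultimately have "\<mm> +> \<one> = \<mm> +> \<zero>" using inj_onD[OF \<iota>(2) _ one_k] by blast
      then have "\<one> \<in> \<mm> +> \<zero>" using m.a_rcos_self[OF one_closed] by simp
      then show False using one_notin_maximal mR by (auto simp: a_r_coset_def')
    qed
    show "\<exists>r\<in>carrier R. r \<odot>\<^bsub>E\<^esub> e = s" if e: "e \<in> carrier E" "e \<noteq> \<zero>\<^bsub>E\<^esub>" for e
    proof -
      let ?A = "{r \<odot>\<^bsub>E\<^esub> e | r. r \<in> carrier R}"
      have A: "submodule ?A R E"
      proof (rule E.submoduleI)
        show "?A \<subseteq> carrier E" using e(1) by blast
        show "\<zero>\<^bsub>E\<^esub> \<in> ?A" using e(1) by (intro CollectI exI[of _ \<zero>]) simp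
        fix a assume "a \<in> ?A"
        then obtain r where a: "a = r \<odot>\<^bsub>E\<^esub> e" "r \<in> carrier R" by blast
        show "\<ominus>\<^bsub>E\<^esub> a \<in> ?A" using a e(1) by (intro CollectI exI[of _ "\<ominus> r"]) (simp add: E.smult_l_minus)
        show "a \<oplus>\<^bsub>E\<^esub> b \<in> ?A" if b: "b \<in> ?A" for b
        proof -
          obtain r' where "b = r' \<odot>\<^bsub>E\<^esub> e" "r' \<in> carrier R" using b by blast
          then show ?thesis using a e(1) by (intro CollectI exI[of _ "r \<oplus> r'"]) (simp add: E.smult_l_distr)
        qed
        show "t \<odot>\<^bsub>E\<^esub> a \<in> ?A" if "t \<in> carrier R" for t
          using that a e(1) by (intro CollectI exI[of _ "t \<otimes> r"]) (simp add: E.smult_assoc1)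
      qed
      have "e \<in> ?A" using e(1) by (intro CollectI exI[of _ \<one>]) simp
      then have "?A \<noteq> {\<zero>\<^bsub>E\<^esub>}" using e(2) singletonD by fastforce
      from ess[OF A this] obtain X where X: "X = ?A \<inter> \<iota> ` carrier ?k" "X \<noteq> {\<zero>\<^bsub>E\<^esub>}"
        by simp
      have "\<zero>\<^bsub>E\<^esub> = \<iota> (\<mm> +> \<zero>)" using \<iota>_eq[OF zero_closed] s by simp
      then have "\<zero>\<^bsub>E\<^esub> \<in> \<iota> ` carrier ?k" using k_carrier by blast
      then have "\<zero>\<^bsub>E\<^esub> \<in> X" unfolding X(1)
        by (intro IntI CollectI exI[of _ \<zero>]) (use e(1) in simp_all)
      \<comment> \<open>Essentiality says only that the intersection is different from {0}; a
        nonzero element exists because the intersection does contain 0.\<close>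
      with X(2) have "\<exists>t. t \<in> X \<and> t \<noteq> \<zero>\<^bsub>E\<^esub>" by fast
      then obtain t where t: "t \<in> ?A" "t \<in> \<iota> ` carrier ?k" "t \<noteq> \<zero>\<^bsub>E\<^esub>"
        unfolding X(1) by (elim exE conjE IntE)
      obtain r where r: "r \<in> carrier R" "t = r \<odot>\<^bsub>E\<^esub> e" using t(1) by blast
      obtain y where y: "y \<in> carrier R" "t = y \<odot>\<^bsub>E\<^esub> s" using t(2) k_carrier \<iota>_eq by auto
      obtain c x where cx: "c \<in> K" "x \<in> \<mm>" "y = c \<oplus> x" using residue[OF y(1)] by blast
      have "x \<odot>\<^bsub>E\<^esub> s = \<zero>\<^bsub>E\<^esub>"
        using \<iota>_eq[OF mR[OF cx(2)]] coset_m[OF cx(2)] \<iota>_eq[OF zero_closed] s by simp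
      then have tc: "t = c \<odot>\<^bsub>E\<^esub> s"
        using y(2) cx s KR[OF cx(1)] mR[OF cx(2)] by (simp add: E.smult_l_distr)
      then have "c \<noteq> \<zero>" using t(3) s by auto
      then obtain d where d: "d \<in> K" "d \<otimes> c = \<one>" using E.K_inverse[OF cx(1)] by blast
      have "s = d \<odot>\<^bsub>E\<^esub> t" using tc d s KR[OF d(1)] KR[OF cx(1)] by (simp flip: E.smult_assoc1)
      then have "(d \<otimes> r) \<odot>\<^bsub>E\<^esub> e = s" using r e(1) KR[OF d(1)] by (simp add: E.smult_assoc1)
      then show ?thesis using r(1) KR[OF d(1)] by blast
    qed
    fix J f assume J: "ideal J R" and f: "f \<in> mod_hom R ((regular_module R)\<lparr>carrier := J\<rparr>) E"
    have JR: "a \<in> carrier R" if "a \<in> J" for a using ideal.Icarr[OF J that] .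
    have "submodule J R (regular_module R)"
    proof (rule module.submoduleI[OF regular_module])
      fix a assume a: "a \<in> J"
      have "\<ominus>\<^bsub>regular_module R\<^esub> a = \<ominus> a"
        using additive_map_minus[OF module.axioms(2)[OF regular_module] is_abelian_group, of "\<lambda>x. x" a] JR[OF a]
        by (simp add: additive_map_def)
      then show "\<ominus>\<^bsub>regular_module R\<^esub> a \<in> J"
        using additive_subgroup.a_inv_closed[OF ideal.axioms(1)[OF J] a] by simp
    qed (use JR in \<open>simp_all add: subsetI additive_subgroup.zero_closed[OF ideal.axioms(1)[OF J]]
        additive_subgroup.a_closed[OF ideal.axioms(1)[OF J]] ideal.I_l_closed[OF J]\<close>)
    \<comment> \<open>This is the instance of injectivity for R as a module over itself, whose
      elements have the type over which the definition quantifies.\<close>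
    with f regular_module
    have "module R (regular_module R) \<and> submodule J R (regular_module R) \<and>
        f \<in> mod_hom R ((regular_module R)\<lparr>carrier := J\<rparr>) E" by simp
    then show "\<exists>g\<in>mod_hom R (regular_module R) E. \<forall>x\<in>J. g x = f x"
      using conjunct2[OF inj[unfolded injective_module_def]] by (elim allE impE)
  qed
  then show ?thesis ..
qed

context matlis_dual
begin

text \<open>The product w \<xi> is defined by \<tau> (\<phi> (w \<xi>)) = \<tau> ((\<xi> \<phi>) w)
  for all \<phi> in H: it exists by \<open>represent\<close> and is unique by nondegeneracy of the
  pairing. Each module law is then tested against all \<phi>.\<close>

lemma right_D_module:
  assumes act: "left_D_action R K H B"
  shows "\<exists>ract. compatible_right_D_module R K W ract"
proof -
  interpret operator_ring R K
    by (intro operator_ring.intro operator_ring_axioms.intro is_cring subfieldE(3)[OF E.K_subfield])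
  let ?D = "diff_ops R K"
  note Bc = left_D_action_closed[OF act] and Ba = additive_map_add[OF left_D_action_additive[OF act]]
  have eqI: "v = w" if v: "v \<in> carrier W" and w: "w \<in> carrier W"
    and e: "\<And>\<phi>. \<phi> \<in> carrier H \<Longrightarrow> \<tau> (\<phi> v) = \<tau> (\<phi> w)" for v w
  proof -
    have "v \<ominus>\<^bsub>W\<^esub> w = \<zero>\<^bsub>W\<^esub>"
    proof (rule pairing_nondegenerate)
      fix \<phi> assume \<phi>: "\<phi> \<in> carrier H"
      note a = pairing_additive[OF \<phi>]
      have "\<tau> (\<phi> (v \<ominus>\<^bsub>W\<^esub> w)) = \<tau> (\<phi> v) \<oplus> \<ominus> \<tau> (\<phi> w)"
        using additive_map_add[OF a v W.a_inv_closed[OF w]]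
          additive_map_minus[OF W.abelian_group_axioms is_abelian_group a w] by (simp add: W.M.minus_eq)
      then show "\<tau> (\<phi> (v \<ominus>\<^bsub>W\<^esub> w)) = \<zero>"
        using e[OF \<phi>] \<tau>_in_R[OF H_closed[OF \<phi> w]] by (simp add: r_neg)
    qed (use v w in simp)
    then have "\<ominus>\<^bsub>W\<^esub> (\<ominus>\<^bsub>W\<^esub> w) = v"
      using v w by (intro W.M.minus_equality) (simp_all add: W.M.minus_eq)
    then show ?thesis using w by simp
  qed
  \<comment> \<open>Here the K-linearity of operators enters: \<xi> commutes with multiplication by
    c as an operator on R, hence also in the action on H. This makes \<phi> \<mapsto> \<tau> ((\<xi>
    \<phi>) w) a K-linear functional, to which \<open>represent\<close> applies.\<close>
  have commute: "B \<xi> (c \<odot>\<^bsub>H\<^esub> \<phi>) = c \<odot>\<^bsub>H\<^esub> B \<xi> \<phi>"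
    if \<xi>: "\<xi> \<in> carrier ?D" and c: "c \<in> K" and \<phi>: "\<phi> \<in> carrier H" for \<xi> c \<phi>
  proof -
    note cR = E.K_in_R[OF c]
    have "\<xi> \<otimes>\<^bsub>?D\<^esub> mult_op R c = mult_op R c \<otimes>\<^bsub>?D\<^esub> \<xi>"
      using End_ring_closed[OF diff_ops_End[OF \<xi>]] End_ring_scalar[OF diff_ops_End[OF \<xi>] c] cR
      by (auto simp: diff_ops_simps End_ring_simps compose_def mult_op_def intro!: restrict_ext)
    then have "B \<xi> (B (mult_op R c) \<phi>) = B (mult_op R c) (B \<xi> \<phi>)"
      using left_D_action_mult[OF act \<xi> mult_op_diff_ops[OF cR] \<phi>]
        left_D_action_mult[OF act mult_op_diff_ops[OF cR] \<xi> \<phi>] by simp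
    then show ?thesis using left_D_action_mult_op[OF act cR] \<phi> Bc[OF \<xi> \<phi>] by simp
  qed
  have "\<exists>w'\<in>carrier W. \<forall>\<phi>\<in>carrier H. \<tau> (B \<xi> \<phi> w) = \<tau> (\<phi> w')"
    if \<xi>: "\<xi> \<in> carrier ?D" and w: "w \<in> carrier W" for \<xi> w
  proof (rule represent)
    note p = pairing_K_linear[OF w]
    show "K_linear R K H (carrier H) (\<lambda>\<phi>. \<tau> (B \<xi> \<phi> w))"
      unfolding K_linear_def
      using K_linear_mem[OF p Bc[OF \<xi>]] K_linear_add[OF p Bc[OF \<xi>] Bc[OF \<xi>]] K_linear_smult[OF p _ Bc[OF \<xi>]]
      by (simp add: Ba[OF \<xi>] commute[OF \<xi>])
  qed
  then have "\<forall>\<xi>\<in>carrier ?D. \<forall>w\<in>carrier W. \<exists>w'. w' \<in> carrier W \<and> (\<forall>\<phi>\<in>carrier H. \<tau> (B \<xi> \<phi> w) = \<tau> (\<phi> w'))"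
    by blast
  then obtain ract' where "\<forall>\<xi>\<in>carrier ?D. \<forall>w\<in>carrier W. ract' \<xi> w \<in> carrier W \<and>
      (\<forall>\<phi>\<in>carrier H. \<tau> (B \<xi> \<phi> w) = \<tau> (\<phi> (ract' \<xi> w)))"
    unfolding bchoice_iff by blast
  then obtain ract where ract: "\<And>\<xi> w. \<lbrakk>\<xi> \<in> carrier ?D; w \<in> carrier W\<rbrakk> \<Longrightarrow> ract w \<xi> \<in> carrier W"
      "\<And>\<xi> w \<phi>. \<lbrakk>\<xi> \<in> carrier ?D; w \<in> carrier W; \<phi> \<in> carrier H\<rbrakk> \<Longrightarrow> \<tau> (\<phi> (ract w \<xi>)) = \<tau> (B \<xi> \<phi> w)"
    using that[of "\<lambda>w \<xi>. ract' \<xi> w"] by simp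
  note plus = K_linear_add[OF \<tau>]
  \<comment> \<open>Since \<phi> is R-linear, f \<phi> at w is \<phi> at f w, so multiplication by f
    is its own transpose. This is compatibility with the given R-module structure.\<close>
  have ract_op: "ract w (mult_op R f) = f \<odot>\<^bsub>W\<^esub> w" if f: "f \<in> carrier R" and w: "w \<in> carrier W" for f w
  proof (rule eqI)
    fix \<phi> assume \<phi>: "\<phi> \<in> carrier H"
    show "\<tau> (\<phi> (ract w (mult_op R f))) = \<tau> (\<phi> (f \<odot>\<^bsub>W\<^esub> w))"
      using \<phi> f w by (simp add: ract mult_op_diff_ops left_D_action_mult_op[OF act] Hom_module_simps(4) H_smult)
  qed (use f w in \<open>simp_all add: ract mult_op_diff_ops\<close>)
  have "right_module ?D W ract"
  proof (intro right_module.intro right_module_axioms.intro diff_ops_ring W.abelian_group_axioms)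
    fix x \<xi> assume x: "x \<in> carrier W" and \<xi>: "\<xi> \<in> carrier ?D"
    show "ract x \<xi> \<in> carrier W" by (rule ract(1)[OF \<xi> x])
    show "ract (x \<oplus>\<^bsub>W\<^esub> y) \<xi> = ract x \<xi> \<oplus>\<^bsub>W\<^esub> ract y \<xi>" if y: "y \<in> carrier W" for y
      by (rule eqI) (use x y \<xi> in \<open>simp_all add: ract H_add Bc H_closed plus\<close>)
    fix \<eta> assume \<eta>: "\<eta> \<in> carrier ?D"
    have D: "\<xi> \<otimes>\<^bsub>?D\<^esub> \<eta> \<in> carrier ?D" "\<xi> \<oplus>\<^bsub>?D\<^esub> \<eta> \<in> carrier ?D"
      using diff_ops_mult[OF \<xi> \<eta>] diff_ops_add[OF \<xi> \<eta>] by (simp_all add: diff_ops_simps)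
    show "ract x (\<xi> \<oplus>\<^bsub>?D\<^esub> \<eta>) = ract x \<xi> \<oplus>\<^bsub>W\<^esub> ract x \<eta>"
      by (rule eqI) (use x \<xi> \<eta> D in \<open>simp_all add: ract H_add Bc H_closed plus
        left_D_action_plus[OF act] Hom_module_simps(3)\<close>)
    \<comment> \<open>The order of the factors turns around once under transposition: \<tau> ((\<xi>
      (\<eta> \<phi>)) x) = \<tau> ((\<eta> \<phi>) (x \<xi>)) = \<tau> (\<phi> ((x \<xi>)
      \<eta>)).\<close>
    show "ract x (\<xi> \<otimes>\<^bsub>?D\<^esub> \<eta>) = ract (ract x \<xi>) \<eta>"
      by (rule eqI) (use x \<xi> \<eta> D in \<open>simp_all add: ract Bc left_D_action_mult[OF act]\<close>)
  next
    fix x assume "x \<in> carrier W"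
    then show "ract x \<one>\<^bsub>?D\<^esub> = x" by (simp add: diff_ops_simps ract_op)
  qed
  then show ?thesis using ract_op unfolding compatible_right_D_module_def by blast
qed

end

theorem theorem3p6:
  fixes R :: "('a, 'r) ring_scheme" and \<mm> K :: "'a set"
    and E :: "('a, 'e) module" and \<omega> :: "('a, 'w) module"
  assumes "complete_local_ring R \<mm>"
    and "cohen_macaulay R \<mm>"
    and "coefficient_field R \<mm> K"
    and "injective_hull R (residue_module R \<mm>) E"
    and "canonical_module R \<mm> E \<omega>"
  shows "\<exists>act. compatible_right_D_module R K \<omega> act"
proof -
  obtain s where s: "matlis R \<mm> E K s"
    using matlis_exists[OF assms(1,3,4)] by blast
  interpret matlis R \<mm> E K s by (rule s)
  have W: "module R \<omega>" "finitely_generated R \<omega>"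
    "mod_isomorphic R (Hom_module R \<omega> E) (local_cohomology R \<mm> (the_enat (krull_dim R)))"
    using assms(5) by (simp_all add: canonical_module_def)
  obtain \<tau> where \<tau>: "K_linear R K E (carrier E) \<tau>" "\<tau> s = \<one>\<^bsub>R\<^esub>"
    using E.K_linear_exists[OF s_closed s_nonzero] by blast
  obtain G where G: "finite G" "G \<subseteq> carrier \<omega>" "\<And>N. \<lbrakk>submodule N R \<omega>; G \<subseteq> N\<rbrakk> \<Longrightarrow> N = carrier \<omega>"
    using W(2) unfolding finitely_generated_def by blast
  interpret matlis_dual R \<mm> E K s \<omega> \<tau> G
    by (intro matlis_dual.intro matlis_module.intro matlis_dual_axioms.intro s W(1) \<tau> G)
  obtain act where "left_D_action R K (local_cohomology R \<mm> (the_enat (krull_dim R))) act"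
    using local_cohomology_action[OF subfieldE(3)[OF E.K_subfield]] by blast
  moreover obtain f where "f \<in> mod_hom R (Hom_module R \<omega> E) (local_cohomology R \<mm> (the_enat (krull_dim R)))"
    "bij_betw f (carrier (Hom_module R \<omega> E)) (carrier (local_cohomology R \<mm> (the_enat (krull_dim R))))"
    using W(3) unfolding mod_isomorphic_def by (elim bexE)
  ultimately obtain B where "left_D_action R K (Hom_module R \<omega> E) B"
    using left_D_action_transport[OF _ WE.module_Hom_module] by blast
  then show ?thesis by (rule right_D_module)
qed

end
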